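(* Let $\Gamma\subset\mathbb R^n$ be a regular cone such that for every $y'\in\Gamma$ $$\lim_{\widetilde y\in\overline{y'+\Gamma},\ |\widetilde y|\to\infty}K(x+i\widetilde y,\overline{x+i\widetilde y})=0 .$$ Let $F\in H^2(T_\Gamma)$ and let $\{z^{(k)}\}_{k=1}^\infty\subset T_\Gamma$ be a sequence (repetitions allowed) each element of which is selected according to the pre-orthogonal maximal selection principle, i.e. for every $m\ge0$, $$|\langle F,\mathcal B_{m+1}^{z^{(m+1)}}\rangle|=\max_{z\in T_\Gamma}|\langle F,\mathcal B^z_{m+1}\rangle| .$$ Then $$\lim_{m\to\infty}\Big\|F-\sum_{k=1}^m\langle F,\mathcal B_k\rangle\mathcal B_k\Big\|=0 .$$
   Context: An open cone is a nonempty open $\Gamma\subset\mathbb R^n$ with $0\notin\Gamma$ and $ax+by\in\Gamma$ whenever $x,y\in\Gamma$, $a,b>0$. Its dual is $\Gamma^*=\{t\in\mathbb R^n: x\cdot t\ge0\ \text{for all } x\in\Gamma\}$; $\Gamma$ is regular if $\Gamma^*$ has nonempty interior. $T_\Gamma=\{x+iy:x\in\mathbb R^n,y\in\Gamma\}\subset\mathbb C^n$. $H^2(T_\Gamma)$ is the space of holomorphic $F$ on $T_\Gamma$ with $\|F\|^2=\sup_{y\in\Gamma}\int_{\mathbb R^n}|F(x+iy)|^2dx<\infty$, a Hilbert space with $\langle F,G\rangle=\int_{\mathbb R^n}F(\xi)\overline{G(\xi)}d\xi$, where $F(\xi)=\lim_{\eta\in\Gamma,\eta\to0}F(\xi+i\eta)$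 is the $L^2$ boundary limit. Its reproducing kernel is the Cauchy-Szegő kernel $K(w,\overline z)=\int_{\Gamma^*}e^{2\pi iw\cdot t}\,\overline{e^{2\pi iz\cdot t}}\,dt$, $w,z\in T_\Gamma$; put $\phi_z=K(\cdot,\overline z)$. Note $K(x+iy,\overline{x+iy})=\int_{\Gamma^*}e^{-4\pi y\cdot t}dt$ does not depend on $x$. Multiple kernels: fix a direction $\vec d=(d_1,\dots,d_n)\in\mathbb C^n$ with $\sum_j|d_j|^2=1$ and put $\vec d\cdot\nabla=\sum_{j=1}^n d_j\frac{\partial}{\partial\overline z_j}$. For a finite or infinite sequence $(z^{(1)},z^{(2)},\dots)$ in $T_\Gamma$ let $l_k$ be the cardinality of $\{j\le k: z^{(j)}=z^{(k)}\}$ and $\Phi_{z^{(k)}}=\frac1{(l_k-1)!}(\vec d\cdot\nabla)^{l_k-1}\phi_z|_{z=z^{(k)}}$. $\{\mathcal B_k\}$ is the orthonormal system obtained by applying the Gram-Schmidt process (with normalization) to $\Phi_{z^{(1)}},\Phi_{z^{(2)}},\dots$. Given $z^{(1)},\dots,z^{(m)}$ and $z\in T_\Gamma$, $\mathcal B_{m+1}^z$ denotes the last element of the Gram-Schmidt orthonormalization of $\{\mathcal B_1,\dots,\mathcal B_m,\Phi_z\}$, where $\Phi_z$ is the multiple kernel associated with the last term of the sequence $(z^{(1)},\dots,z^{(m)},z)$; thus $\mathcal B_{m+1}=\mathcal B_{m+1}^{z^{(m+1)}}$. *)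

theory Defs
  imports "HOL-Analysis.Analysis"
begin

subsection \<open>Cones and tubes\<close>

definition open_cone :: "(real^'n) set \<Rightarrow> bool" where
  "open_cone \<Gamma> \<longleftrightarrow> \<Gamma> \<noteq> {} \<and> open \<Gamma> \<and> 0 \<notin> \<Gamma> \<and>
     (\<forall>x\<in>\<Gamma>. \<forall>y\<in>\<Gamma>. \<forall>a>0. \<forall>b>0. a *\<^sub>R x + b *\<^sub>R y \<in> \<Gamma>)"

definition dual_cone :: "(real^'n) set \<Rightarrow> (real^'n) set" where
  "dual_cone \<Gamma> = {t. \<forall>x\<in>\<Gamma>. x \<bullet> t \<ge> 0}"

definition regular_cone :: "(real^'n) set \<Rightarrow> bool" where
  "regular_cone \<Gamma> \<longleftrightarrow> open_cone \<Gamma> \<and> interior (dual_cone \<Gamma>) \<noteq> {}"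

text \<open>The point \<open>x + i y\<close>.\<close>

definition cpoint :: "real^'n \<Rightarrow> real^'n \<Rightarrow> complex^'n" where
  "cpoint x y = (\<chi> j. Complex (x $ j) (y $ j))"

definition tube :: "(real^'n) set \<Rightarrow> (complex^'n) set" where
  "tube \<Gamma> = {cpoint x y | x y. y \<in> \<Gamma>}"

subsection \<open>The Hardy space\<close>

definition vec_holomorphic_on :: "(complex^'n \<Rightarrow> complex) \<Rightarrow> (complex^'n) set \<Rightarrow> bool" where
  "vec_holomorphic_on F S \<longleftrightarrow>
     (\<forall>z\<in>S. \<exists>F'. (F has_derivative F') (at z) \<and> (\<forall>c v. F' (c *s v) = c * F' v))"

definition hardy_norm_sq :: "(real^'n) set \<Rightarrow> (complex^'n \<Rightarrow> complex) \<Rightarrow> ennreal" where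
  "hardy_norm_sq \<Gamma> F = (SUP y\<in>\<Gamma>. \<integral>\<^sup>+x. ennreal ((norm (F (cpoint x y)))\<^sup>2) \<partial>lborel)"

definition hardy_space :: "(real^'n) set \<Rightarrow> (complex^'n \<Rightarrow> complex) set" where
  "hardy_space \<Gamma> = {F. vec_holomorphic_on F (tube \<Gamma>) \<and> hardy_norm_sq \<Gamma> F < \<infinity>}"

text \<open>Elements of the Hardy space are total functions of which only the values on the tube
  matter. The following three notions are meaningful only on the Hardy space; in particular
  \<open>enn2real\<close> sends an infinite supremum to 0.\<close>

definition hardy_norm :: "(real^'n) set \<Rightarrow> (complex^'n \<Rightarrow> complex) \<Rightarrow> real" where
  "hardy_norm \<Gamma> F = sqrt (enn2real (hardy_norm_sq \<Gamma> F))"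

text \<open>A representative of the \<open>L\<^sup>2\<close> boundary limit, which is determined up to a null set.\<close>

definition boundary_value ::
  "(real^'n) set \<Rightarrow> (complex^'n \<Rightarrow> complex) \<Rightarrow> real^'n \<Rightarrow> complex" where
  "boundary_value \<Gamma> F = (SOME f. f \<in> borel_measurable lborel \<and>
     ((\<lambda>\<eta>. \<integral>\<^sup>+\<xi>. ennreal ((norm (F (cpoint \<xi> \<eta>) - f \<xi>))\<^sup>2) \<partial>lborel) \<longlongrightarrow> 0)
       (at 0 within \<Gamma>))"

definition hardy_inner ::
  "(real^'n) set \<Rightarrow> (complex^'n \<Rightarrow> complex) \<Rightarrow> (complex^'n \<Rightarrow> complex) \<Rightarrow> complex" where
  "hardy_inner \<Gamma> F G =
     (LINT \<xi>|lborel. boundary_value \<Gamma> F \<xi> * cnj (boundary_value \<Gamma> G \<xi>))"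

subsection \<open>The Cauchy-Szego kernel and multiple kernels\<close>

definition cdot :: "complex^'n \<Rightarrow> real^'n \<Rightarrow> complex" where
  "cdot w t = (\<Sum>j\<in>UNIV. w $ j * complex_of_real (t $ j))"

text \<open>\<open>szego_kernel \<Gamma> w z\<close> is \<open>K(w, \<close>conjugate of \<open>z)\<close>: the second argument is the point \<open>z\<close>
  itself, and the kernel is antiholomorphic in it.\<close>

definition szego_kernel :: "(real^'n) set \<Rightarrow> complex^'n \<Rightarrow> complex^'n \<Rightarrow> complex" where
  "szego_kernel \<Gamma> w z =
     (LINT t:dual_cone \<Gamma>|lborel.
        exp (2 * of_real pi * \<i> * cdot w t) * cnj (exp (2 * of_real pi * \<i> * cdot z t)))"

text \<open>The Wirtinger derivative with respect to the conjugate of the \<open>j\<close>-th variable.\<close>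

definition wirtinger_bar ::
  "'n \<Rightarrow> (complex^'n \<Rightarrow> complex) \<Rightarrow> complex^'n \<Rightarrow> complex" where
  "wirtinger_bar j f z =
     (vector_derivative (\<lambda>s. f (z + axis j (complex_of_real s))) (at 0) +
      \<i> * vector_derivative (\<lambda>s. f (z + axis j (\<i> * complex_of_real s))) (at 0)) / 2"

definition dir_wirtinger_bar ::
  "complex^'n \<Rightarrow> (complex^'n \<Rightarrow> complex) \<Rightarrow> complex^'n \<Rightarrow> complex" where
  "dir_wirtinger_bar d f z = (\<Sum>j\<in>UNIV. d $ j * wirtinger_bar j f z)"

text \<open>Sequences are indexed from 0: \<open>z k\<close> is the \<open>(k+1)\<close>-st point.\<close>

definition occurrences :: "(nat \<Rightarrow> 'a) \<Rightarrow> nat \<Rightarrow> nat" where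
  "occurrences z k = card {j. j \<le> k \<and> z j = z k}"

definition multiple_kernel ::
  "(real^'n) set \<Rightarrow> complex^'n \<Rightarrow> (nat \<Rightarrow> complex^'n) \<Rightarrow> nat \<Rightarrow> complex^'n \<Rightarrow> complex" where
  "multiple_kernel \<Gamma> d z k =
     (\<lambda>w. 1 / fact (occurrences z k - 1) *
          (dir_wirtinger_bar d ^^ (occurrences z k - 1)) (\<lambda>\<zeta>. szego_kernel \<Gamma> w \<zeta>) (z k))"

subsection \<open>Orthonormalization\<close>

function gram_schmidt ::
  "(real^'n) set \<Rightarrow> (nat \<Rightarrow> complex^'n \<Rightarrow> complex) \<Rightarrow> nat \<Rightarrow> complex^'n \<Rightarrow> complex" where
  "gram_schmidt \<Gamma> f k =
     (let g = (\<lambda>w. f k w - (\<Sum>j<k. hardy_inner \<Gamma> (f k) (gram_schmidt \<Gamma> f j) *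
                                     gram_schmidt \<Gamma> f j w))
      in (\<lambda>w. g w / complex_of_real (hardy_norm \<Gamma> g)))"
  by pat_completeness auto
termination
  by (relation "Wellfounded.measure (\<lambda>(\<Gamma>, f, k). k)") auto

declare gram_schmidt.simps [simp del]

definition onsys ::
  "(real^'n) set \<Rightarrow> complex^'n \<Rightarrow> (nat \<Rightarrow> complex^'n) \<Rightarrow> nat \<Rightarrow> complex^'n \<Rightarrow> complex" where
  "onsys \<Gamma> d z = gram_schmidt \<Gamma> (multiple_kernel \<Gamma> d z)"

text \<open>The last element of the orthonormalization of the first \<open>m\<close> elements of the system
  of \<open>z\<close> followed by the multiple kernel of the last term of \<open>(z 0, \<dots>, z (m - 1), \<zeta>)\<close>.\<close>

definition onsys_next ::
  "(real^'n) set \<Rightarrow> complex^'n \<Rightarrow> (nat \<Rightarrow> complex^'n) \<Rightarrow> nat \<Rightarrow> complex^'n \<Rightarrow>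
     complex^'n \<Rightarrow> complex" where
  "onsys_next \<Gamma> d z m \<zeta> =
     gram_schmidt \<Gamma>
       (\<lambda>k. if k < m then onsys \<Gamma> d z k else multiple_kernel \<Gamma> d (z(m := \<zeta>)) m) m"

definition maximal_selection ::
  "(real^'n) set \<Rightarrow> complex^'n \<Rightarrow> (complex^'n \<Rightarrow> complex) \<Rightarrow> (nat \<Rightarrow> complex^'n) \<Rightarrow> bool" where
  "maximal_selection \<Gamma> d F z \<longleftrightarrow>
     (\<forall>m. z m \<in> tube \<Gamma> \<and>
          (\<forall>\<zeta>\<in>tube \<Gamma>. norm (hardy_inner \<Gamma> F (onsys_next \<Gamma> d z m \<zeta>))
                     \<le> norm (hardy_inner \<Gamma> F (onsys_next \<Gamma> d z m (z m)))))"

end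

(* Elements of the Hardy space are handled without a Paley-Wiener theorem. Integrating Cauchy's theorem
   for a square over the real directions shows that the integral of a holomorphic function over the
   slices Im z = y does not depend on y. Hence the inner product of two slices of F depends only on the
   sum of their heights; as a function of that sum it is bounded and midpoint convex, so it decreases
   along the cone. This gives the L2 boundary limit, and the norm of F as the L2 norm of that limit.
   The reproducing property of the Cauchy-Szego kernel follows from Fourier inversion for the damped
   functions F(z) L(z/n + iv)/L(iv), where L(u) is the integral of exp(2 pi i u.t) over the dual cone.

   For the convergence let H_m be the residual after m steps. Since H_m(\<zeta>) is the inner product of F with the
   unnormalized Gram-Schmidt remainder of the kernel at \<zeta>, maximality of z_m yields
   |H_m(\<zeta>)| <= |<F, B_m>| ||phi_\<zeta>|| for every \<zeta> outside the sequence, and <F, B_m> tends to 0 by Bessel's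
   inequality. So H_m tends to 0 pointwise off a countable set, while it is Cauchy in norm; Fatou's lemma
   on the slices gives norm convergence to 0. *)

theory Submission
  imports Defs "HOL-Complex_Analysis.Cauchy_Integral_Formula" "HOL-Probability.Probability"
begin

subsection \<open>Invariance of slice integrals\<close>

text \<open>A product of two Hardy functions, however, has slices that are uniformly in L1, and for
  such a function the transform of the slice at height y, multiplied by exp(2 pi y.t), does not
  depend on y and vanishes off the dual cone. The damping factors are Hardy functions themselves, so
  that \<open>F\<close> times one of them is of this kind. Of Plancherel's theorem only the upper
  bound enters, to place the kernels and the damping factors in the Hardy space.

  The selection principle compares multiple kernels, and at a point already chosen the next kernel
  is a derivative, which does not represent a point value. Pointwise information is therefore taken
  only at points outside the whole sequence; a countable set meets each slice in a null set.
  Gram-Schmidt divides by the norm of the remainder even when this is 0, which yields the zero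
  function; the arguments allow for norms 0 and 1, so linear independence of the kernels is never an
  issue.\<close>

lemma nn_integral_lborel_shift:
  fixes f :: "'a::euclidean_space \<Rightarrow> ennreal"
  assumes [measurable]: "f \<in> borel_measurable borel"
  shows "(\<integral>\<^sup>+x. f (x + a) \<partial>lborel) = (\<integral>\<^sup>+x. f x \<partial>lborel)"
proof -
  have "(\<integral>\<^sup>+x. f x \<partial>lborel) = (\<integral>\<^sup>+x. f x \<partial>distr lborel borel ((+) a))"
    by (simp add: lborel_distr_plus)
  also have "\<dots> = (\<integral>\<^sup>+x. f (a + x) \<partial>lborel)"
    by (subst nn_integral_distr) auto
  finally show ?thesis by (simp add: add.commute)
qed

lemma integral_lborel_shift:
  fixes f :: "'a::euclidean_space \<Rightarrow> 'b::{banach, second_countable_topology}"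
  assumes [measurable]: "f \<in> borel_measurable borel"
  shows "(LINT x|lborel. f (x + a)) = (LINT x|lborel. f x)"
proof -
  have "(LINT x|lborel. f x) = (LINT x|distr lborel borel ((+) a). f x)"
    by (simp add: lborel_distr_plus)
  also have "\<dots> = (LINT x|lborel. f (a + x))"
    by (subst integral_distr) auto
  finally show ?thesis by (simp add: add.commute)
qed

text \<open>Tonelli with the first variable integrated first: in the applications the inner integral
  over \<open>x\<close> is controlled by translation invariance or factors as a product.\<close>

lemma integrable_pair_lborelI:
  fixes f :: "'a::euclidean_space \<times> 'b::euclidean_space \<Rightarrow> complex"
  assumes [measurable]: "f \<in> borel_measurable (lborel \<Otimes>\<^sub>M lborel)"
    and "\<And>s. (\<integral>\<^sup>+x. norm (f (x, s)) \<partial>lborel) \<le> g s"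
    and "(\<integral>\<^sup>+s. g s \<partial>lborel) < \<infinity>"
  shows "integrable (lborel \<Otimes>\<^sub>M lborel) f"
proof (rule integrableI_bounded)
  have "(\<integral>\<^sup>+p. norm (f p) \<partial>(lborel \<Otimes>\<^sub>M lborel)) = (\<integral>\<^sup>+s. (\<integral>\<^sup>+x. norm (f (x, s)) \<partial>lborel) \<partial>lborel)"
    by (subst lborel_pair.nn_integral_snd[symmetric]) auto
  also have "\<dots> \<le> (\<integral>\<^sup>+s. g s \<partial>lborel)"
    by (intro nn_integral_mono assms)
  finally show "(\<integral>\<^sup>+p. norm (f p) \<partial>(lborel \<Otimes>\<^sub>M lborel)) < \<infinity>"
    using assms(3) by (meson le_less_trans)
qed fact

section \<open>Points of the tube as pairs of real and imaginary parts; slices at a fixed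
  height\<close>

definition imvec :: "complex^'n \<Rightarrow> real^'n" where "imvec z = (\<chi> j. Im (z $ j))"
definition revec :: "complex^'n \<Rightarrow> real^'n" where "revec z = (\<chi> j. Re (z $ j))"

lemma cpoint_nth [simp]: "cpoint x y $ j = Complex (x $ j) (y $ j)"
  by (simp add: cpoint_def)

lemma imvec_cpoint [simp]: "imvec (cpoint x y) = y"
  by (simp add: imvec_def vec_eq_iff)

lemma revec_cpoint [simp]: "revec (cpoint x y) = x"
  by (simp add: revec_def vec_eq_iff)

lemma cpoint_revec_imvec [simp]: "cpoint (revec z) (imvec z) = z"
  by (simp add: revec_def imvec_def vec_eq_iff complex_eq_iff)

lemma mem_tube_iff: "z \<in> tube U \<longleftrightarrow> imvec z \<in> U"
  unfolding tube_def by (auto, metis cpoint_revec_imvec)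

lemma cpoint_mem_tube [simp]: "cpoint x y \<in> tube U \<longleftrightarrow> y \<in> U"
  by (simp add: mem_tube_iff)

lemma bounded_linear_imvec: "bounded_linear (imvec :: complex^'n \<Rightarrow> real^'n)"
  by (rule linear_conv_bounded_linear[THEN iffD1]) (auto intro!: linearI simp: imvec_def vec_eq_iff)

lemma continuous_on_imvec [continuous_intros]:
  "continuous_on S f \<Longrightarrow> continuous_on S (\<lambda>x. imvec (f x :: complex^'n))"
  by (rule bounded_linear.continuous_on[OF bounded_linear_imvec])

lemma open_tube: "open U \<Longrightarrow> open (tube U)"
proof -
  assume "open U"
  then have "open (imvec -` U)"
    by (intro open_vimage continuous_on_imvec continuous_on_id)
  moreover have "tube U = imvec -` U" by (auto simp: mem_tube_iff)
  ultimately show ?thesis by simp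
qed

lemma continuous_on_Complex [continuous_intros]:
  "continuous_on S f \<Longrightarrow> continuous_on S g \<Longrightarrow> continuous_on S (\<lambda>x. Complex (f x) (g x))"
  unfolding Complex_eq by (intro continuous_intros)

lemma continuous_on_cpoint [continuous_intros]:
  "continuous_on S f \<Longrightarrow> continuous_on S g \<Longrightarrow> continuous_on S (\<lambda>x. cpoint (f x) (g x :: real^'n))"
  unfolding cpoint_def
  by (intro continuous_intros)

abbreviation (input) slice :: "(complex^'n \<Rightarrow> complex) \<Rightarrow> real^'n \<Rightarrow> real^'n \<Rightarrow> complex" where
  "slice F y \<equiv> \<lambda>x. F (cpoint x y)"

lemma vec_holomorphic_imp_continuous_on:
  "vec_holomorphic_on F S \<Longrightarrow> continuous_on S F"
  unfolding vec_holomorphic_on_def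
  by (metis continuous_at_imp_continuous_on has_derivative_continuous)

lemma continuous_on_slice:
  assumes "vec_holomorphic_on F (tube U)" "continuous_on S f" "continuous_on S g" "\<And>x. x \<in> S \<Longrightarrow> g x \<in> U"
  shows "continuous_on S (\<lambda>x. F (cpoint (f x) (g x)))"
  by (rule continuous_on_compose2[OF vec_holomorphic_imp_continuous_on[OF assms(1)] continuous_on_cpoint])
     (use assms in auto)

lemma borel_measurable_slice:
  assumes "vec_holomorphic_on F (tube U)" "y \<in> U"
  shows "(slice F y) \<in> borel_measurable borel"
  by (rule borel_measurable_continuous_onI, rule continuous_on_slice[OF assms(1)])
     (use assms in \<open>auto intro: continuous_intros\<close>)

text \<open>The real vector \<open>v\<close> spans a complex line through \<open>cpoint x y\<close>.
  Complex linearity of the derivative of \<open>h\<close> turns its restriction to this line into a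
  holomorphic function of one variable, to which Cauchy's theorem applies.\<close>

lemma holomorphic_on_complex_line:
  assumes "vec_holomorphic_on h (tube U)" "open U"
  shows "(\<lambda>\<zeta>. h (cpoint (x + Re \<zeta> *\<^sub>R v) (y + Im \<zeta> *\<^sub>R v))) holomorphic_on {\<zeta>. y + Im \<zeta> *\<^sub>R v \<in> U}"
proof -
  let ?v = "cpoint v 0"
  have eq: "cpoint (x + Re \<zeta> *\<^sub>R v) (y + Im \<zeta> *\<^sub>R v) = cpoint x y + \<zeta> *s ?v" for \<zeta>
    by (simp add: vec_eq_iff complex_eq_iff)
  have bl: "bounded_linear (\<lambda>k. k *s ?v)"
    by (rule linear_conv_bounded_linear[THEN iffD1]) (auto intro!: linearI simp: vec_eq_iff algebra_simps complex_eq_iff)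
  have d: "((\<lambda>\<zeta>. h (cpoint x y + \<zeta> *s ?v)) has_field_derivative F' ?v) (at \<zeta>)"
    if "(h has_derivative F') (at (cpoint x y + \<zeta> *s ?v))" "\<forall>c v. F' (c *s v) = c * F' v" for \<zeta> F'
  proof -
    have "((\<lambda>\<zeta>. cpoint x y + \<zeta> *s ?v) has_derivative (\<lambda>k. k *s ?v)) (at \<zeta>)"
      using has_derivative_add[OF has_derivative_const bounded_linear_imp_has_derivative[OF bl]]
      by simp
    from diff_chain_at[OF this that(1)]
    show ?thesis unfolding has_field_derivative_def o_def
      using that(2) by (simp add: mult_commute_abs)
  qed
  show ?thesis
    unfolding eq holomorphic_on_def
  proof safe
    fix \<zeta> assume "y + Im \<zeta> *\<^sub>R v \<in> U"
    then have "cpoint x y + \<zeta> *s ?v \<in> tube U"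
      unfolding eq[symmetric] by simp
    then obtain F' where "(h has_derivative F') (at (cpoint x y + \<zeta> *s ?v))" "\<forall>c v. F' (c *s v) = c * F' v"
      using assms unfolding vec_holomorphic_on_def by blast
    from d[OF this] show "(\<lambda>\<zeta>. h (cpoint x y + \<zeta> *s ?v)) field_differentiable at \<zeta> within {\<zeta>. y + Im \<zeta> *\<^sub>R v \<in> U}"
      using field_differentiable_at_within field_differentiable_def by blast
  qed
qed

text \<open>A primitive \<open>g\<close> exists on the convex set \<open>W\<close>, and both sides
  are the increment of \<open>g\<close> from 0 to 1 + i, taken along the two paths on the boundary
  of the unit square.\<close>

lemma holomorphic_square_boundary:
  assumes "f holomorphic_on W" "open W" "convex W" and W: "\<And>s t. 0 \<le> t \<Longrightarrow> t \<le> 1 \<Longrightarrow> Complex s t \<in> W"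
  shows "(LINT s|lborel. indicator {0..1} s *\<^sub>R f (Complex s 0)) + \<i> * (LINT t|lborel. indicator {0..1} t *\<^sub>R f (Complex 1 t))
    = \<i> * (LINT t|lborel. indicator {0..1} t *\<^sub>R f (Complex 0 t)) + (LINT s|lborel. indicator {0..1} s *\<^sub>R f (Complex s 1))"
proof -
  obtain g where g: "\<And>x. x \<in> W \<Longrightarrow> (g has_field_derivative f x) (at x within W)"
    using holomorphic_convex_primitive'[OF assms(3,2,1)] by blast
  have gat: "(g has_field_derivative f x) (at x)" if "x \<in> W" for x
    using g[OF that] assms(2) that at_within_open by metis
  have contf: "continuous_on W f" using assms(1) by (rule holomorphic_on_imp_continuous_on)
  have hor: "(LINT s|lborel. indicator {0..1} s *\<^sub>R f (Complex s t)) = g (Complex 1 t) - g (Complex 0 t)"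
    if t: "0 \<le> t" "t \<le> 1" for t
  proof (rule integral_FTC_atLeastAtMost)
    show "((\<lambda>s. g (Complex s t)) has_vector_derivative f (Complex s t)) (at s within {0..1})" for s
    proof -
      have "((\<lambda>s. Complex s t) has_vector_derivative 1) (at s within {0..1})"
        unfolding Complex_eq by (auto intro!: derivative_eq_intros simp: has_vector_derivative_def scaleR_conv_of_real)
      from field_vector_diff_chain_within[OF this, of g] gat[OF W[OF t, of s]]
      show ?thesis by (auto simp: o_def intro: has_field_derivative_at_within)
    qed
    show "continuous_on {0..1} (\<lambda>s. f (Complex s t))"
      by (rule continuous_on_compose2[OF contf]) (auto intro!: continuous_intros W t)
  qed simp
  have ver: "\<i> * (LINT t|lborel. indicator {0..1} t *\<^sub>R f (Complex s t)) = g (Complex s 1) - g (Complex s 0)" for s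
  proof -
    have "\<i> * (LINT t|lborel. indicator {0..1} t *\<^sub>R f (Complex s t)) = (LINT t|lborel. indicator {0..1} t *\<^sub>R (\<i> * f (Complex s t)))"
      by (subst integral_mult_right_zero[symmetric]) (simp add: mult.left_commute scaleR_conv_of_real)
    also have "\<dots> = g (Complex s 1) - g (Complex s 0)"
    proof (rule integral_FTC_atLeastAtMost)
      show "((\<lambda>t. g (Complex s t)) has_vector_derivative \<i> * f (Complex s t)) (at t within {0..1})"
        if "0 \<le> t" "t \<le> 1" for t
      proof -
        have "((\<lambda>t. Complex s t) has_vector_derivative \<i>) (at t within {0..1})"
          unfolding Complex_eq by (auto intro!: derivative_eq_intros simp: has_vector_derivative_def scaleR_conv_of_real)
        from field_vector_diff_chain_within[OF this, of g] gat[OF W[OF that, of s]]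
        show ?thesis by (auto simp: o_def intro: has_field_derivative_at_within)
      qed
      show "continuous_on {0..1} (\<lambda>t. \<i> * f (Complex s t))"
        by (intro continuous_intros continuous_on_compose2[OF contf]) (auto intro!: continuous_intros W)
    qed simp
    finally show ?thesis .
  qed
  show ?thesis using hor[of 0] hor[of 1] ver[of 0] ver[of 1] by simp
qed

text \<open>Cauchy's theorem is applied to the square spanned by \<open>v = y1 - y0\<close> at every
  base point \<open>x\<close> and then integrated over \<open>x\<close>. The vertical edges are
  translates of one another by \<open>v\<close> and cancel; a horizontal edge yields the slice
  integral at its height. Integration over \<open>x\<close> takes the place of the usual limit of
  long rectangles, so the L1 bound on slices replaces decay at infinity.\<close>

lemma integral_slice_constant:
  fixes h :: "complex^'n \<Rightarrow> complex"
  assumes hol: "vec_holomorphic_on h (tube U)" and U: "open U" "convex U" "y0 \<in> U" "y1 \<in> U"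
    and bound: "\<And>y. y \<in> closed_segment y0 y1 \<Longrightarrow> (\<integral>\<^sup>+x. norm (h (cpoint x y)) \<partial>lborel) \<le> ennreal C"
  shows "(LINT x|lborel. h (cpoint x y0)) = (LINT x|lborel. h (cpoint x y1))"
proof -
  define v where "v = y1 - y0"
  let ?I = "\<lambda>s::real. indicator {0..1::real} s :: real"
  have seg: "y0 + t *\<^sub>R v \<in> closed_segment y0 y1" if "0 \<le> t" "t \<le> 1" for t
    using that unfolding v_def in_segment by (intro exI[of _ t]) (auto simp: algebra_simps)
  have segU: "y0 + t *\<^sub>R v \<in> U" if "0 \<le> t" "t \<le> 1" for t
    using seg[OF that] U closed_segment_subset by blast
  have fin: "(\<integral>\<^sup>+s. indicator {0..1::real} s * ennreal C \<partial>lborel) < \<infinity>"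
    by (subst nn_integral_multc) (auto simp: ennreal_mult_less_top)
  have hor: "integrable (lborel \<Otimes>\<^sub>M lborel) (\<lambda>(x, s). ?I s *\<^sub>R h (cpoint (x + s *\<^sub>R v) y))"
    if y: "y \<in> closed_segment y0 y1" for y
  proof (rule integrable_pair_lborelI[OF _ _ fin])
    have yU: "y \<in> U" using y U closed_segment_subset by blast
    note [measurable] = borel_measurable_slice[OF hol yU]
    show "(\<lambda>(x, s). ?I s *\<^sub>R h (cpoint (x + s *\<^sub>R v) y)) \<in> borel_measurable (lborel \<Otimes>\<^sub>M lborel)"
      by measurable
    show "(\<integral>\<^sup>+x. norm (case (x, s) of (x, s) \<Rightarrow> ?I s *\<^sub>R h (cpoint (x + s *\<^sub>R v) y)) \<partial>lborel)
        \<le> indicator {0..1::real} s * ennreal C" for s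
      using bound[OF y] nn_integral_lborel_shift[of "\<lambda>x. ennreal (norm (h (cpoint x y)))" "s *\<^sub>R v"]
      by (auto simp: indicator_def)
  qed
  have ver: "integrable (lborel \<Otimes>\<^sub>M lborel) (\<lambda>(x, t). ?I t *\<^sub>R h (cpoint (x + c) (y0 + t *\<^sub>R v)))" for c
  proof (rule integrable_pair_lborelI[OF _ _ fin])
    \<comment> \<open>\<open>h\<close> is known to be continuous only on the tube, so joint
      measurability is shown for its product with the indicator of the closed strip.\<close>
    have "(\<lambda>p. indicator (UNIV \<times> {0..1::real}) p *\<^sub>R h (cpoint (fst p + c) (y0 + snd p *\<^sub>R v))) \<in> borel_measurable borel"
    proof (rule borel_measurable_continuous_on_indicator)
      show "UNIV \<times> {0..1} \<in> sets (borel :: ((real^'n) \<times> real) measure)"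
        by (intro borel_closed closed_Times) auto
      show "continuous_on (UNIV \<times> {0..1}) (\<lambda>p. h (cpoint (fst p + c) (y0 + snd p *\<^sub>R v)))"
        by (rule continuous_on_slice[OF hol]) (auto intro!: continuous_intros segU)
    qed
    moreover have "(\<lambda>(x, t). ?I t *\<^sub>R h (cpoint (x + c) (y0 + t *\<^sub>R v))) =
      (\<lambda>p. indicator (UNIV \<times> {0..1::real}) p *\<^sub>R h (cpoint (fst p + c) (y0 + snd p *\<^sub>R v)))"
      by (auto simp: indicator_def fun_eq_iff)
    ultimately show "(\<lambda>(x, t). ?I t *\<^sub>R h (cpoint (x + c) (y0 + t *\<^sub>R v))) \<in> borel_measurable (lborel \<Otimes>\<^sub>M lborel)"
      by (simp add: lborel_prod)
    show "(\<integral>\<^sup>+x. norm (case (x, t) of (x, t) \<Rightarrow> ?I t *\<^sub>R h (cpoint (x + c) (y0 + t *\<^sub>R v))) \<partial>lborel)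
        \<le> indicator {0..1::real} t * ennreal C" for t
    proof (cases "t \<in> {0..1}")
      case True
      note [measurable] = borel_measurable_slice[OF hol segU]
      show ?thesis using True bound[OF seg]
        nn_integral_lborel_shift[of "\<lambda>x. ennreal (norm (h (cpoint x (y0 + t *\<^sub>R v))))" c]
        by auto
    qed auto
  qed
  \<comment> \<open>All translates by \<open>s *\<^sub>R v\<close> have the same integral, and so
    has their average over \<open>s\<close> in [0, 1].\<close>
  have hor_eq: "(LINT x|lborel. LINT s|lborel. ?I s *\<^sub>R h (cpoint (x + s *\<^sub>R v) y)) = (LINT x|lborel. h (cpoint x y))"
    if y: "y \<in> closed_segment y0 y1" for y
  proof -
    have yU: "y \<in> U" using y U closed_segment_subset by blast
    note [measurable] = borel_measurable_slice[OF hol yU]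
    have "(LINT x|lborel. LINT s|lborel. ?I s *\<^sub>R h (cpoint (x + s *\<^sub>R v) y)) =
        (LINT s|lborel. LINT x|lborel. ?I s *\<^sub>R h (cpoint (x + s *\<^sub>R v) y))"
      using lborel_pair.Fubini_integral[OF hor[OF y]] by simp
    also have "\<dots> = (LINT s|lborel. ?I s *\<^sub>R (LINT x|lborel. h (cpoint x y)))"
      using integral_lborel_shift[of "\<lambda>x. h (cpoint x y)"] by simp
    also have "\<dots> = (LINT x|lborel. h (cpoint x y))"
      by simp
    finally show ?thesis .
  qed
  have ver_eq: "(LINT x|lborel. LINT t|lborel. ?I t *\<^sub>R h (cpoint (x + v) (y0 + t *\<^sub>R v))) =
      (LINT x|lborel. LINT t|lborel. ?I t *\<^sub>R h (cpoint (x + 0) (y0 + t *\<^sub>R v)))"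
  proof -
    have "(LINT x|lborel. LINT t|lborel. ?I t *\<^sub>R h (cpoint (x + c) (y0 + t *\<^sub>R v))) =
        (LINT t|lborel. LINT x|lborel. ?I t *\<^sub>R h (cpoint x (y0 + t *\<^sub>R v)))" for c
    proof -
      have "(LINT x|lborel. LINT t|lborel. ?I t *\<^sub>R h (cpoint (x + c) (y0 + t *\<^sub>R v))) =
          (LINT t|lborel. LINT x|lborel. ?I t *\<^sub>R h (cpoint (x + c) (y0 + t *\<^sub>R v)))"
        using lborel_pair.Fubini_integral[OF ver[of c]] by simp
      also have "\<dots> = (LINT t|lborel. LINT x|lborel. ?I t *\<^sub>R h (cpoint x (y0 + t *\<^sub>R v)))"
      proof (rule Bochner_Integration.integral_cong[OF refl])
        fix t
        show "(LINT x|lborel. ?I t *\<^sub>R h (cpoint (x + c) (y0 + t *\<^sub>R v))) =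
          (LINT x|lborel. ?I t *\<^sub>R h (cpoint x (y0 + t *\<^sub>R v)))"
        proof (cases "t \<in> {0..1}")
          case True
          note [measurable] = borel_measurable_slice[OF hol segU]
          show ?thesis using True
            by (intro integral_lborel_shift[of "\<lambda>x. ?I t *\<^sub>R h (cpoint x (y0 + t *\<^sub>R v))"]) auto
        qed auto
      qed
      finally show ?thesis .
    qed
    then show ?thesis by metis
  qed
  have edge: "(LINT s|lborel. ?I s *\<^sub>R h (cpoint (x + s *\<^sub>R v) y0)) + \<i> * (LINT t|lborel. ?I t *\<^sub>R h (cpoint (x + v) (y0 + t *\<^sub>R v)))
    = \<i> * (LINT t|lborel. ?I t *\<^sub>R h (cpoint (x + 0) (y0 + t *\<^sub>R v))) + (LINT s|lborel. ?I s *\<^sub>R h (cpoint (x + s *\<^sub>R v) y1))" for x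
  proof -
    let ?W = "{\<zeta>. y0 + Im \<zeta> *\<^sub>R v \<in> U}"
    have "open ?W"
    proof -
      have "continuous_on UNIV (\<lambda>\<zeta>. y0 + Im \<zeta> *\<^sub>R v)"
        by (intro continuous_intros)
      from open_vimage[OF U(1) this] show ?thesis by (simp add: vimage_def)
    qed
    moreover have "convex ?W"
    proof (rule convexI)
      fix a b and p q :: real
      assume a: "a \<in> ?W" "b \<in> ?W" "0 \<le> p" "0 \<le> q" "p + q = 1"
      then have "p *\<^sub>R (y0 + Im a *\<^sub>R v) + q *\<^sub>R (y0 + Im b *\<^sub>R v) \<in> U"
        using U(2) convexD by blast
      moreover have "p *\<^sub>R (y0 + Im a *\<^sub>R v) + q *\<^sub>R (y0 + Im b *\<^sub>R v) = (p + q) *\<^sub>R y0 + Im (p *\<^sub>R a + q *\<^sub>R b) *\<^sub>R v"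
        by (simp add: algebra_simps)
      ultimately show "p *\<^sub>R a + q *\<^sub>R b \<in> ?W" using a by simp
    qed
    ultimately have "(LINT s|lborel. ?I s *\<^sub>R h (cpoint (x + Re (Complex s 0) *\<^sub>R v) (y0 + Im (Complex s 0) *\<^sub>R v))) + \<i> * (LINT t|lborel. ?I t *\<^sub>R h (cpoint (x + Re (Complex 1 t) *\<^sub>R v) (y0 + Im (Complex 1 t) *\<^sub>R v)))
    = \<i> * (LINT t|lborel. ?I t *\<^sub>R h (cpoint (x + Re (Complex 0 t) *\<^sub>R v) (y0 + Im (Complex 0 t) *\<^sub>R v))) + (LINT s|lborel. ?I s *\<^sub>R h (cpoint (x + Re (Complex s 1) *\<^sub>R v) (y0 + Im (Complex s 1) *\<^sub>R v)))"
      by (intro holomorphic_square_boundary[OF holomorphic_on_complex_line[OF hol U(1)]]) (auto intro: segU)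
    then show ?thesis by (simp add: v_def)
  qed
  have i1: "integrable lborel (\<lambda>x. LINT s|lborel. ?I s *\<^sub>R h (cpoint (x + s *\<^sub>R v) y))"
    if "y \<in> closed_segment y0 y1" for y
    using lborel_pair.integrable_fst'[OF hor[OF that]] by simp
  have i2: "integrable lborel (\<lambda>x. LINT t|lborel. ?I t *\<^sub>R h (cpoint (x + c) (y0 + t *\<^sub>R v)))" for c
    using lborel_pair.integrable_fst'[OF ver[of c]] by simp
  have "(LINT x|lborel. (LINT s|lborel. ?I s *\<^sub>R h (cpoint (x + s *\<^sub>R v) y0)) + \<i> * (LINT t|lborel. ?I t *\<^sub>R h (cpoint (x + v) (y0 + t *\<^sub>R v))))
    = (LINT x|lborel. \<i> * (LINT t|lborel. ?I t *\<^sub>R h (cpoint (x + 0) (y0 + t *\<^sub>R v))) + (LINT s|lborel. ?I s *\<^sub>R h (cpoint (x + s *\<^sub>R v) y1)))"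
    by (intro Bochner_Integration.integral_cong[OF refl] edge)
  then have "(LINT x|lborel. (LINT s|lborel. ?I s *\<^sub>R h (cpoint (x + s *\<^sub>R v) y0))) + \<i> * (LINT x|lborel. (LINT t|lborel. ?I t *\<^sub>R h (cpoint (x + v) (y0 + t *\<^sub>R v))))
    = \<i> * (LINT x|lborel. (LINT t|lborel. ?I t *\<^sub>R h (cpoint (x + 0) (y0 + t *\<^sub>R v)))) + (LINT x|lborel. LINT s|lborel. ?I s *\<^sub>R h (cpoint (x + s *\<^sub>R v) y1))"
    using i1[of y0] i1[of y1] i2[of v] i2[of 0] by (subst (asm) (1 2) Bochner_Integration.integral_add) auto
  then show ?thesis
    unfolding ver_eq using hor_eq[of y0] hor_eq[of y1] by auto
qed

subsection \<open>Square integrable functions\<close>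

definition square_integrable :: "('a::euclidean_space \<Rightarrow> complex) \<Rightarrow> bool" where
  "square_integrable f \<longleftrightarrow> f \<in> borel_measurable lborel \<and> integrable lborel (\<lambda>x. (norm (f x))\<^sup>2)"

abbreviation (input) nn_energy :: "('a::euclidean_space \<Rightarrow> complex) \<Rightarrow> ennreal" where
  "nn_energy f \<equiv> \<integral>\<^sup>+x. ennreal ((norm (f x))\<^sup>2) \<partial>lborel"

abbreviation (input) energy :: "('a::euclidean_space \<Rightarrow> complex) \<Rightarrow> real" where
  "energy f \<equiv> LINT x|lborel. (norm (f x))\<^sup>2"

lemma square_integrable_measurable [measurable_dest]:
  "square_integrable f \<Longrightarrow> f \<in> borel_measurable borel"
  by (simp add: square_integrable_def)

lemma borel_measurable_cnj [measurable]: "cnj \<in> borel_measurable borel"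
  by (intro borel_measurable_continuous_onI continuous_intros)

lemma square_integrable_iff_nn:
  "square_integrable f \<longleftrightarrow> f \<in> borel_measurable lborel \<and> (nn_energy f) < \<infinity>"
  unfolding square_integrable_def by (auto simp: integrable_iff_bounded)

lemma norm_add_square_le: "(norm (a + b))\<^sup>2 \<le> 2 * (norm a)\<^sup>2 + 2 * (norm (b::'a::real_normed_vector))\<^sup>2"
proof -
  have "(norm (a + b))\<^sup>2 \<le> (norm a + norm b)\<^sup>2"
    by (intro power_mono norm_triangle_ineq) auto
  also have "\<dots> \<le> 2 * (norm a)\<^sup>2 + 2 * (norm b)\<^sup>2"
    using zero_le_power2[of "norm a - norm b"] by (simp add: power2_eq_square algebra_simps)
  finally show ?thesis .
qed

lemma square_integrable_add:
  assumes "square_integrable f" "square_integrable g"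
  shows "square_integrable (\<lambda>x. f x + g x)"
  unfolding square_integrable_def
proof
  note [measurable] = assms
  show "(\<lambda>x. f x + g x) \<in> borel_measurable lborel" by measurable
  show "integrable lborel (\<lambda>x. (norm (f x + g x))\<^sup>2)"
  proof (rule Bochner_Integration.integrable_bound)
    show "integrable lborel (\<lambda>x. 2 * (norm (f x))\<^sup>2 + 2 * (norm (g x))\<^sup>2)"
      using assms by (auto simp: square_integrable_def)
    show "(\<lambda>x. (norm (f x + g x))\<^sup>2) \<in> borel_measurable lborel" by measurable
  qed (auto intro: norm_add_square_le)
qed

lemma square_integrable_cmult:
  "square_integrable f \<Longrightarrow> square_integrable (\<lambda>x. c * f x)"
  unfolding square_integrable_def by (auto simp: norm_mult power_mult_distrib)

lemma square_integrable_diff: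
  assumes "square_integrable f" "square_integrable g"
  shows "square_integrable (\<lambda>x. f x - g x)"
  using square_integrable_add[OF assms(1) square_integrable_cmult[OF assms(2), of "-1"]] by simp

lemma norm_mult_le_squares: "norm a * norm b \<le> ((norm a)\<^sup>2 + (norm b)\<^sup>2) / 2"
  using zero_le_power2[of "norm a - norm b"] by (simp add: power2_eq_square algebra_simps)

lemma integrable_mult_cnj:
  assumes "square_integrable f" "square_integrable g"
  shows "integrable lborel (\<lambda>x. f x * cnj (g x))"
proof (rule Bochner_Integration.integrable_bound)
  note [measurable] = assms
  show "integrable lborel (\<lambda>x. ((norm (f x))\<^sup>2 + (norm (g x))\<^sup>2) / 2)"
    using assms by (auto simp: square_integrable_def)
  show "(\<lambda>x. f x * cnj (g x)) \<in> borel_measurable lborel" by measurable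
  show "AE x in lborel. norm (f x * cnj (g x)) \<le> norm (((norm (f x))\<^sup>2 + (norm (g x))\<^sup>2) / 2)"
    unfolding norm_mult complex_mod_cnj using norm_mult_le_squares[of "f _" "g _"] by simp
qed

lemma Cauchy_Schwarz_integral:
  assumes "square_integrable f" "square_integrable g"
  shows "(norm (LINT x|lborel. f x * cnj (g x)))\<^sup>2 \<le> energy f * energy g"
proof -
  note [measurable] = assms
  have "ennreal (norm (LINT x|lborel. f x * cnj (g x))) \<le> (\<integral>\<^sup>+x. ennreal (norm (f x)) * ennreal (norm (g x)) \<partial>lborel)"
    using integral_norm_bound_ennreal[OF integrable_mult_cnj[OF assms]] by (simp add: norm_mult ennreal_mult)
  then have "ennreal (norm (LINT x|lborel. f x * cnj (g x))) ^ 2 \<le> (\<integral>\<^sup>+x. ennreal (norm (f x)) * ennreal (norm (g x)) \<partial>lborel) ^ 2"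
    by (intro power_mono) auto
  also have "\<dots> \<le> (\<integral>\<^sup>+x. ennreal (norm (f x)) ^ 2 \<partial>lborel) * (\<integral>\<^sup>+x. ennreal (norm (g x)) ^ 2 \<partial>lborel)"
    by (intro Cauchy_Schwarz_nn_integral) auto
  also have "\<dots> = ennreal (energy f * energy g)"
    using assms unfolding square_integrable_def
    by (auto simp: ennreal_power nn_integral_eq_integral ennreal_mult integral_nonneg_AE)
  finally show ?thesis
    by (simp add: ennreal_power)
qed

text \<open>Only the liminf of the energies enters, hence a bound from \<open>N\<close> on is
  enough. This serves both the completeness of L2 and the final estimate of the residuals.\<close>

lemma L2_Fatou:
  fixes g :: "nat \<Rightarrow> 'a::euclidean_space \<Rightarrow> complex"
  assumes [measurable]: "\<And>k. g k \<in> borel_measurable borel"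
    and lim: "AE x in lborel. (\<lambda>k. g k x) \<longlonglongrightarrow> h x"
    and C: "\<And>k. N \<le> k \<Longrightarrow> (nn_energy (g k)) \<le> ennreal C"
  shows "nn_energy h \<le> ennreal C"
proof -
  have "nn_energy h = (\<integral>\<^sup>+x. liminf (\<lambda>k. ennreal ((norm (g k x))\<^sup>2)) \<partial>lborel)"
  proof (rule nn_integral_cong_AE, use lim in eventually_elim)
    fix x assume "(\<lambda>k. g k x) \<longlonglongrightarrow> h x"
    then have "(\<lambda>k. ennreal ((norm (g k x))\<^sup>2)) \<longlonglongrightarrow> ennreal ((norm (h x))\<^sup>2)"
      by (intro tendsto_intros)
    then show "ennreal ((norm (h x))\<^sup>2) = liminf (\<lambda>k. ennreal ((norm (g k x))\<^sup>2))"
      by (intro lim_imp_Liminf[symmetric]) auto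
  qed
  also have "\<dots> \<le> liminf (\<lambda>k. (nn_energy (g k)))"
    by (intro nn_integral_liminf) measurable
  also have "\<dots> \<le> ennreal C"
    by (rule Liminf_le) (auto intro!: eventually_sequentiallyI[of N] C)
  finally show ?thesis .
qed

text \<open>Completeness of L2 for a prescribed rate. Weighting the squared increments by
  \<open>4^n\<close> leaves energies at most \<open>(1/2)^n\<close>, so the weighted sum is finite
  almost everywhere; there the increments are O(2^-n) and the sequence converges. Fatou's lemma then
  carries the rate over to the limit.\<close>

lemma riesz_fischer_geometric:
  fixes f :: "nat \<Rightarrow> 'a::euclidean_space \<Rightarrow> complex"
  assumes [measurable]: "\<And>n. f n \<in> borel_measurable borel"
    and C: "\<And>n m. n \<le> m \<Longrightarrow> (nn_energy (\<lambda>x. f n x - f m x)) \<le> ennreal ((1/8)^n)"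
  obtains b where "b \<in> borel_measurable borel"
    "\<And>n. (nn_energy (\<lambda>x. f n x - b x)) \<le> ennreal ((1/8)^n)"
proof -
  \<comment> \<open>On the null set of divergence \<open>lim\<close> has an unspecified value;
    measurability holds nevertheless.\<close>
  define b where "b x = lim (\<lambda>n. f n x)" for x
  have b [measurable]: "b \<in> borel_measurable borel"
    unfolding b_def by measurable
  have "(\<integral>\<^sup>+x. (\<Sum>n. ennreal (4^n * (norm (f n x - f (Suc n) x))\<^sup>2)) \<partial>lborel)
      = (\<Sum>n. (\<integral>\<^sup>+x. ennreal (4^n * (norm (f n x - f (Suc n) x))\<^sup>2) \<partial>lborel))"
    by (intro nn_integral_suminf) auto
  also have "\<dots> \<le> (\<Sum>n. ennreal ((1/2)^n))"
  proof (intro suminf_le allI summableI)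
    fix n
    have "(\<integral>\<^sup>+x. ennreal (4^n * (norm (f n x - f (Suc n) x))\<^sup>2) \<partial>lborel)
      = ennreal (4^n) * nn_energy (\<lambda>x. f n x - f (Suc n) x)"
      by (simp add: ennreal_mult nn_integral_cmult)
    also have "\<dots> \<le> ennreal (4^n) * ennreal ((1/8)^n)"
      by (intro mult_left_mono C) auto
    also have "\<dots> = ennreal ((1/2)^n)"
      unfolding ennreal_mult[symmetric, OF zero_le_power zero_le_power, OF zero_le_numeral zero_le_divide_1_iff[THEN iffD2, OF zero_le_numeral]]
        power_mult_distrib[symmetric] by simp
    finally show "(\<integral>\<^sup>+x. ennreal (4^n * (norm (f n x - f (Suc n) x))\<^sup>2) \<partial>lborel) \<le> ennreal ((1/2)^n)" .
  qed
  also have "\<dots> < \<infinity>"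
  proof -
    have "summable (\<lambda>n. (1/2::real)^n)" by (rule summable_geometric) simp
    moreover have "0 \<le> (1/2::real)^n" for n by simp
    ultimately have "(\<Sum>n. ennreal ((1/2)^n)) = ennreal (\<Sum>n. (1/2::real)^n)"
      by (rule suminf_ennreal2[rotated])
    then show ?thesis by (simp only: ennreal_less_top infinity_ennreal_def)
  qed
  finally have fin: "(\<integral>\<^sup>+x. (\<Sum>n. ennreal (4^n * (norm (f n x - f (Suc n) x))\<^sup>2)) \<partial>lborel) \<noteq> \<infinity>"
    by (rule less_imp_neq)
  have "(\<lambda>x. \<Sum>n. ennreal (4^n * (norm (f n x - f (Suc n) x))\<^sup>2)) \<in> borel_measurable lborel"
    by (intro borel_measurable_suminf_order) measurable
  from nn_integral_PInf_AE[OF this fin] have "AE x in lborel. (\<Sum>n. ennreal (4^n * (norm (f n x - f (Suc n) x))\<^sup>2)) \<noteq> \<infinity>"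
    .
  then have lim: "AE x in lborel. (\<lambda>n. f n x) \<longlonglongrightarrow> b x"
  proof (rule AE_mp, intro AE_I2 impI)
    fix x assume fin: "(\<Sum>n. ennreal (4^n * (norm (f n x - f (Suc n) x))\<^sup>2)) \<noteq> \<infinity>"
    obtain c where c: "(\<Sum>n. ennreal (4^n * (norm (f n x - f (Suc n) x))\<^sup>2)) = ennreal c" "c \<ge> 0"
      using fin by (cases "\<Sum>n. ennreal (4^n * (norm (f n x - f (Suc n) x))\<^sup>2)" rule: ennreal_cases)
        (simp_all only: infinity_ennreal_def not_True_eq_False simp_thms)
    have bd: "norm (f (Suc n) x - f n x) \<le> sqrt c * (1/2)^n" for n
    proof -
      have "ennreal (4^n * (norm (f n x - f (Suc n) x))\<^sup>2) \<le> ennreal c"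
      proof -
        have "(\<Sum>k\<in>{n}. ennreal (4^k * (norm (f k x - f (Suc k) x))\<^sup>2)) \<le> ennreal c"
          unfolding c(1)[symmetric] by (rule sum_le_suminf) (auto intro: summableI)
        then show ?thesis by simp
      qed
      then have "4^n * (norm (f n x - f (Suc n) x))\<^sup>2 \<le> c"
        using c(2) by simp
      then have "(2^n * norm (f n x - f (Suc n) x))\<^sup>2 \<le> c"
      proof -
        have "((2::real)^n)\<^sup>2 = 4^n" by (simp add: power2_eq_square flip: power_mult_distrib)
        then show ?thesis using \<open>4^n * (norm (f n x - f (Suc n) x))\<^sup>2 \<le> c\<close> by (simp add: power_mult_distrib)
      qed
      then have "2^n * norm (f n x - f (Suc n) x) \<le> sqrt c"
        using real_le_rsqrt by blast
      then show ?thesis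
        unfolding norm_minus_commute[of "f (Suc n) x"] power_one_over by (simp add: field_simps)
    qed
    have "summable (\<lambda>n. f (Suc n) x - f n x)"
    proof (rule summable_comparison_test'[OF _ bd])
      show "summable (\<lambda>n. sqrt c * (1/2)^n)" by (intro summable_mult summable_geometric) simp
    qed
    then have "convergent (\<lambda>n. f 0 x + (\<Sum>i<n. f (Suc i) x - f i x))"
      by (intro convergent_add convergent_const) (simp only: summable_iff_convergent)
    then have "convergent (\<lambda>n. f n x)"
      unfolding sum_lessThan_telescope[of "\<lambda>i. f i x"] by simp
    then show "(\<lambda>n. f n x) \<longlonglongrightarrow> b x"
      unfolding b_def by (simp add: convergent_LIMSEQ_iff)
  qed
  show ?thesis
  proof (rule that[OF b])
    show "nn_energy (\<lambda>x. f n x - b x) \<le> ennreal ((1/8)^n)" for n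
    proof (rule L2_Fatou[OF _ _ C])
      show "AE x in lborel. (\<lambda>m. f n x - f m x) \<longlonglongrightarrow> f n x - b x"
        using lim by eventually_elim (intro tendsto_intros)
    qed measurable
  qed
qed

subsection \<open>Cones and slices of Hardy functions\<close>

lemma open_cone_add: "open_cone \<Gamma> \<Longrightarrow> x \<in> \<Gamma> \<Longrightarrow> y \<in> \<Gamma> \<Longrightarrow> x + y \<in> \<Gamma>"
  unfolding open_cone_def using zero_less_one[where 'a=real] scaleR_one[of x] scaleR_one[of y] by metis

lemma open_cone_scale: 
  assumes "open_cone \<Gamma>" "x \<in> \<Gamma>" "0 < a" 
  shows "a *\<^sub>R x \<in> \<Gamma>"
proof -
  have "(a/2) *\<^sub>R x + (a/2) *\<^sub>R x \<in> \<Gamma>"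
    using assms half_gt_zero[OF assms(3)] unfolding open_cone_def by blast
  then show ?thesis by (simp flip: scaleR_add_left)
qed

lemma open_cone_imp_open: "open_cone \<Gamma> \<Longrightarrow> open \<Gamma>"
  by (simp add: open_cone_def)

lemma open_cone_imp_convex: 
  assumes "open_cone \<Gamma>" shows "convex \<Gamma>"
proof (rule convexI)
  fix x y and u v :: real assume a: "x \<in> \<Gamma>" "y \<in> \<Gamma>" "0 \<le> u" "0 \<le> v" "u + v = 1"
  show "u *\<^sub>R x + v *\<^sub>R y \<in> \<Gamma>"
  proof (cases "u = 0 \<or> v = 0")
    case True with a show ?thesis by auto
  next
    case False with a assms show ?thesis unfolding open_cone_def by force
  qed
qed

lemma open_cone_small:
  assumes "open_cone \<Gamma>" "0 < (e::real)"
  obtains y where "y \<in> \<Gamma>" "norm y < e"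
proof -
  obtain x where x: "x \<in> \<Gamma>" using assms by (auto simp: open_cone_def)
  then have "x \<noteq> 0" using assms by (auto simp: open_cone_def)
  then have "norm ((e / (2 * norm x)) *\<^sub>R x) < e" using assms by simp
  moreover have "(e / (2 * norm x)) *\<^sub>R x \<in> \<Gamma>" using \<open>x \<noteq> 0\<close> assms x by (intro open_cone_scale) auto
  ultimately show ?thesis using that by blast
qed

lemma trivial_limit_at_0_within_cone: "open_cone \<Gamma> \<Longrightarrow> at 0 within \<Gamma> \<noteq> bot"
  unfolding trivial_limit_within islimpt_approachable
  by (metis dist_0_norm dist_commute open_cone_def open_cone_small)

lemma hardy_space_holomorphic: "F \<in> hardy_space \<Gamma> \<Longrightarrow> vec_holomorphic_on F (tube \<Gamma>)"
  by (simp add: hardy_space_def)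

lemma hardy_norm_nonneg [simp]: "0 \<le> hardy_norm \<Gamma> F"
  by (simp add: hardy_norm_def)

lemma hardy_norm_square: 
  assumes "F \<in> hardy_space \<Gamma>" 
  shows "ennreal ((hardy_norm \<Gamma> F)\<^sup>2) = hardy_norm_sq \<Gamma> F"
  using assms by (simp add: hardy_norm_def hardy_space_def top.not_eq_extremum)

lemma hardy_slice_nn_le:
  assumes "F \<in> hardy_space \<Gamma>" "y \<in> \<Gamma>"
  shows "nn_energy (slice F y) \<le> ennreal ((hardy_norm \<Gamma> F)\<^sup>2)"
  unfolding hardy_norm_square[OF assms(1)] hardy_norm_sq_def by (rule SUP_upper[OF assms(2)])

lemma square_integrable_slice:
  assumes "F \<in> hardy_space \<Gamma>" "y \<in> \<Gamma>"
  shows "square_integrable (slice F y)"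
  unfolding square_integrable_iff_nn 
  using hardy_slice_nn_le[OF assms] borel_measurable_slice[OF hardy_space_holomorphic[OF assms(1)] assms(2)]
  by (auto simp: le_less_trans)

lemma hardy_slice_le:
  assumes "F \<in> hardy_space \<Gamma>" "y \<in> \<Gamma>"
  shows "energy (slice F y) \<le> (hardy_norm \<Gamma> F)\<^sup>2"
proof -
  have "ennreal (energy (slice F y)) \<le> ennreal ((hardy_norm \<Gamma> F)\<^sup>2)"
    using hardy_slice_nn_le[OF assms] square_integrable_slice[OF assms] 
    by (subst nn_integral_eq_integral[symmetric]) (auto simp: square_integrable_def)
  then show ?thesis by simp
qed

lemma hardy_norm_sq_leI:
  assumes "\<And>y. y \<in> \<Gamma> \<Longrightarrow> (nn_energy (slice F y)) \<le> ennreal C" "0 \<le> C"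
  shows "hardy_norm_sq \<Gamma> F \<le> ennreal C" "(hardy_norm \<Gamma> F)\<^sup>2 \<le> C"
proof -
  show 1: "hardy_norm_sq \<Gamma> F \<le> ennreal C"
    unfolding hardy_norm_sq_def by (intro SUP_least assms)
  show "(hardy_norm \<Gamma> F)\<^sup>2 \<le> C"
    unfolding hardy_norm_def using enn2real_mono[OF 1] assms(2) by simp
qed

lemma hardy_spaceI:
  assumes "vec_holomorphic_on F (tube \<Gamma>)" 
    "\<And>y. y \<in> \<Gamma> \<Longrightarrow> (nn_energy (slice F y)) \<le> ennreal C" "0 \<le> C"
  shows "F \<in> hardy_space \<Gamma>"
  unfolding hardy_space_def using assms(1) le_less_trans[OF hardy_norm_sq_leI(1)[OF assms(2,3)]] by simp

section \<open>Products, sums and reflections of holomorphic functions of several variables\<close>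

definition vcnj :: "complex^'n \<Rightarrow> complex^'n" where "vcnj z = (\<chi> j. cnj (z $ j))"

lemma vcnj_nth [simp]: "vcnj z $ j = cnj (z $ j)" by (simp add: vcnj_def)

lemma bounded_linear_vcnj: "bounded_linear (vcnj :: complex^'n \<Rightarrow> _)"
  by (rule linear_conv_bounded_linear[THEN iffD1]) (auto intro!: linearI simp: vec_eq_iff)

lemma vec_holomorphic_on_mult:
  assumes "vec_holomorphic_on F S" "vec_holomorphic_on G S"
  shows "vec_holomorphic_on (\<lambda>z. F z * G z) S"
  unfolding vec_holomorphic_on_def
proof
  fix z assume "z \<in> S"
  then obtain F' G' where F': "(F has_derivative F') (at z)" "\<forall>c v. F' (c *s v) = c * F' v" 
    and G': "(G has_derivative G') (at z)" "\<forall>c v. G' (c *s v) = c * G' v"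
    using assms unfolding vec_holomorphic_on_def by metis
  show "\<exists>H'. ((\<lambda>z. F z * G z) has_derivative H') (at z) \<and> (\<forall>c v. H' (c *s v) = c * H' v)"
    by (rule exI, rule conjI[OF has_derivative_mult[OF F'(1) G'(1)]]) (use F'(2) G'(2) in \<open>auto simp: algebra_simps\<close>)
qed

lemma vec_holomorphic_on_add:
  assumes "vec_holomorphic_on F S" "vec_holomorphic_on G S"
  shows "vec_holomorphic_on (\<lambda>z. F z + G z) S"
  unfolding vec_holomorphic_on_def
proof
  fix z assume "z \<in> S"
  then obtain F' G' where F': "(F has_derivative F') (at z)" "\<forall>c v. F' (c *s v) = c * F' v" 
    and G': "(G has_derivative G') (at z)" "\<forall>c v. G' (c *s v) = c * G' v"
    using assms unfolding vec_holomorphic_on_def by metis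
  show "\<exists>H'. ((\<lambda>z. F z + G z) has_derivative H') (at z) \<and> (\<forall>c v. H' (c *s v) = c * H' v)"
    by (rule exI, rule conjI[OF has_derivative_add[OF F'(1) G'(1)]]) (use F'(2) G'(2) in \<open>auto simp: algebra_simps\<close>)
qed

lemma vec_holomorphic_on_const: "vec_holomorphic_on (\<lambda>z. c) S"
  unfolding vec_holomorphic_on_def by (auto intro!: exI[of _ "\<lambda>_. 0"])

lemma vec_holomorphic_on_subset: "vec_holomorphic_on F S \<Longrightarrow> T \<subseteq> S \<Longrightarrow> vec_holomorphic_on F T"
  unfolding vec_holomorphic_on_def by blast

text \<open>Schwarz reflection: conjugating both argument and value preserves holomorphy. It turns
  the antiholomorphic second factor of a pairing of slices into a holomorphic one.\<close>

lemma vec_holomorphic_on_reflect: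
  fixes a :: "complex^'n"
  assumes "vec_holomorphic_on G S" "\<And>z. z \<in> T \<Longrightarrow> a + vcnj z \<in> S"
  shows "vec_holomorphic_on (\<lambda>z. cnj (G (a + vcnj z))) T"
  unfolding vec_holomorphic_on_def
proof
  fix z assume "z \<in> T"
  then obtain G' where G': "(G has_derivative G') (at (a + vcnj z))" "\<forall>c v. G' (c *s v) = c * G' v"
    using assms unfolding vec_holomorphic_on_def by metis
  have "((\<lambda>z. a + vcnj z) has_derivative vcnj) (at z)"
    using has_derivative_add[OF has_derivative_const bounded_linear_imp_has_derivative[OF bounded_linear_vcnj]] by simp
  from diff_chain_at[OF this G'(1)]
  have "((\<lambda>z. G (a + vcnj z)) has_derivative (\<lambda>k. G' (vcnj k))) (at z)" by (simp add: o_def)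
  from has_derivative_cnj[OF this]
  have "((\<lambda>z. cnj (G (a + vcnj z))) has_derivative (\<lambda>k. cnj (G' (vcnj k)))) (at z)" .
  moreover have "vcnj (c *s v) = cnj c *s vcnj v" for c and v :: "complex^'n"
    by (simp add: vec_eq_iff)
  ultimately show "\<exists>H'. ((\<lambda>z. cnj (G (a + vcnj z))) has_derivative H') (at z) \<and> (\<forall>c v. H' (c *s v) = c * H' v)"
    using G'(2) by (intro exI[of _ "\<lambda>k. cnj (G' (vcnj k))"]) auto
qed

text \<open>From \<open>ab \<le> (a^2 + b^2)/2\<close>. The bound is uniform in both heights, which
  makes products of Hardy functions accessible to \<open>integral_slice_constant\<close> and to the
  Fourier transform.\<close>

lemma nn_integral_slice_mult_le:
  assumes F: "F \<in> hardy_space \<Gamma>" "y \<in> \<Gamma>" and G: "G \<in> hardy_space \<Gamma>" "y' \<in> \<Gamma>"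
  shows "(\<integral>\<^sup>+x. norm (F (cpoint x y)) * norm (G (cpoint x y')) \<partial>lborel) \<le> ennreal ((hardy_norm \<Gamma> F)\<^sup>2 + (hardy_norm \<Gamma> G)\<^sup>2)"
proof -
  note [measurable] = square_integrable_slice[OF F] square_integrable_slice[OF G]
  have "(\<integral>\<^sup>+x. norm (F (cpoint x y)) * norm (G (cpoint x y')) \<partial>lborel) \<le>
    (\<integral>\<^sup>+x. ennreal ((norm (F (cpoint x y)))\<^sup>2) + ennreal ((norm (G (cpoint x y')))\<^sup>2) \<partial>lborel)"
  proof (intro nn_integral_mono)
    fix x
    have "norm (F (cpoint x y)) * norm (G (cpoint x y')) \<le> (norm (F (cpoint x y)))\<^sup>2 + (norm (G (cpoint x y')))\<^sup>2"
      by (rule order_trans[OF norm_mult_le_squares]) simp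
    then show "ennreal (norm (F (cpoint x y)) * norm (G (cpoint x y'))) \<le> ennreal ((norm (F (cpoint x y)))\<^sup>2) + ennreal ((norm (G (cpoint x y')))\<^sup>2)"
      by (simp flip: ennreal_plus)
  qed
  also have "\<dots> = nn_energy (slice F y) + nn_energy (slice G y')"
    by (intro nn_integral_add) measurable
  also have "\<dots> \<le> ennreal ((hardy_norm \<Gamma> F)\<^sup>2) + ennreal ((hardy_norm \<Gamma> G)\<^sup>2)"
    by (intro add_mono hardy_slice_nn_le F G)
  finally show ?thesis by simp
qed

text \<open>With \<open>c = y + y'\<close>, the function \<open>h\<close> multiplies
  \<open>F\<close> by the reflection of \<open>G\<close> in the height \<open>c\<close>, so its
  slice at height \<open>w\<close> pairs \<open>F\<close> at \<open>w\<close> with \<open>G\<close>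
  at \<open>c - w\<close>. It is holomorphic over the convex open set of those \<open>w\<close> for
  which both heights lie in the cone, and its slice integrals are constant there.\<close>

lemma slice_pairing_invariant:
  assumes cone: "open_cone \<Gamma>" and F: "F \<in> hardy_space \<Gamma>" and G: "G \<in> hardy_space \<Gamma>"
    and y: "y \<in> \<Gamma>" "y' \<in> \<Gamma>" "u \<in> \<Gamma>" "u' \<in> \<Gamma>" "y + y' = u + u'"
  shows "(LINT x|lborel. F (cpoint x y) * cnj (G (cpoint x y'))) = (LINT x|lborel. F (cpoint x u) * cnj (G (cpoint x u')))"
proof -
  define c where "c = y + y'"
  define U where "U = \<Gamma> \<inter> {w. c - w \<in> \<Gamma>}"
  have refl: "cpoint 0 c + vcnj (cpoint x w) = cpoint x (c - w)" for x w
    by (simp add: vec_eq_iff complex_eq_iff)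
  have op: "open U"
  proof -
    have "continuous_on UNIV (\<lambda>w. c - w)" by (intro continuous_intros)
    from open_vimage[OF open_cone_imp_open[OF cone] this] show ?thesis
      using open_cone_imp_open[OF cone] unfolding U_def vimage_def by auto
  qed
  have cv: "convex U"
  proof (rule convexI)
    fix a b and p q :: real
    assume a: "a \<in> U" "b \<in> U" "0 \<le> p" "0 \<le> q" "p + q = 1"
    then have "p *\<^sub>R (c - a) + q *\<^sub>R (c - b) \<in> \<Gamma>" "p *\<^sub>R a + q *\<^sub>R b \<in> \<Gamma>"
      using convexD[OF open_cone_imp_convex[OF cone]] by (auto simp: U_def)
    moreover have "p *\<^sub>R (c - a) + q *\<^sub>R (c - b) = (p + q) *\<^sub>R c - (p *\<^sub>R a + q *\<^sub>R b)" by (simp add: algebra_simps)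
    ultimately show "p *\<^sub>R a + q *\<^sub>R b \<in> U" using a by (simp add: U_def)
  qed
  define h where "h z = F z * cnj (G (cpoint 0 c + vcnj z))" for z
  have hol: "vec_holomorphic_on h (tube U)"
    unfolding h_def
  proof (intro vec_holomorphic_on_mult vec_holomorphic_on_reflect)
    show "vec_holomorphic_on F (tube U)"
      by (rule vec_holomorphic_on_subset[OF hardy_space_holomorphic[OF F]]) (auto simp: mem_tube_iff U_def)
    show "vec_holomorphic_on G (tube \<Gamma>)" by (rule hardy_space_holomorphic[OF G])
    show "cpoint 0 c + vcnj z \<in> tube \<Gamma>" if "z \<in> tube U" for z
      using refl[of "revec z" "imvec z"] that by (simp add: mem_tube_iff U_def)
  qed
  have "c - y = y'" "c - u = u'" unfolding c_def using y(5) by (metis add_diff_cancel_left')+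
  then have mem: "y \<in> U" "u \<in> U" using y by (auto simp: U_def)
  have "(LINT x|lborel. h (cpoint x y)) = (LINT x|lborel. h (cpoint x u))"
  proof (rule integral_slice_constant[OF hol op cv mem])
    fix w assume "w \<in> closed_segment y u"
    then have w: "w \<in> U" using closed_segment_subset[OF mem cv] by blast
    then have w\<Gamma>: "w \<in> \<Gamma>" "c - w \<in> \<Gamma>" by (auto simp: U_def)
    show "(\<integral>\<^sup>+x. norm (h (cpoint x w)) \<partial>lborel) \<le> ennreal ((hardy_norm \<Gamma> F)\<^sup>2 + (hardy_norm \<Gamma> G)\<^sup>2)"
      using nn_integral_slice_mult_le[OF F w\<Gamma>(1) G w\<Gamma>(2)] by (simp add: h_def refl norm_mult)
  qed
  then show ?thesis unfolding h_def refl using \<open>c - y = y'\<close> \<open>c - u = u'\<close> by simp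
qed

subsection \<open>Boundary values and the inner product\<close>

text \<open>The height is halved so that the argument is the sum of two heights: pairing the slices
  at \<open>y\<close> and \<open>y'\<close> gives \<open>slice_energy F (y + y')\<close>.\<close>

definition slice_energy :: "(complex^'n \<Rightarrow> complex) \<Rightarrow> real^'n \<Rightarrow> real" where
  "slice_energy F y = energy (\<lambda>x. F (cpoint x ((1/2) *\<^sub>R y)))"

lemma mult_cnj_self: "a * cnj a = of_real ((norm a)\<^sup>2)"
  by (rule complex_norm_square[symmetric])

context
  fixes \<Gamma> :: "(real^'n) set" and F :: "complex^'n \<Rightarrow> complex"
  assumes cone: "open_cone \<Gamma>" and F: "F \<in> hardy_space \<Gamma>"
begin

lemma half_mem: "y \<in> \<Gamma> \<Longrightarrow> (1/2) *\<^sub>R y \<in> \<Gamma>"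
  using cone by (intro open_cone_scale) auto

text \<open>Both heights are moved to their midpoint, where the pairing is an energy and therefore
  real and nonnegative.\<close>

lemma slice_pairing_eq_energy:
  assumes "y \<in> \<Gamma>" "y' \<in> \<Gamma>"
  shows "(LINT x|lborel. F (cpoint x y) * cnj (F (cpoint x y'))) = of_real (slice_energy F (y + y'))"
proof -
  have "(LINT x|lborel. F (cpoint x y) * cnj (F (cpoint x y'))) =
    (LINT x|lborel. F (cpoint x ((1/2) *\<^sub>R (y + y'))) * cnj (F (cpoint x ((1/2) *\<^sub>R (y + y')))))"
  proof (rule slice_pairing_invariant[OF cone F F assms])
    show "(1/2) *\<^sub>R (y + y') \<in> \<Gamma>" "(1/2) *\<^sub>R (y + y') \<in> \<Gamma>" using assms by (auto intro!: half_mem open_cone_add[OF cone])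
    show "y + y' = (1/2) *\<^sub>R (y + y') + (1/2) *\<^sub>R (y + y')" by (simp flip: scaleR_add_left)
  qed
  also have "\<dots> = of_real (slice_energy F (y + y'))"
    unfolding slice_energy_def mult_cnj_self by (rule integral_complex_of_real)
  finally show ?thesis .
qed

lemma slice_energy_double: "slice_energy F (y + y) = energy (slice F y)"
proof -
  have "(1/2) *\<^sub>R (y + y) = y" by (simp add: vec_eq_iff)
  then show ?thesis by (simp only: slice_energy_def)
qed

lemma slice_energy_le: "y \<in> \<Gamma> \<Longrightarrow> slice_energy F y \<le> (hardy_norm \<Gamma> F)\<^sup>2"
  unfolding slice_energy_def by (rule hardy_slice_le[OF F half_mem])

text \<open>Expanding the square produces two cross terms, which coincide because both depend on
  \<open>y + y'\<close> alone. This identity gives midpoint convexity as well as the Cauchy property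
  of the slices.\<close>

lemma integral_norm_slice_diff:
  assumes y: "y \<in> \<Gamma>" "y' \<in> \<Gamma>"
  shows "energy (\<lambda>x. F (cpoint x y) - F (cpoint x y')) =
    slice_energy F (y + y) + slice_energy F (y' + y') - 2 * slice_energy F (y + y')"
proof -
  note s = square_integrable_slice[OF F y(1)] square_integrable_slice[OF F y(2)]
  have i: "integrable lborel (\<lambda>x. F (cpoint x a) * cnj (F (cpoint x b)))" if "a \<in> \<Gamma>" "b \<in> \<Gamma>" for a b
    by (intro integrable_mult_cnj square_integrable_slice[OF F] that)
  have "complex_of_real (energy (\<lambda>x. F (cpoint x y) - F (cpoint x y'))) =
     (LINT x|lborel. (F (cpoint x y) * cnj (F (cpoint x y)) + F (cpoint x y') * cnj (F (cpoint x y'))) -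
        (F (cpoint x y) * cnj (F (cpoint x y')) + F (cpoint x y') * cnj (F (cpoint x y))))"
    unfolding integral_complex_of_real[symmetric] mult_cnj_self[symmetric]
    by (intro Bochner_Integration.integral_cong refl) (simp add: algebra_simps)
  also have "\<dots> = of_real (slice_energy F (y + y) + slice_energy F (y' + y') - 2 * slice_energy F (y + y'))"
    using y by (simp add: i slice_pairing_eq_energy add.commute[of y' y])
  finally show ?thesis by (simp only: of_real_eq_iff)
qed

lemma slice_energy_midpoint:
  assumes "y \<in> \<Gamma>" "y' \<in> \<Gamma>"
  shows "2 * slice_energy F (y + y') \<le> slice_energy F (y + y) + slice_energy F (y' + y')"
proof -
  have "0 \<le> energy (\<lambda>x. F (cpoint x y) - F (cpoint x y'))"
    by (intro integral_nonneg_AE) auto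
  then show ?thesis unfolding integral_norm_slice_diff[OF assms] by simp
qed

text \<open>A midpoint-convex function that is bounded along a ray cannot increase along it.\<close>

lemma slice_energy_antimono:
  assumes y: "y \<in> \<Gamma>" and \<eta>: "\<eta> \<in> \<Gamma>"
  shows "slice_energy F (y + \<eta>) \<le> slice_energy F y"
proof (rule ccontr)
  assume "\<not> ?thesis"
  define \<delta> where "\<delta> = slice_energy F (y + \<eta>) - slice_energy F y"
  have \<delta>: "\<delta> > 0" using \<open>\<not> slice_energy F (y + \<eta>) \<le> slice_energy F y\<close> by (simp add: \<delta>_def)
  \<comment> \<open>The point \<open>y + 2^k *\<^sub>R \<eta>\<close> is the midpoint of
    \<open>y\<close> and \<open>y + 2^Suc k *\<^sub>R \<eta>\<close>, so the increase over the value
    at \<open>y\<close> at least doubles with each step; eventually it exceeds the bound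
    \<open>slice_energy_le\<close>.\<close>
  have grow: "slice_energy F (y + 2^k *\<^sub>R \<eta>) \<ge> slice_energy F y + 2^k * \<delta>" for k
  proof (induction k)
    case (Suc k)
    have mem: "y + 2 ^ Suc k *\<^sub>R \<eta> \<in> \<Gamma>"
      by (intro open_cone_add[OF cone] open_cone_scale[OF cone] y \<eta>) auto
    have "2 * slice_energy F ((1/2) *\<^sub>R y + (1/2) *\<^sub>R (y + 2^Suc k *\<^sub>R \<eta>)) \<le>
      slice_energy F ((1/2) *\<^sub>R y + (1/2) *\<^sub>R y) + slice_energy F ((1/2) *\<^sub>R (y + 2^Suc k *\<^sub>R \<eta>) + (1/2) *\<^sub>R (y + 2^Suc k *\<^sub>R \<eta>))"
      by (rule slice_energy_midpoint[OF half_mem[OF y] half_mem[OF mem]])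
    moreover have "(1/2) *\<^sub>R y + (1/2) *\<^sub>R (y + 2^Suc k *\<^sub>R \<eta>) = y + 2^k *\<^sub>R \<eta>"
      by (simp add: vec_eq_iff field_simps)
    moreover have "(1/2) *\<^sub>R w + (1/2) *\<^sub>R w = w" for w :: "real^'n"
      by (simp add: vec_eq_iff)
    ultimately have "2 * slice_energy F (y + 2^k *\<^sub>R \<eta>) \<le> slice_energy F y + slice_energy F (y + 2^Suc k *\<^sub>R \<eta>)"
      by simp
    with Suc.IH show ?case by (simp add: algebra_simps)
  qed (simp add: \<delta>_def)
  obtain k where k: "((hardy_norm \<Gamma> F)\<^sup>2 - slice_energy F y) / \<delta> < 2^k"
    using real_arch_pow[of 2] by auto
  have "y + 2 ^ k *\<^sub>R \<eta> \<in> \<Gamma>"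
    by (intro open_cone_add[OF cone] open_cone_scale[OF cone] y \<eta>) auto
  from slice_energy_le[OF this] grow[of k] k \<delta> show False by (simp add: field_simps)
qed

text \<open>Take \<open>y0\<close> whose energy is almost the supremum. Since the cone is open,
  \<open>y0 - y\<close> lies in it for every short \<open>y\<close>, and by monotonicity the energy
  at \<open>y\<close> is at least the one at \<open>y0\<close>.\<close>

lemma slice_energy_near_0:
  assumes "e > 0"
  obtains \<delta> where "\<delta> > 0" "\<And>y. y \<in> \<Gamma> \<Longrightarrow> norm y < \<delta> \<Longrightarrow> (hardy_norm \<Gamma> F)\<^sup>2 - e \<le> slice_energy F y"
proof -
  obtain y0 where y0: "y0 \<in> \<Gamma>" "(hardy_norm \<Gamma> F)\<^sup>2 - e < slice_energy F y0"
  \<comment> \<open>A negative target is treated apart because \<open>hardy_norm_sq_leI\<close> asks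
    for a nonnegative bound.\<close>
  proof (cases "(hardy_norm \<Gamma> F)\<^sup>2 - e < 0")
    case True
    moreover obtain y where "y \<in> \<Gamma>" using cone by (auto simp: open_cone_def)
    moreover have "0 \<le> slice_energy F y" for y unfolding slice_energy_def by (intro integral_nonneg_AE) auto
    ultimately show ?thesis using that less_le_trans by blast
  next
    case False
    have "\<exists>y\<in>\<Gamma>. (hardy_norm \<Gamma> F)\<^sup>2 - e < energy (slice F y)"
    proof (rule ccontr)
      assume "\<not> ?thesis"
      then have le: "energy (slice F y) \<le> (hardy_norm \<Gamma> F)\<^sup>2 - e" if "y \<in> \<Gamma>" for y
        using that by fastforce
      have "(hardy_norm \<Gamma> F)\<^sup>2 \<le> (hardy_norm \<Gamma> F)\<^sup>2 - e"
      proof (rule hardy_norm_sq_leI(2))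
        fix y assume y: "y \<in> \<Gamma>"
        show "nn_energy (slice F y) \<le> ennreal ((hardy_norm \<Gamma> F)\<^sup>2 - e)"
          using square_integrable_slice[OF F y] le[OF y]
          by (subst nn_integral_eq_integral) (auto simp: square_integrable_def intro: ennreal_leI)
      qed (use False in simp)
      with assms show False by simp
    qed
    then show ?thesis
      using that slice_energy_double open_cone_add[OF cone] by metis
  qed
  obtain \<delta> where \<delta>: "\<delta> > 0" "ball y0 \<delta> \<subseteq> \<Gamma>"
    using y0(1) open_cone_imp_open[OF cone] open_contains_ball by blast
  show ?thesis
  proof (rule that[OF \<delta>(1)])
    fix y assume y: "y \<in> \<Gamma>" "norm y < \<delta>"
    have "y0 - y \<in> ball y0 \<delta>" using y by (simp add: dist_norm)
    then have "y0 - y \<in> \<Gamma>" using \<delta>(2) by blast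
    from slice_energy_antimono[OF y(1) this] y0(2) show "(hardy_norm \<Gamma> F)\<^sup>2 - e \<le> slice_energy F y"
      by simp
  qed
qed

text \<open>In \<open>integral_norm_slice_diff\<close> the two squares are at most the squared norm,
  and near the vertex the cross term is within \<open>e / 2\<close> of it.\<close>

lemma slices_Cauchy:
  assumes "e > 0"
  obtains \<delta> where "\<delta> > 0" "\<And>y y'. y \<in> \<Gamma> \<Longrightarrow> y' \<in> \<Gamma> \<Longrightarrow> norm y < \<delta> \<Longrightarrow> norm y' < \<delta> \<Longrightarrow>
      (energy (\<lambda>x. F (cpoint x y) - F (cpoint x y'))) \<le> e"
proof -
  obtain \<delta> where \<delta>: "\<delta> > 0" "\<And>y. y \<in> \<Gamma> \<Longrightarrow> norm y < \<delta> \<Longrightarrow> (hardy_norm \<Gamma> F)\<^sup>2 - e / 2 \<le> slice_energy F y"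
    using slice_energy_near_0[of "e/2"] assms by auto
  show ?thesis
  proof (rule that[of "\<delta>/2"])
    fix y y' assume y: "y \<in> \<Gamma>" "y' \<in> \<Gamma>" "norm y < \<delta>/2" "norm y' < \<delta>/2"
    have "norm (y + y') < \<delta>" using norm_triangle_ineq[of y y'] y by linarith
    then show "energy (\<lambda>x. F (cpoint x y) - F (cpoint x y')) \<le> e"
      unfolding integral_norm_slice_diff[OF y(1,2)]
      using \<delta>(2)[OF open_cone_add[OF cone y(1,2)]] slice_energy_le[OF open_cone_add[OF cone y(1,1)]]
        slice_energy_le[OF open_cone_add[OF cone y(2,2)]]
      by simp
  qed (use \<delta> in simp)
qed

lemma boundary_limit_exists:
  "\<exists>b. b \<in> borel_measurable lborel \<and>
     ((\<lambda>\<eta>. \<integral>\<^sup>+\<xi>. ennreal ((norm (F (cpoint \<xi> \<eta>) - b \<xi>))\<^sup>2) \<partial>lborel) \<longlongrightarrow> 0) (at 0 within \<Gamma>)"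
proof -
  have "\<exists>\<delta>. \<forall>n. \<delta> n > 0 \<and> (\<forall>y y'. y \<in> \<Gamma> \<longrightarrow> y' \<in> \<Gamma> \<longrightarrow> norm y < \<delta> n \<longrightarrow> norm y' < \<delta> n \<longrightarrow>
      (energy (\<lambda>x. F (cpoint x y) - F (cpoint x y'))) \<le> (1/8)^n)"
  proof (rule choice, rule allI)
    fix n :: nat
    have "(0::real) < (1/8)^n" by simp
    then obtain \<delta> where "\<delta> > 0" "\<And>y y'. y \<in> \<Gamma> \<Longrightarrow> y' \<in> \<Gamma> \<Longrightarrow> norm y < \<delta> \<Longrightarrow> norm y' < \<delta> \<Longrightarrow>
      (energy (\<lambda>x. F (cpoint x y) - F (cpoint x y'))) \<le> (1/8)^n"
      by (rule slices_Cauchy) blast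
    then show "\<exists>\<delta>>0. \<forall>y y'. y \<in> \<Gamma> \<longrightarrow> y' \<in> \<Gamma> \<longrightarrow> norm y < \<delta> \<longrightarrow> norm y' < \<delta> \<longrightarrow>
      (energy (\<lambda>x. F (cpoint x y) - F (cpoint x y'))) \<le> (1/8)^n" by blast
  qed
  then obtain \<delta> where \<delta>: "\<And>n::nat. \<delta> n > 0" "\<And>n y y'. y \<in> \<Gamma> \<Longrightarrow> y' \<in> \<Gamma> \<Longrightarrow> norm y < \<delta> n \<Longrightarrow> norm y' < \<delta> n \<Longrightarrow>
      (energy (\<lambda>x. F (cpoint x y) - F (cpoint x y'))) \<le> (1/8)^n"
    by blast
  have \<delta>': "nn_energy (\<lambda>x. F (cpoint x y) - F (cpoint x y')) \<le> ennreal ((1/8)^n)"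
    if "y \<in> \<Gamma>" "y' \<in> \<Gamma>" "norm y < \<delta> n" "norm y' < \<delta> n" for n y y'
    using \<delta>(2)[OF that] square_integrable_diff[OF square_integrable_slice[OF F that(1)] square_integrable_slice[OF F that(2)]]
    by (subst nn_integral_eq_integral) (auto simp: square_integrable_def intro: ennreal_leI)
  \<comment> \<open>Lying below all of \<open>\<delta> 0\<close>, ..., \<open>\<delta> m\<close>,
    the height \<open>Y m\<close> is admissible for every \<open>n \<le> m\<close>, although
    \<open>\<delta>\<close> need not be monotone.\<close>
  have "\<exists>y. y \<in> \<Gamma> \<and> norm y < Min (\<delta> ` {..n})" for n
  proof -
    have "0 < Min (\<delta> ` {..n})" using \<delta>(1) by simp
    then show ?thesis by (rule open_cone_small[OF cone]) blast
  qed
  then obtain Y where Y: "\<And>n. Y n \<in> \<Gamma>" "\<And>n. norm (Y n) < Min (\<delta> ` {..n})" by metis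
  have Yd: "norm (Y m) < \<delta> n" if "n \<le> m" for n m
    using Y(2)[of m] that by auto
  have meas: "(slice F y) \<in> borel_measurable borel" if "y \<in> \<Gamma>" for y
    using square_integrable_slice[OF F that] by (rule square_integrable_measurable)
  obtain b where b [measurable]: "b \<in> borel_measurable borel"
    "\<And>n. (nn_energy (\<lambda>x. F (cpoint x (Y n)) - b x)) \<le> ennreal ((1/8)^n)"
  proof (rule riesz_fischer_geometric[of "\<lambda>n x. F (cpoint x (Y n))"])
    show "(slice F (Y n)) \<in> borel_measurable borel" for n by (rule meas[OF Y(1)])
    show "nn_energy (\<lambda>x. F (cpoint x (Y n)) - F (cpoint x (Y m))) \<le> ennreal ((1/8)^n)"
      if "n \<le> m" for n m by (rule \<delta>'[OF Y(1) Y(1) Yd[OF order_refl] Yd[OF that]])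
  qed blast
  \<comment> \<open>The factor 4 is 2 + 2, from splitting at the slice of height \<open>Y n\<close>
    with \<open>norm_add_square_le\<close>.\<close>
  have close: "nn_energy (\<lambda>x. F (cpoint x y) - b x) \<le> ennreal (4 * (1/8)^n)"
    if y: "y \<in> \<Gamma>" "norm y < \<delta> n" for n y
  proof -
    note [measurable] = meas[OF y(1)] meas[OF Y(1)]
    have "nn_energy (\<lambda>x. F (cpoint x y) - b x) \<le>
      (\<integral>\<^sup>+x. 2 * ennreal ((norm (F (cpoint x y) - F (cpoint x (Y n))))\<^sup>2) + 2 * ennreal ((norm (F (cpoint x (Y n)) - b x))\<^sup>2) \<partial>lborel)"
    proof (intro nn_integral_mono)
      fix x
      have "(norm (F (cpoint x y) - b x))\<^sup>2 \<le> 2 * (norm (F (cpoint x y) - F (cpoint x (Y n))))\<^sup>2 + 2 * (norm (F (cpoint x (Y n)) - b x))\<^sup>2"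
        using norm_add_square_le[of "F (cpoint x y) - F (cpoint x (Y n))" "F (cpoint x (Y n)) - b x"] by simp
      from ennreal_leI[OF this] show "ennreal ((norm (F (cpoint x y) - b x))\<^sup>2) \<le> 2 * ennreal ((norm (F (cpoint x y) - F (cpoint x (Y n))))\<^sup>2) + 2 * ennreal ((norm (F (cpoint x (Y n)) - b x))\<^sup>2)"
        by (simp add: ennreal_mult)
    qed
    also have "\<dots> = 2 * nn_energy (\<lambda>x. F (cpoint x y) - F (cpoint x (Y n))) + 2 * nn_energy (\<lambda>x. F (cpoint x (Y n)) - b x)"
      by (subst nn_integral_add) (auto simp: nn_integral_cmult)
    also have "\<dots> \<le> 2 * ennreal ((1/8)^n) + 2 * ennreal ((1/8)^n)"
      by (intro add_mono mult_left_mono b \<delta>' y Y Yd) auto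
    also have "\<dots> = ennreal (2 * (1/8)^n + 2 * (1/8)^n)"
      by (subst ennreal_plus) (auto simp: ennreal_mult)
    finally show ?thesis by simp
  qed
  have "((\<lambda>\<eta>. \<integral>\<^sup>+\<xi>. ennreal ((norm (F (cpoint \<xi> \<eta>) - b \<xi>))\<^sup>2) \<partial>lborel) \<longlongrightarrow> 0) (at 0 within \<Gamma>)"
  proof (rule order_tendstoI)
    fix a :: ennreal assume "0 < a"
    have "(\<lambda>n. ennreal (4 * (1/8)^n)) \<longlonglongrightarrow> ennreal (4 * 0)"
      by (intro tendsto_intros LIMSEQ_realpow_zero) auto
    then have "eventually (\<lambda>n. ennreal (4 * (1/8)^n) < a) sequentially"
      using \<open>0 < a\<close> by (simp add: order_tendsto_iff)
    then obtain n where n: "ennreal (4 * (1/8)^n) < a" by (auto simp: eventually_sequentially)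
    show "\<forall>\<^sub>F \<eta> in at 0 within \<Gamma>. (nn_energy (\<lambda>\<xi>. F (cpoint \<xi> \<eta>) - b \<xi>)) < a"
      unfolding eventually_at
      using \<delta>(1)[of n] close[of _ n] n by (intro exI[of _ "\<delta> n"]) (auto simp: dist_norm intro: le_less_trans)
  qed auto
  then show ?thesis using b(1) by (intro exI[of _ b] conjI) simp_all
qed

text \<open>Existence of some boundary limit gives the function picked by \<open>SOME\<close> its
  defining properties; everything else about it is derived from these two.\<close>

lemma boundary_value_measurable [measurable]: "boundary_value \<Gamma> F \<in> borel_measurable borel"
  and boundary_value_tendsto:
    "((\<lambda>\<eta>. \<integral>\<^sup>+\<xi>. ennreal ((norm (F (cpoint \<xi> \<eta>) - boundary_value \<Gamma> F \<xi>))\<^sup>2) \<partial>lborel) \<longlongrightarrow> 0) (at 0 within \<Gamma>)"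
  using someI_ex[OF boundary_limit_exists] unfolding boundary_value_def[symmetric] by auto

lemma eventually_slice_close:
  "e > 0 \<Longrightarrow> \<forall>\<^sub>F \<eta> in at 0 within \<Gamma>. \<eta> \<in> \<Gamma> \<and> square_integrable (\<lambda>x. F (cpoint x \<eta>) - boundary_value \<Gamma> F x) \<and>
     (energy (\<lambda>x. F (cpoint x \<eta>) - boundary_value \<Gamma> F x)) < e"
proof -
  assume "e > 0"
  then have "\<forall>\<^sub>F \<eta> in at 0 within \<Gamma>. (nn_energy (\<lambda>\<xi>. F (cpoint \<xi> \<eta>) - boundary_value \<Gamma> F \<xi>)) < ennreal e"
    using order_tendstoD(2)[OF boundary_value_tendsto, of "ennreal e"] by simp
  moreover have "\<forall>\<^sub>F \<eta> in at 0 within \<Gamma>. \<eta> \<in> \<Gamma>"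
    by (auto simp: eventually_at intro: exI[of _ 1])
  ultimately show ?thesis
  proof eventually_elim
    case (elim \<eta>)
    note [measurable] = square_integrable_slice[OF F elim(2)]
    have s: "square_integrable (\<lambda>x. F (cpoint x \<eta>) - boundary_value \<Gamma> F x)"
      unfolding square_integrable_iff_nn using elim(1) by (auto intro: less_trans)
    then have "ennreal (energy (\<lambda>x. F (cpoint x \<eta>) - boundary_value \<Gamma> F x)) < ennreal e"
      using elim(1) by (subst nn_integral_eq_integral[symmetric]) (auto simp: square_integrable_def)
    then show ?case using s elim(2) by (simp add: ennreal_less_iff integral_nonneg_AE)
  qed
qed

lemma square_integrable_boundary_value: "square_integrable (boundary_value \<Gamma> F)"
proof -
  have "\<exists>\<eta>. \<eta> \<in> \<Gamma> \<and> square_integrable (\<lambda>x. F (cpoint x \<eta>) - boundary_value \<Gamma> F x)"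
    using eventually_happens'[OF trivial_limit_at_0_within_cone[OF cone] eventually_slice_close[of 1]] by auto
  then obtain \<eta> where "\<eta> \<in> \<Gamma>" "square_integrable (\<lambda>x. F (cpoint x \<eta>) - boundary_value \<Gamma> F x)" by blast
  from square_integrable_diff[OF square_integrable_slice[OF F this(1)] this(2)] show ?thesis by simp
qed

lemma boundary_value_L2_tendsto:
  "((\<lambda>\<eta>. LINT x|lborel. (norm (F (cpoint x \<eta>) - boundary_value \<Gamma> F x))\<^sup>2) \<longlongrightarrow> 0) (at 0 within \<Gamma>)"
proof (rule tendstoI)
  fix e :: real assume "e > 0"
  from eventually_slice_close[OF this]
  show "\<forall>\<^sub>F \<eta> in at 0 within \<Gamma>. dist (energy (\<lambda>x. F (cpoint x \<eta>) - boundary_value \<Gamma> F x)) 0 < e"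
    by eventually_elim (simp add: integral_nonneg_AE)
qed

text \<open>The supremum that defines the norm is thus a limit at the vertex of the cone, which is
  what the boundary value sees.\<close>

lemma slice_energy_tendsto:
  "((\<lambda>\<eta>. LINT x|lborel. (norm (F (cpoint x \<eta>)))\<^sup>2) \<longlongrightarrow> (hardy_norm \<Gamma> F)\<^sup>2) (at 0 within \<Gamma>)"
proof (rule tendstoI)
  fix e :: real assume "e > 0"
  then obtain \<delta> where \<delta>: "\<delta> > 0" "\<And>y. y \<in> \<Gamma> \<Longrightarrow> norm y < \<delta> \<Longrightarrow> (hardy_norm \<Gamma> F)\<^sup>2 - e/2 \<le> slice_energy F y"
    using slice_energy_near_0[of "e/2"] by auto
  show "\<forall>\<^sub>F \<eta> in at 0 within \<Gamma>. dist (energy (slice F \<eta>)) ((hardy_norm \<Gamma> F)\<^sup>2) < e"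
    unfolding eventually_at
  proof (intro exI[of _ "\<delta>/2"] conjI ballI impI)
    fix \<eta> assume \<eta>: "\<eta> \<in> \<Gamma>" "\<eta> \<noteq> 0 \<and> dist \<eta> 0 < \<delta> / 2"
    have "norm (\<eta> + \<eta>) < \<delta>" using norm_triangle_ineq[of \<eta> \<eta>] \<eta> by simp
    from \<delta>(2)[OF open_cone_add[OF cone \<eta>(1) \<eta>(1)] this] slice_energy_le[OF open_cone_add[OF cone \<eta>(1) \<eta>(1)]] \<open>e > 0\<close>
    show "dist (energy (slice F \<eta>)) ((hardy_norm \<Gamma> F)\<^sup>2) < e"
      unfolding slice_energy_double by (simp add: dist_real_def)
  qed (use \<delta> in auto)
qed

end

text \<open>Transfers the inner product from chosen boundary values to slices of the given
  functions. Linearity, Cauchy-Schwarz and the reproducing property are all obtained on slices and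
  passed to this limit.\<close>

lemma hardy_inner_tendsto:
  assumes cone: "open_cone \<Gamma>" and F: "F \<in> hardy_space \<Gamma>" and G: "G \<in> hardy_space \<Gamma>"
  shows "((\<lambda>\<eta>. LINT x|lborel. F (cpoint x \<eta>) * cnj (G (cpoint x \<eta>))) \<longlongrightarrow> hardy_inner \<Gamma> F G) (at 0 within \<Gamma>)"
proof (rule Lim_transform2)
  let ?f = "boundary_value \<Gamma> F" and ?g = "boundary_value \<Gamma> G"
  note sf = square_integrable_boundary_value[OF cone F] and sg = square_integrable_boundary_value[OF cone G]
  show "((\<lambda>\<eta>. hardy_inner \<Gamma> F G) \<longlongrightarrow> hardy_inner \<Gamma> F G) (at 0 within \<Gamma>)" by simp
  let ?dF = "\<lambda>\<eta>. LINT x|lborel. (norm (F (cpoint x \<eta>) - ?f x))\<^sup>2"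
  let ?dG = "\<lambda>\<eta>. LINT x|lborel. (norm (G (cpoint x \<eta>) - ?g x))\<^sup>2"
  let ?N = "LINT x|lborel. (norm (?f x))\<^sup>2"
  have "((\<lambda>\<eta>. sqrt (?dF \<eta> * (hardy_norm \<Gamma> G)\<^sup>2) + sqrt (?N * ?dG \<eta>)) \<longlongrightarrow> sqrt (0 * (hardy_norm \<Gamma> G)\<^sup>2) + sqrt (?N * 0)) (at 0 within \<Gamma>)"
    by (intro tendsto_intros boundary_value_L2_tendsto cone F G)
  then have lim: "((\<lambda>\<eta>. sqrt (?dF \<eta> * (hardy_norm \<Gamma> G)\<^sup>2) + sqrt (?N * ?dG \<eta>)) \<longlongrightarrow> 0) (at 0 within \<Gamma>)" by simp
  show "((\<lambda>\<eta>. hardy_inner \<Gamma> F G - (LINT x|lborel. F (cpoint x \<eta>) * cnj (G (cpoint x \<eta>)))) \<longlongrightarrow> 0) (at 0 within \<Gamma>)"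
  proof (rule Lim_null_comparison[OF _ lim])
    show "\<forall>\<^sub>F \<eta> in at 0 within \<Gamma>. norm (hardy_inner \<Gamma> F G - (LINT x|lborel. F (cpoint x \<eta>) * cnj (G (cpoint x \<eta>))))
       \<le> sqrt (?dF \<eta> * (hardy_norm \<Gamma> G)\<^sup>2) + sqrt (?N * ?dG \<eta>)"
      using eventually_slice_close[OF cone F zero_less_one] eventually_slice_close[OF cone G zero_less_one]
    proof eventually_elim
      case (elim \<eta>)
      let ?F = "\<lambda>x. F (cpoint x \<eta>)" and ?G = "\<lambda>x. G (cpoint x \<eta>)"
      have \<eta>: "\<eta> \<in> \<Gamma>" using elim by simp
      have a: "square_integrable (\<lambda>x. ?F x - ?f x)" and b: "square_integrable (\<lambda>x. ?G x - ?g x)" using elim by auto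
      have c: "square_integrable ?F" "square_integrable ?G" by (intro square_integrable_slice[OF F] square_integrable_slice[OF G] \<eta>)+
      have "(LINT x|lborel. ?F x * cnj (?G x)) - hardy_inner \<Gamma> F G = (LINT x|lborel. ?F x * cnj (?G x) - ?f x * cnj (?g x))"
        unfolding hardy_inner_def by (intro Bochner_Integration.integral_diff[symmetric] integrable_mult_cnj c sf sg)
      also have "\<dots> = (LINT x|lborel. (?F x - ?f x) * cnj (?G x) + ?f x * cnj (?G x - ?g x))"
        by (intro Bochner_Integration.integral_cong refl) (simp add: algebra_simps)
      also have "\<dots> = (LINT x|lborel. (?F x - ?f x) * cnj (?G x)) + (LINT x|lborel. ?f x * cnj (?G x - ?g x))"
        by (intro Bochner_Integration.integral_add integrable_mult_cnj a b c sf)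
      finally have eq: "(LINT x|lborel. ?F x * cnj (?G x)) - hardy_inner \<Gamma> F G =
        (LINT x|lborel. (?F x - ?f x) * cnj (?G x)) + (LINT x|lborel. ?f x * cnj (?G x - ?g x))" .
      have "norm ((LINT x|lborel. ?F x * cnj (?G x)) - hardy_inner \<Gamma> F G) \<le>
        norm (LINT x|lborel. (?F x - ?f x) * cnj (?G x)) + norm (LINT x|lborel. ?f x * cnj (?G x - ?g x))"
        unfolding eq by (rule norm_triangle_ineq)
      also have "\<dots> \<le> sqrt (?dF \<eta> * (hardy_norm \<Gamma> G)\<^sup>2) + sqrt (?N * ?dG \<eta>)"
      proof (intro add_mono real_le_rsqrt)
        have "(norm (LINT x|lborel. (?F x - ?f x) * cnj (?G x)))\<^sup>2 \<le> ?dF \<eta> * energy ?G"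
          by (rule Cauchy_Schwarz_integral[OF a c(2)])
        also have "\<dots> \<le> ?dF \<eta> * (hardy_norm \<Gamma> G)\<^sup>2"
          by (intro mult_left_mono hardy_slice_le G \<eta> integral_nonneg_AE) auto
        finally show "(norm (LINT x|lborel. (?F x - ?f x) * cnj (?G x)))\<^sup>2 \<le> ?dF \<eta> * (hardy_norm \<Gamma> G)\<^sup>2" .
        show "(norm (LINT x|lborel. ?f x * cnj (?G x - ?g x)))\<^sup>2 \<le> ?N * ?dG \<eta>"
          by (rule Cauchy_Schwarz_integral[OF sf b])
      qed
      finally show ?case by (simp add: norm_minus_commute)
    qed
  qed
qed

lemma hardy_inner_self:
  assumes cone: "open_cone \<Gamma>" and F: "F \<in> hardy_space \<Gamma>"
  shows "hardy_inner \<Gamma> F F = of_real ((hardy_norm \<Gamma> F)\<^sup>2)"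
proof (rule tendsto_unique[OF trivial_limit_at_0_within_cone[OF cone] hardy_inner_tendsto[OF cone F F]])
  show "((\<lambda>\<eta>. LINT x|lborel. F (cpoint x \<eta>) * cnj (F (cpoint x \<eta>))) \<longlongrightarrow> of_real ((hardy_norm \<Gamma> F)\<^sup>2)) (at 0 within \<Gamma>)"
    unfolding mult_cnj_self integral_complex_of_real by (intro tendsto_of_real slice_energy_tendsto cone F)
qed

lemma hardy_inner_commute:
  "hardy_inner \<Gamma> G F = cnj (hardy_inner \<Gamma> F G)"
proof -
  have "cnj (hardy_inner \<Gamma> F G) = (LINT \<xi>|lborel. cnj (boundary_value \<Gamma> F \<xi> * cnj (boundary_value \<Gamma> G \<xi>)))"
    unfolding hardy_inner_def by (rule Bochner_Integration.integral_cnj[symmetric])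
  then show ?thesis by (simp add: hardy_inner_def mult.commute)
qed

section \<open>Linear structure of the Hardy space\<close>

lemma hardy_space_add_cmult:
  assumes F: "F \<in> hardy_space \<Gamma>" and G: "G \<in> hardy_space \<Gamma>"
  shows "(\<lambda>w. F w + c * G w) \<in> hardy_space \<Gamma>"
proof (rule hardy_spaceI)
  show "vec_holomorphic_on (\<lambda>w. F w + c * G w) (tube \<Gamma>)"
    by (intro vec_holomorphic_on_add vec_holomorphic_on_mult vec_holomorphic_on_const hardy_space_holomorphic F G)
  fix y assume y: "y \<in> \<Gamma>"
  note s = square_integrable_slice[OF F y] square_integrable_slice[OF G y]
  have "nn_energy (\<lambda>x. F (cpoint x y) + c * G (cpoint x y))
      \<le> (\<integral>\<^sup>+x. ennreal (2 * (norm (F (cpoint x y)))\<^sup>2 + 2 * (norm c)\<^sup>2 * (norm (G (cpoint x y)))\<^sup>2) \<partial>lborel)"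
    by (intro nn_integral_mono ennreal_leI order_trans[OF norm_add_square_le]) (auto simp: norm_mult power_mult_distrib)
  also have "\<dots> = ennreal (LINT x|lborel. 2 * (norm (F (cpoint x y)))\<^sup>2 + 2 * (norm c)\<^sup>2 * (norm (G (cpoint x y)))\<^sup>2)"
    using s by (intro nn_integral_eq_integral) (auto simp: square_integrable_def)
  also have "\<dots> \<le> ennreal (2 * (hardy_norm \<Gamma> F)\<^sup>2 + 2 * (norm c)\<^sup>2 * (hardy_norm \<Gamma> G)\<^sup>2)"
    using s by (intro ennreal_leI, subst Bochner_Integration.integral_add)
       (auto simp: square_integrable_def intro!: add_mono mult_left_mono hardy_slice_le F G y)
  finally show "nn_energy (\<lambda>x. F (cpoint x y) + c * G (cpoint x y)) \<le>
    ennreal (2 * (hardy_norm \<Gamma> F)\<^sup>2 + 2 * (norm c)\<^sup>2 * (hardy_norm \<Gamma> G)\<^sup>2)" .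
qed simp

lemma zero_in_hardy_space: "(\<lambda>w. 0) \<in> hardy_space \<Gamma>"
  by (rule hardy_spaceI[of _ _ 0]) (auto intro: vec_holomorphic_on_const)

lemma hardy_space_cmult: "F \<in> hardy_space \<Gamma> \<Longrightarrow> (\<lambda>w. c * F w) \<in> hardy_space \<Gamma>"
  using hardy_space_add_cmult[OF zero_in_hardy_space, of F \<Gamma> c] by simp

lemma hardy_inner_add_cmult:
  assumes cone: "open_cone \<Gamma>" and F: "F \<in> hardy_space \<Gamma>" and G: "G \<in> hardy_space \<Gamma>" and H: "H \<in> hardy_space \<Gamma>"
  shows "hardy_inner \<Gamma> (\<lambda>w. F w + c * G w) H = hardy_inner \<Gamma> F H + c * hardy_inner \<Gamma> G H"
proof (rule tendsto_unique[OF trivial_limit_at_0_within_cone[OF cone] hardy_inner_tendsto[OF cone hardy_space_add_cmult[OF F G] H]])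
  have "((\<lambda>\<eta>. (LINT x|lborel. F (cpoint x \<eta>) * cnj (H (cpoint x \<eta>))) + c * (LINT x|lborel. G (cpoint x \<eta>) * cnj (H (cpoint x \<eta>))))
     \<longlongrightarrow> hardy_inner \<Gamma> F H + c * hardy_inner \<Gamma> G H) (at 0 within \<Gamma>)"
    by (intro tendsto_intros hardy_inner_tendsto cone F G H)
  moreover have "\<forall>\<^sub>F \<eta> in at 0 within \<Gamma>. (LINT x|lborel. F (cpoint x \<eta>) * cnj (H (cpoint x \<eta>))) + c * (LINT x|lborel. G (cpoint x \<eta>) * cnj (H (cpoint x \<eta>)))
     = (LINT x|lborel. (F (cpoint x \<eta>) + c * G (cpoint x \<eta>)) * cnj (H (cpoint x \<eta>)))"
    using eventually_slice_close[OF cone F zero_less_one]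
  proof eventually_elim
    case (elim \<eta>)
    then have \<eta>: "\<eta> \<in> \<Gamma>" by simp
    have "integrable lborel (\<lambda>x. F (cpoint x \<eta>) * cnj (H (cpoint x \<eta>)))" "integrable lborel (\<lambda>x. G (cpoint x \<eta>) * cnj (H (cpoint x \<eta>)))"
      by (intro integrable_mult_cnj square_integrable_slice[OF F] square_integrable_slice[OF G] square_integrable_slice[OF H] \<eta>)+
    then show ?case by (simp add: ring_distribs mult.assoc)
  qed
  ultimately show "((\<lambda>\<eta>. LINT x|lborel. (F (cpoint x \<eta>) + c * G (cpoint x \<eta>)) * cnj (H (cpoint x \<eta>)))
     \<longlongrightarrow> hardy_inner \<Gamma> F H + c * hardy_inner \<Gamma> G H) (at 0 within \<Gamma>)"
    by (rule Lim_transform_eventually)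
qed

subsection \<open>Gaussians and the Fourier transform\<close>

lemma
  fixes g :: "'a::euclidean_space \<Rightarrow> real \<Rightarrow> 'b::{real_normed_field,banach,second_countable_topology}"
  assumes g: "\<And>b. b \<in> Basis \<Longrightarrow> integrable lborel (g b)"
  shows integrable_lborel_prod_Basis: "integrable lborel (\<lambda>x::'a. \<Prod>b\<in>Basis. g b (x \<bullet> b))"
    and integral_lborel_prod_Basis:
      "(LINT x|lborel. (\<Prod>b\<in>Basis. g b ((x::'a) \<bullet> b))) = (\<Prod>b\<in>Basis. (LINT x|lborel. g b x))"
proof -
  interpret product_sigma_finite "\<lambda>_::'a. lborel :: real measure" by standard
  have inner: "(\<Sum>c\<in>Basis. f c *\<^sub>R c) \<bullet> b = f b" if "b \<in> Basis" for b :: 'a and f :: "'a \<Rightarrow> real"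
    using that by simp
  have eq: "(\<Prod>b\<in>Basis. g b ((\<Sum>c\<in>Basis. f c *\<^sub>R c) \<bullet> b)) = (\<Prod>b\<in>Basis. g b (f b))" for f :: "'a \<Rightarrow> real"
    by (intro prod.cong refl arg_cong[where f="g _"] inner)
  have meas: "(\<lambda>x::'a. \<Prod>b\<in>Basis. g b (x \<bullet> b)) \<in> borel_measurable borel"
  proof (intro borel_measurable_prod)
    fix b :: 'a assume b: "b \<in> Basis"
    have [measurable]: "g b \<in> borel_measurable borel" using borel_measurable_integrable[OF g[OF b]] by simp
    show "(\<lambda>x. g b (x \<bullet> b)) \<in> borel_measurable borel" by measurable
  qed
  have T: "(\<lambda>f. \<Sum>b\<in>Basis. f b *\<^sub>R b) \<in> (\<Pi>\<^sub>M b\<in>(Basis::'a set). lborel) \<rightarrow>\<^sub>M borel"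
    by measurable
  show "integrable lborel (\<lambda>x::'a. \<Prod>b\<in>Basis. g b (x \<bullet> b))"
    by (subst lborel_eq, subst integrable_distr_eq[OF T meas], subst eq)
       (intro product_integrable_prod g finite_Basis)
  show "(LINT x|lborel. (\<Prod>b\<in>Basis. g b ((x::'a) \<bullet> b))) = (\<Prod>b\<in>Basis. (LINT x|lborel. g b x))"
    by (subst lborel_eq, subst integral_distr[OF T meas], subst eq)
       (intro product_integral_prod g finite_Basis)
qed

lemma integrable_exp_abs:
  assumes "0 < (a::real)" shows "integrable lborel (\<lambda>x. exp (- (a * \<bar>x\<bar>)))"
proof -
  have i: "integrable lborel (\<lambda>x::real. indicator {0<..} x *\<^sub>R exp (- (x * a)))"
    using integrable_I0i_exp_mscale[OF assms] by (simp add: set_integrable_def)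
  have "integrable lborel (\<lambda>x::real. indicator {0<..} (- x) *\<^sub>R exp (- (- x * a)))"
    using lborel_integrable_real_affine[OF i, of "-1" 0] by simp
  from Bochner_Integration.integrable_add[OF i this]
  show ?thesis
  proof (rule integrable_cong_AE_imp)
    have "AE x in lborel. x \<noteq> (0::real)" by (rule AE_lborel_singleton)
    then show "AE x in lborel. indicator {0<..} x *\<^sub>R exp (- (x * a)) + indicator {0<..} (- x) *\<^sub>R exp (- (- x * a)) = exp (- (a * \<bar>x\<bar>))"
      by eventually_elim (auto simp: indicator_def abs_if mult.commute)
  qed measurable
qed

text \<open>The norm dominates every coordinate, hence the average of their absolute values; so the
  function lies below a product of one-dimensional exponentials.\<close>

lemma integrable_exp_norm:
  assumes "0 < (a::real)" shows "integrable lborel (\<lambda>x::'a::euclidean_space. exp (- (a * norm x)))"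
proof (rule Bochner_Integration.integrable_bound)
  let ?n = "real DIM('a)"
  have n: "?n > 0" by simp
  show "integrable lborel (\<lambda>x::'a. \<Prod>b\<in>Basis. exp (- ((a / ?n) * \<bar>x \<bullet> b\<bar>)))"
    by (rule integrable_lborel_prod_Basis, rule integrable_exp_abs) (use assms n in simp)
  show "AE x in lborel. norm (exp (- (a * norm x))) \<le> norm (\<Prod>b\<in>Basis. exp (- ((a / ?n) * \<bar>(x::'a) \<bullet> b\<bar>)))"
  proof (rule AE_I2)
    fix x :: 'a
    have "(\<Sum>b\<in>Basis. (a / ?n) * \<bar>x \<bullet> b\<bar>) \<le> (\<Sum>b\<in>(Basis::'a set). (a / ?n) * norm x)"
      using assms by (intro sum_mono mult_left_mono Basis_le_norm) auto
    also have "\<dots> = a * norm x" using n by simp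
    finally have "exp (- (a * norm x)) \<le> exp (- (\<Sum>b\<in>Basis. (a / ?n) * \<bar>x \<bullet> b\<bar>))" by simp
    also have "\<dots> = (\<Prod>b\<in>Basis. exp (- ((a / ?n) * \<bar>x \<bullet> b\<bar>)))"
      by (simp add: exp_sum flip: sum_negf)
    finally show "norm (exp (- (a * norm x))) \<le> norm (\<Prod>b\<in>Basis. exp (- ((a / ?n) * \<bar>x \<bullet> b\<bar>)))"
      by (simp add: prod_nonneg)
  qed
qed measurable

lemma cis_measurable [measurable]: "cis \<in> borel_measurable borel"
  by (intro borel_measurable_continuous_onI continuous_intros)

text \<open>The characteristic function of the standard normal distribution, freed of its
  normalization and rescaled by \<open>\<sigma>\<close>.\<close>

lemma
  assumes \<sigma>: "0 < (\<sigma>::real)"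
  shows integrable_gaussian_cis_real: "integrable lborel (\<lambda>x. of_real (exp (- ((\<sigma> * x)\<^sup>2 / 2))) * cis (x * s))"
    and integral_gaussian_cis_real: "(LINT x|lborel. of_real (exp (- ((\<sigma> * x)\<^sup>2 / 2))) * cis (x * s)) =
      of_real (sqrt (2 * pi) / \<sigma> * exp (- ((s / \<sigma>)\<^sup>2 / 2)))"
proof -
  have i0: "integrable lborel (\<lambda>x. std_normal_density x)"
    by simp
  have i1: "integrable lborel (\<lambda>x. std_normal_density x *\<^sub>R cis (u * x))" for u
    by (rule Bochner_Integration.integrable_bound[OF i0]) auto
  have e1: "(LINT x|lborel. std_normal_density x *\<^sub>R cis (u * x)) = of_real (exp (- (u\<^sup>2 / 2)))" for u
  proof -
    have "char std_normal_distribution u = (LINT x|lborel. std_normal_density x *\<^sub>R iexp (u * x))"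
      unfolding char_def by (subst integral_density) auto
    then show ?thesis by (simp add: char_std_normal_distribution cis_conv_exp)
  qed
  have den: "std_normal_density x *\<^sub>R z = of_real (1 / sqrt (2 * pi)) * (of_real (exp (- (x\<^sup>2 / 2))) * z)" for x and z :: complex
    by (simp add: std_normal_density_def scaleR_conv_of_real mult.assoc)
  have i2: "integrable lborel (\<lambda>x. of_real (exp (- (x\<^sup>2 / 2))) * cis (u * x))" for u
  proof -
    have "of_real (sqrt (2 * pi)) * (of_real (1 / sqrt (2 * pi)) * z) = z" for z :: complex
      by (simp add: mult.assoc[symmetric] flip: of_real_mult)
    with integrable_mult_right[OF i1[of u, unfolded den], of "of_real (sqrt (2 * pi))"] show ?thesis by simp
  qed
  have e2: "(LINT x|lborel. of_real (exp (- (x\<^sup>2 / 2))) * cis (u * x)) = of_real (sqrt (2 * pi) * exp (- (u\<^sup>2 / 2)))" for u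
    using e1[of u] unfolding den integral_mult_right_zero by (simp add: field_simps flip: of_real_mult)
  have arg: "(s / \<sigma>) * (0 + \<sigma> * x) = x * s" for x using \<sigma> by simp
  show "integrable lborel (\<lambda>x. of_real (exp (- ((\<sigma> * x)\<^sup>2 / 2))) * cis (x * s))"
    using lborel_integrable_real_affine[OF i2[of "s / \<sigma>"], of \<sigma> 0] \<sigma> unfolding arg by simp
  have "of_real (sqrt (2 * pi) * exp (- ((s / \<sigma>)\<^sup>2 / 2))) = \<bar>\<sigma>\<bar> *\<^sub>R (LINT x|lborel. of_real (exp (- ((0 + \<sigma> * x)\<^sup>2 / 2))) * cis ((s / \<sigma>) * (0 + \<sigma> * x)))"
    unfolding e2[symmetric] using \<sigma> by (intro lborel_integral_real_affine) simp
  then show "(LINT x|lborel. of_real (exp (- ((\<sigma> * x)\<^sup>2 / 2))) * cis (x * s)) =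
      of_real (sqrt (2 * pi) / \<sigma> * exp (- ((s / \<sigma>)\<^sup>2 / 2)))"
    unfolding arg using \<sigma> by (simp add: scaleR_conv_of_real field_simps)
qed

text \<open>Here \<open>\<sigma>\<close> is the reciprocal of the standard deviation:
  \<open>\<sigma>\<close> tending to 0 flattens the function to 1, while its Fourier transform, a
  multiple of a Gaussian with the reciprocal parameter, concentrates.\<close>

definition gaussian :: "real \<Rightarrow> 'a::euclidean_space \<Rightarrow> real" where
  "gaussian \<sigma> x = exp (- ((\<sigma> * norm x)\<^sup>2 / 2))"

lemma gaussian_pos [simp]: "0 < gaussian \<sigma> x" and gaussian_nonneg [simp]: "0 \<le> gaussian \<sigma> x" and gaussian_le_1: "gaussian \<sigma> x \<le> 1"
  by (auto simp: gaussian_def)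

lemma gaussian_minus: "gaussian \<sigma> (x - y) = gaussian \<sigma> (y - x)"
  by (simp add: gaussian_def norm_minus_commute)

lemma gaussian_measurable [measurable]: "gaussian \<sigma> \<in> borel_measurable borel"
  unfolding gaussian_def by measurable

lemma gaussian_tendsto_1: "(\<lambda>n. gaussian (1 / real (Suc n)) x) \<longlonglongrightarrow> 1"
proof -
  have "(\<lambda>n. exp (- ((1 / real (Suc n) * norm x)\<^sup>2 / 2))) \<longlonglongrightarrow> exp (- ((0 * norm x)\<^sup>2 / 2))"
    by (intro tendsto_intros LIMSEQ_inverse_real_of_nat[unfolded inverse_eq_divide]) simp_all
  then show ?thesis by (simp add: gaussian_def)
qed

lemma norm_square_eq_sum_Basis: "(norm (x::'a::euclidean_space))\<^sup>2 = (\<Sum>b\<in>Basis. (x \<bullet> b)\<^sup>2)"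
  unfolding power2_norm_eq_inner by (subst euclidean_inner) (simp add: power2_eq_square)

lemma gaussian_prod: "gaussian \<sigma> (x::'a::euclidean_space) = (\<Prod>b\<in>Basis. exp (- ((\<sigma> * (x \<bullet> b))\<^sup>2 / 2)))"
  by (simp add: gaussian_def power_mult_distrib norm_square_eq_sum_Basis sum_distrib_left sum_divide_distrib
      flip: exp_sum sum_negf)

lemma cis_inner_prod: "cis (x \<bullet> (s::'a::euclidean_space)) = (\<Prod>b\<in>Basis. cis ((x \<bullet> b) * (s \<bullet> b)))"
  by (simp add: cis_conv_exp euclidean_inner[of x s] sum_distrib_left flip: exp_sum)

lemma
  fixes s :: "'a::euclidean_space"
  assumes \<sigma>: "0 < (\<sigma>::real)"
  shows integrable_gaussian_cis: "integrable lborel (\<lambda>x. of_real (gaussian \<sigma> x) * cis (x \<bullet> s))"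
    and integral_gaussian_cis: "(LINT x|lborel. of_real (gaussian \<sigma> x) * cis (x \<bullet> s)) =
      of_real ((sqrt (2 * pi) / \<sigma>) ^ DIM('a) * gaussian (1 / \<sigma>) s)"
proof -
  have eq: "of_real (gaussian \<sigma> x) * cis (x \<bullet> s) = (\<Prod>b\<in>Basis. of_real (exp (- ((\<sigma> * (x \<bullet> b))\<^sup>2 / 2))) * cis ((x \<bullet> b) * (s \<bullet> b)))" for x
    by (simp only: gaussian_prod of_real_prod cis_inner_prod prod.distrib)
  show "integrable lborel (\<lambda>x. of_real (gaussian \<sigma> x) * cis (x \<bullet> s))"
    unfolding eq by (intro integrable_lborel_prod_Basis integrable_gaussian_cis_real \<sigma>)
  have "(LINT x|lborel. of_real (gaussian \<sigma> x) * cis (x \<bullet> s)) =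
    (\<Prod>b\<in>Basis. of_real (sqrt (2 * pi) / \<sigma> * exp (- ((s \<bullet> b / \<sigma>)\<^sup>2 / 2))))"
    unfolding eq
    by (subst integral_lborel_prod_Basis, rule integrable_gaussian_cis_real[OF \<sigma>])
       (intro prod.cong refl integral_gaussian_cis_real[OF \<sigma>])
  also have "\<dots> = of_real ((sqrt (2 * pi) / \<sigma>) ^ DIM('a) * gaussian (1 / \<sigma>) s)"
    by (simp only: gaussian_prod of_real_prod[symmetric] prod.distrib prod_constant) simp
  finally show "(LINT x|lborel. of_real (gaussian \<sigma> x) * cis (x \<bullet> s)) =
      of_real ((sqrt (2 * pi) / \<sigma>) ^ DIM('a) * gaussian (1 / \<sigma>) s)" .
qed

lemma
  assumes \<sigma>: "0 < (\<sigma>::real)"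
  shows integrable_gaussian: "integrable lborel (gaussian \<sigma> :: 'a::euclidean_space \<Rightarrow> real)"
    and integral_gaussian: "(LINT x|lborel. gaussian \<sigma> (x::'a)) = (sqrt (2 * pi) / \<sigma>) ^ DIM('a)"
proof -
  have "integrable lborel (\<lambda>x::'a. complex_of_real (gaussian \<sigma> x))"
    using integrable_gaussian_cis[OF \<sigma>, of "0::'a"] by simp
  then show i: "integrable lborel (gaussian \<sigma> :: 'a \<Rightarrow> real)"
    by (simp add: complex_of_real_integrable_eq)
  have "complex_of_real (LINT x|lborel. gaussian \<sigma> (x::'a)) = of_real ((sqrt (2 * pi) / \<sigma>) ^ DIM('a))"
    using integral_gaussian_cis[OF \<sigma>, of "0::'a"] by (simp add: gaussian_def)
  then show "(LINT x|lborel. gaussian \<sigma> (x::'a)) = (sqrt (2 * pi) / \<sigma>) ^ DIM('a)"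
    by (simp only: of_real_eq_iff)
qed

text \<open>Sign and scale are a parameter: \<open>- (2 * pi)\<close> and \<open>2 * pi\<close> are
  the transform and its inverse, and \<open>2 * pi * s\<close> arises from dilated arguments of
  Laplace transforms.\<close>

definition fourier :: "real \<Rightarrow> ('a::euclidean_space \<Rightarrow> complex) \<Rightarrow> 'a \<Rightarrow> complex" where
  "fourier c f x = (LINT t|lborel. f t * cis (c * (x \<bullet> t)))"

lemma integrable_mult_cis:
  fixes f :: "'a::euclidean_space \<Rightarrow> complex"
  assumes "integrable lborel f" and [measurable]: "g \<in> borel_measurable borel"
  shows "integrable lborel (\<lambda>t. f t * cis (g t))"
  by (rule Bochner_Integration.integrable_bound[OF assms(1)])
     (use assms in \<open>auto simp: norm_mult\<close>)

lemma fourier_measurable [measurable]: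
  assumes [measurable]: "integrable lborel f"
  shows "fourier c f \<in> borel_measurable borel"
proof -
  have [measurable]: "f \<in> borel_measurable borel" using borel_measurable_integrable[OF assms] by simp
  have "(\<lambda>x. LINT t|lborel. f t * cis (c * (x \<bullet> t))) \<in> borel_measurable lborel"
    by (rule lborel.borel_measurable_lebesgue_integral) measurable
  then show ?thesis unfolding fourier_def by simp
qed

lemma norm_fourier_le:
  assumes "integrable lborel f"
  shows "norm (fourier c f x) \<le> (LINT t|lborel. norm (f t))"
  unfolding fourier_def
  by (rule order_trans[OF integral_norm_bound]) (simp add: norm_mult)

text \<open>The multiplication formula, by Fubini. It replaces convolution theorems in the L2 bound,
  in the inversion formula and in the reproducing property.\<close>

lemma integral_mult_fourier:
  fixes f g :: "'a::euclidean_space \<Rightarrow> complex"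
  assumes f: "integrable lborel f" and g: "integrable lborel g"
  shows "(LINT x|lborel. g x * fourier c f x) = (LINT t|lborel. f t * fourier c g t)"
proof -
  have [measurable]: "f \<in> borel_measurable borel" "g \<in> borel_measurable borel"
    using borel_measurable_integrable[OF f] borel_measurable_integrable[OF g] by auto
  have "integrable (lborel \<Otimes>\<^sub>M lborel) (\<lambda>(x, t). g x * (f t * cis (c * (x \<bullet> t))))"
  proof (rule integrable_pair_lborelI)
    show "(\<integral>\<^sup>+x. norm (case (x, t) of (x, t) \<Rightarrow> g x * (f t * cis (c * (x \<bullet> t)))) \<partial>lborel)
       \<le> (\<integral>\<^sup>+x. norm (g x) \<partial>lborel) * norm (f t)" for t
      by (subst nn_integral_multc[symmetric]) (auto simp: norm_mult ennreal_mult)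
    show "(\<integral>\<^sup>+t. (\<integral>\<^sup>+x. norm (g x) \<partial>lborel) * norm (f t) \<partial>lborel) < \<infinity>"
      using f g by (subst nn_integral_cmult) (auto simp: integrable_iff_bounded ennreal_mult_less_top)
  qed measurable
  note Fubini = lborel_pair.Fubini_integral[OF this]
  have "(LINT x|lborel. g x * fourier c f x) = (LINT x|lborel. LINT t|lborel. g x * (f t * cis (c * (x \<bullet> t))))"
    by (simp only: fourier_def integral_mult_right_zero)
  also have "\<dots> = (LINT t|lborel. LINT x|lborel. f t * (g x * cis (c * (t \<bullet> x))))"
    unfolding Fubini[symmetric] by (intro Bochner_Integration.integral_cong refl) (simp add: inner_commute mult.left_commute)
  also have "\<dots> = (LINT t|lborel. f t * fourier c g t)"
    by (simp only: fourier_def integral_mult_right_zero)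
  finally show ?thesis .
qed

text \<open>Modulation by \<open>u\<close> becomes translation: the transform is centred at
  \<open>- u\<close> and narrows as \<open>\<sigma>\<close> tends to 0.\<close>

lemma fourier_gaussian_cis:
  assumes \<sigma>: "0 < \<sigma>"
  shows "fourier c (\<lambda>x. of_real (gaussian \<sigma> x) * cis (c * (x \<bullet> u))) (t::'a::euclidean_space) =
    of_real ((sqrt (2 * pi) / \<sigma>) ^ DIM('a) * gaussian (\<bar>c\<bar> / \<sigma>) (u + t))"
proof -
  have "fourier c (\<lambda>x. of_real (gaussian \<sigma> x) * cis (c * (x \<bullet> u))) t = (LINT x|lborel. of_real (gaussian \<sigma> x) * cis (x \<bullet> (c *\<^sub>R (u + t))))"
    unfolding fourier_def by (intro Bochner_Integration.integral_cong refl) (simp add: mult.assoc cis_mult inner_add_right inner_commute algebra_simps)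
  then show ?thesis unfolding integral_gaussian_cis[OF \<sigma>] by (simp add: gaussian_def)
qed

text \<open>Integrability is not assumed: the Bochner integral of a nonintegrable function is
  0.\<close>

lemma norm_integral_le_nn_integral:
  fixes f :: "'a \<Rightarrow> 'b::{banach, second_countable_topology}"
  shows "ennreal (norm (integral\<^sup>L M f)) \<le> (\<integral>\<^sup>+x. norm (f x) \<partial>M)"
  by (cases "integrable M f") (auto simp: not_integrable_integral_eq intro: integral_norm_bound_ennreal)

lemma ennreal_add_mult:
  "0 \<le> a \<Longrightarrow> 0 \<le> b \<Longrightarrow> 0 \<le> k \<Longrightarrow> ennreal (a * k + b * k) = ennreal a * ennreal k + ennreal b * ennreal k"
  by (simp add: ennreal_mult)

text \<open>The upper half of Plancherel's theorem. A Gaussian weight turns the energy of the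
  transform into a double integral of \<open>f t * cnj (f s)\<close> against a positive even kernel
  in \<open>t - s\<close>, whose total mass is the constant of the bound.\<close>

lemma fourier_L2_bound:
  fixes f :: "'a::euclidean_space \<Rightarrow> complex"
  assumes f: "integrable lborel f" and f2: "square_integrable f" and c: "c \<noteq> 0"
  shows "nn_energy (fourier c f) \<le> ennreal ((2 * pi / \<bar>c\<bar>) ^ DIM('a) * energy f)"
proof -
  let ?B = "(2 * pi / \<bar>c\<bar>) ^ DIM('a) * energy f"
  let ?E = "\<lambda>t. ennreal ((norm (f t))\<^sup>2 / 2)" and ?P = "ennreal ((2 * pi / \<bar>c\<bar>) ^ DIM('a))"
  have mf [measurable]: "f \<in> borel_measurable borel" using borel_measurable_integrable[OF f] by simp
  have [measurable]: "fourier c f \<in> borel_measurable borel" by (rule fourier_measurable[OF f])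
  \<comment> \<open>The weight makes the energy integrable, and the bound is uniform in
    \<open>\<sigma>\<close>.\<close>
  have reg: "(\<integral>\<^sup>+x. ennreal (gaussian \<sigma> x * (norm (fourier c f x))\<^sup>2) \<partial>lborel) \<le> ennreal ?B" if \<sigma>: "0 < \<sigma>" for \<sigma>
  proof -
    let ?k = "\<lambda>u::'a. (sqrt (2 * pi) / \<sigma>) ^ DIM('a) * gaussian (\<bar>c\<bar> / \<sigma>) u"
    have k0: "0 \<le> ?k u" for u using \<sigma> by simp
    \<comment> \<open>The factor \<open>sqrt (2 * pi) / \<sigma>\<close> in the kernel cancels the
      \<open>\<sigma>\<close> in the integral of the Gaussian, so the mass does not depend on
      \<open>\<sigma>\<close>.\<close>
    have kint: "(\<integral>\<^sup>+u. ennreal (?k u) \<partial>lborel) = ?P"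
    proof -
      have "(\<integral>\<^sup>+u. ennreal (?k u) \<partial>lborel) = ennreal (LINT u|lborel. ?k u)"
        by (intro nn_integral_eq_integral) (use \<sigma> c in \<open>auto intro!: integrable_mult_right integrable_gaussian\<close>)
      also have "(LINT u|lborel. ?k u) = (2 * pi / \<bar>c\<bar>) ^ DIM('a)"
        using \<sigma> c by (subst integral_mult_right_zero, subst integral_gaussian) (auto simp: power_mult_distrib[symmetric])
      finally show ?thesis .
    qed
    have gi: "integrable lborel (\<lambda>x. of_real (gaussian \<sigma> x) * cnj (fourier c f x))"
    proof (rule Bochner_Integration.integrable_bound)
      show "integrable lborel (\<lambda>x::'a. gaussian \<sigma> x * (LINT t|lborel. norm (f t)))"
        by (intro integrable_mult_left integrable_gaussian \<sigma>)
      show "AE x in lborel. norm (of_real (gaussian \<sigma> x) * cnj (fourier c f x)) \<le> norm (gaussian \<sigma> x * (LINT t|lborel. norm (f t)))"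
        by (auto simp: norm_mult abs_mult intro!: mult_left_mono order_trans[OF norm_fourier_le[OF f]])
    qed measurable
    \<comment> \<open>Conjugation reverses the sign of \<open>c\<close>, so the multiplication
      formula exhibits this transform as the convolution of the conjugate of \<open>f\<close> with
      the kernel \<open>?k\<close>.\<close>
    have fg: "fourier c (\<lambda>x. of_real (gaussian \<sigma> x) * cnj (fourier c f x)) t = (LINT s|lborel. cnj (f s) * of_real (?k (t - s)))" for t
    proof -
      have cf: "cnj (fourier c f x) = fourier (- c) (\<lambda>s. cnj (f s)) x" for x
        unfolding fourier_def by (subst Bochner_Integration.integral_cnj[symmetric]) (simp add: cis_cnj)
      have "fourier c (\<lambda>x. of_real (gaussian \<sigma> x) * cnj (fourier c f x)) t =
         (LINT x|lborel. (of_real (gaussian \<sigma> x) * cis (c * (t \<bullet> x))) * fourier (- c) (\<lambda>s. cnj (f s)) x)"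
        unfolding fourier_def[of c _ t] cf by (simp add: mult_ac)
      also have "\<dots> = (LINT s|lborel. cnj (f s) * fourier (-c) (\<lambda>x. of_real (gaussian \<sigma> x) * cis (c * (t \<bullet> x))) s)"
        using integrable_gaussian[OF \<sigma>, where 'a='a] f
        by (intro integral_mult_fourier integrable_mult_cis) (auto simp: complex_of_real_integrable_eq)
      also have "\<dots> = (LINT s|lborel. cnj (f s) * of_real (?k (t - s)))"
        using fourier_gaussian_cis[OF \<sigma>, of "-c" "-t"] by (simp add: inner_commute gaussian_minus)
      finally show ?thesis .
    qed
    have half: "(\<integral>\<^sup>+t. \<integral>\<^sup>+s. ?E t * ennreal (?k (t - s)) \<partial>lborel \<partial>lborel) = ennreal (?B / 2)"
    proof -
      have "(\<integral>\<^sup>+s. ?E t * ennreal (?k (t - s)) \<partial>lborel) = ?E t * ?P" for t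
      proof -
        have "(\<integral>\<^sup>+s. ennreal (?k (t - s)) \<partial>lborel) = (\<integral>\<^sup>+s. ennreal (?k (s + (- t))) \<partial>lborel)"
          by (simp add: gaussian_minus)
        also have "\<dots> = ?P"
          unfolding kint[symmetric] by (rule nn_integral_lborel_shift) measurable
        finally show ?thesis by (subst nn_integral_cmult) auto
      qed
      then have "(\<integral>\<^sup>+t. \<integral>\<^sup>+s. ?E t * ennreal (?k (t - s)) \<partial>lborel \<partial>lborel) =
        (\<integral>\<^sup>+t. ?E t * ?P \<partial>lborel)" by simp
      also have "\<dots> = (\<integral>\<^sup>+t. ?E t \<partial>lborel) * ?P"
        by (rule nn_integral_multc) measurable
      also have "(\<integral>\<^sup>+t. ?E t \<partial>lborel) = ennreal (energy f / 2)"
        using f2 by (subst nn_integral_eq_integral) (auto simp: square_integrable_def)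
      also have "ennreal (energy f / 2) * ?P = ennreal (?B / 2)"
        by (subst ennreal_mult[symmetric]) (auto simp: integral_nonneg_AE mult.commute)
      finally show ?thesis .
    qed
    have "complex_of_real (LINT x|lborel. gaussian \<sigma> x * (norm (fourier c f x))\<^sup>2) =
       (LINT x|lborel. (of_real (gaussian \<sigma> x) * cnj (fourier c f x)) * fourier c f x)"
      unfolding integral_complex_of_real[symmetric]
      by (intro Bochner_Integration.integral_cong refl) (simp add: complex_norm_square mult_ac del: of_real_power)
    also have "\<dots> = (LINT t|lborel. f t * (LINT s|lborel. cnj (f s) * of_real (?k (t - s))))"
      using integral_mult_fourier[OF f gi, of c] unfolding fg .
    finally have eq: "complex_of_real (LINT x|lborel. gaussian \<sigma> x * (norm (fourier c f x))\<^sup>2) = \<dots>" .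
    have bi: "integrable lborel (\<lambda>x. gaussian \<sigma> x * (norm (fourier c f x))\<^sup>2)"
    proof (rule Bochner_Integration.integrable_bound)
      show "integrable lborel (\<lambda>x::'a. gaussian \<sigma> x * (LINT t|lborel. norm (f t))\<^sup>2)"
        by (intro integrable_mult_left integrable_gaussian \<sigma>)
      show "AE x in lborel. norm (gaussian \<sigma> x * (norm (fourier c f x))\<^sup>2) \<le> norm (gaussian \<sigma> x * (LINT t|lborel. norm (f t))\<^sup>2)"
        by (auto simp: abs_mult intro!: mult_left_mono power_mono norm_fourier_le f)
    qed measurable
    have "(\<integral>\<^sup>+x. ennreal (gaussian \<sigma> x * (norm (fourier c f x))\<^sup>2) \<partial>lborel) = ennreal (LINT x|lborel. gaussian \<sigma> x * (norm (fourier c f x))\<^sup>2)"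
      by (intro nn_integral_eq_integral bi) auto
    also have "\<dots> = ennreal (norm (LINT t|lborel. f t * (LINT s|lborel. cnj (f s) * of_real (?k (t - s)))))"
      unfolding eq[symmetric] by (simp add: integral_nonneg_AE)
    also have "\<dots> \<le> (\<integral>\<^sup>+t. \<integral>\<^sup>+s. ennreal (norm (f t) * norm (f s) * ?k (t - s)) \<partial>lborel \<partial>lborel)"
    proof -
      have "ennreal (norm (LINT t|lborel. f t * (LINT s|lborel. cnj (f s) * of_real (?k (t - s)))))
         \<le> (\<integral>\<^sup>+t. norm (f t * (LINT s|lborel. cnj (f s) * of_real (?k (t - s)))) \<partial>lborel)"
        by (rule norm_integral_le_nn_integral)
      also have "\<dots> \<le> (\<integral>\<^sup>+t. \<integral>\<^sup>+s. ennreal (norm (f t) * norm (f s) * ?k (t - s)) \<partial>lborel \<partial>lborel)"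
      proof (rule nn_integral_mono)
        fix t
        have "ennreal (norm (f t * (LINT s|lborel. cnj (f s) * of_real (?k (t - s))))) \<le> ennreal (norm (f t)) * (\<integral>\<^sup>+s. norm (cnj (f s) * of_real (?k (t - s))) \<partial>lborel)"
          unfolding norm_mult[of "f t"] by (subst ennreal_mult) (auto intro!: mult_left_mono norm_integral_le_nn_integral)
        also have "\<dots> = (\<integral>\<^sup>+s. ennreal (norm (f t)) * norm (cnj (f s) * of_real (?k (t - s))) \<partial>lborel)"
          by (rule nn_integral_cmult[symmetric]) measurable
        also have "\<dots> = (\<integral>\<^sup>+s. ennreal (norm (f t) * norm (f s) * ?k (t - s)) \<partial>lborel)"
        proof (intro nn_integral_cong)
          fix s
          have "norm (cnj (f s) * of_real (?k (t - s))) = norm (f s) * ?k (t - s)"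
            by (simp only: norm_mult complex_mod_cnj norm_of_real abs_of_nonneg[OF k0])
          then show "ennreal (norm (f t)) * norm (cnj (f s) * of_real (?k (t - s))) = ennreal (norm (f t) * norm (f s) * ?k (t - s))"
            using k0 by (simp only: ennreal_mult mult.assoc norm_ge_zero mult_nonneg_nonneg)
        qed
        finally show "ennreal (norm (f t * (LINT s|lborel. cnj (f s) * of_real (?k (t - s))))) \<le> (\<integral>\<^sup>+s. ennreal (norm (f t) * norm (f s) * ?k (t - s)) \<partial>lborel)" .
      qed
      finally show ?thesis .
    qed
    \<comment> \<open>Schur's test in its simplest form: by \<open>ab \<le> (a^2 + b^2)/2\<close>
      and the symmetry of the kernel, each variable accounts for half of the bound.\<close>
    also have "\<dots> \<le> (\<integral>\<^sup>+t. \<integral>\<^sup>+s. ?E t * ennreal (?k (t - s)) + ?E s * ennreal (?k (t - s)) \<partial>lborel \<partial>lborel)"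
    proof (intro nn_integral_mono)
      fix t s
      have "norm (f t) * norm (f s) * ?k (t - s) \<le> ((norm (f t))\<^sup>2 / 2) * ?k (t - s) + ((norm (f s))\<^sup>2 / 2) * ?k (t - s)"
        using mult_right_mono[OF norm_mult_le_squares[of "f t" "f s"] k0[of "t - s"]] by (simp add: algebra_simps add_divide_distrib)
      from ennreal_leI[OF this] k0 show "ennreal (norm (f t) * norm (f s) * ?k (t - s)) \<le> ?E t * ennreal (?k (t - s)) + ?E s * ennreal (?k (t - s))"
        by (simp only: ennreal_add_mult zero_le_divide_iff zero_le_power2 zero_le_numeral simp_thms)
    qed
    also have "\<dots> = (\<integral>\<^sup>+t. \<integral>\<^sup>+s. ?E t * ennreal (?k (t - s)) \<partial>lborel \<partial>lborel)
        + (\<integral>\<^sup>+t. \<integral>\<^sup>+s. ?E s * ennreal (?k (t - s)) \<partial>lborel \<partial>lborel)"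
    proof -
      have "(\<integral>\<^sup>+s. ?E t * ennreal (?k (t - s)) + ?E s * ennreal (?k (t - s)) \<partial>lborel)
        = (\<integral>\<^sup>+s. ?E t * ennreal (?k (t - s)) \<partial>lborel) + (\<integral>\<^sup>+s. ?E s * ennreal (?k (t - s)) \<partial>lborel)" for t
        by (rule nn_integral_add) measurable
      then show ?thesis
        by (simp only:) (rule nn_integral_add, measurable)
    qed
    also have "\<dots> = ennreal (?B / 2) + ennreal (?B / 2)"
    proof (intro arg_cong2[where f="(+)"] half)
      have "(\<integral>\<^sup>+t. \<integral>\<^sup>+s. ?E s * ennreal (?k (t - s)) \<partial>lborel \<partial>lborel) = (\<integral>\<^sup>+s. \<integral>\<^sup>+t. ?E s * ennreal (?k (t - s)) \<partial>lborel \<partial>lborel)"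
        by (rule lborel_pair.Fubini') measurable
      also have "\<dots> = (\<integral>\<^sup>+s. \<integral>\<^sup>+t. ?E s * ennreal (?k (s - t)) \<partial>lborel \<partial>lborel)"
      proof (intro nn_integral_cong)
        fix s t
        show "?E s * ennreal (?k (t - s)) = ?E s * ennreal (?k (s - t))"
          by (simp only: gaussian_minus[of _ t s])
      qed
      finally show "(\<integral>\<^sup>+t. \<integral>\<^sup>+s. ?E s * ennreal (?k (t - s)) \<partial>lborel \<partial>lborel) = ennreal (?B / 2)"
        unfolding half .
    qed
    also have "ennreal (?B / 2) + ennreal (?B / 2) = ennreal ?B"
      by (subst ennreal_plus[symmetric]) (auto simp: integral_nonneg_AE)
    finally show ?thesis .
  qed
  \<comment> \<open>With \<open>\<sigma>\<close> of the form 1/(n+1) the weights tend to 1, and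
    Fatou's lemma removes them.\<close>
  define G where "G n = (gaussian (1 / real (Suc n)) :: 'a \<Rightarrow> real)" for n
  have G: "(\<lambda>n. G n x) \<longlonglongrightarrow> 1" for x
    unfolding G_def by (rule gaussian_tendsto_1)
  have "nn_energy (fourier c f) = (\<integral>\<^sup>+x. liminf (\<lambda>n. ennreal (G n x * (norm (fourier c f x))\<^sup>2)) \<partial>lborel)"
  proof (intro nn_integral_cong)
    fix x
    have "(\<lambda>n. ennreal (G n x * (norm (fourier c f x))\<^sup>2)) \<longlonglongrightarrow> ennreal (1 * (norm (fourier c f x))\<^sup>2)"
      by (intro tendsto_intros G)
    then show "ennreal ((norm (fourier c f x))\<^sup>2) = liminf (\<lambda>n. ennreal (G n x * (norm (fourier c f x))\<^sup>2))"
      by (intro lim_imp_Liminf[symmetric]) auto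
  qed
  also have "\<dots> \<le> liminf (\<lambda>n. \<integral>\<^sup>+x. ennreal (G n x * (norm (fourier c f x))\<^sup>2) \<partial>lborel)"
    unfolding G_def by (intro nn_integral_liminf) measurable
  also have "\<dots> \<le> ennreal ?B"
  proof (rule Liminf_le)
    show "\<forall>\<^sub>F n in sequentially. (\<integral>\<^sup>+x. ennreal (G n x * (norm (fourier c f x))\<^sup>2) \<partial>lborel) \<le> ennreal ?B"
      unfolding G_def by (intro always_eventually allI reg) simp
  qed simp
  finally show ?thesis .
qed


section \<open>Fourier inversion by Gaussian summation\<close>

lemma power_times_exp_neg_square_tendsto_0:
  assumes "0 < (a::real)" "0 < d"
  shows "(\<lambda>n. (a * real (Suc n)) ^ k * exp (- (d * (real (Suc n))\<^sup>2))) \<longlonglongrightarrow> 0"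
proof (rule Lim_null_comparison)
  show "\<forall>\<^sub>F n in sequentially. norm ((a * real (Suc n)) ^ k * exp (- (d * (real (Suc n))\<^sup>2))) \<le> (a / d) ^ k * ((d * real (Suc n)) ^ k / exp (d * real (Suc n)))"
  proof (rule always_eventually, rule allI)
    fix n
    have "real (Suc n) \<le> (real (Suc n))\<^sup>2" by (simp add: power2_eq_square)
    then have "exp (- (d * (real (Suc n))\<^sup>2)) \<le> exp (- (d * real (Suc n)))" using assms by simp
    then have "(a * real (Suc n)) ^ k * exp (- (d * (real (Suc n))\<^sup>2)) \<le> (a * real (Suc n)) ^ k * exp (- (d * real (Suc n)))"
      using assms by (intro mult_left_mono) auto
    also have "(a * real (Suc n)) ^ k * exp (- (d * real (Suc n))) = (a / d) ^ k * ((d * real (Suc n)) ^ k / exp (d * real (Suc n)))"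
    proof -
      have "(a * real (Suc n)) ^ k = (a / d) ^ k * (d * real (Suc n)) ^ k"
        using assms by (simp flip: power_mult_distrib)
      then show ?thesis by (simp only: exp_minus divide_inverse mult.assoc)
    qed
    finally show "norm ((a * real (Suc n)) ^ k * exp (- (d * (real (Suc n))\<^sup>2))) \<le> (a / d) ^ k * ((d * real (Suc n)) ^ k / exp (d * real (Suc n)))"
      using assms by (simp add: abs_mult)
  qed
  have "filterlim (\<lambda>n. d * real (Suc n)) at_top sequentially"
    by (rule filterlim_tendsto_pos_mult_at_top[OF tendsto_const assms(2) filterlim_compose[OF filterlim_real_sequentially filterlim_Suc]])
  from tendsto_mult[OF tendsto_const filterlim_compose[OF tendsto_power_div_exp_0 this], of "(a / d)^k"]
  show "(\<lambda>n. (a / d) ^ k * ((d * real (Suc n)) ^ k / exp (d * real (Suc n)))) \<longlonglongrightarrow> 0"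
    by simp
qed

text \<open>The kernels \<open>k n\<close> have mass \<open>(2 * pi / c) ^ DIM('a)\<close> and
  concentrate at 0. As \<open>g\<close> is integrable but may be unbounded, away from
  \<open>x0\<close> it is paired with the supremum of the kernel there, which tends to 0, and not
  with its mass.\<close>

lemma gaussian_approximate_identity:
  fixes g :: "'a::euclidean_space \<Rightarrow> complex"
  assumes g: "integrable lborel g" and cont: "isCont g x0" and c: "0 < c"
  defines "k \<equiv> \<lambda>n (u::'a). (sqrt (2 * pi) * real (Suc n)) ^ DIM('a) * gaussian (c * real (Suc n)) u"
  shows "(\<lambda>n. LINT x|lborel. g x * of_real (k n (x - x0))) \<longlonglongrightarrow> of_real ((2 * pi / c) ^ DIM('a)) * g x0"
proof -
  let ?K = "(2 * pi / c) ^ DIM('a)"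
  have [measurable]: "g \<in> borel_measurable borel" using borel_measurable_integrable[OF g] by simp
  have K: "?K > 0" using c by simp
  have k0: "0 \<le> k n u" for n u by (simp add: k_def)
  have km [measurable]: "k n \<in> borel_measurable borel" for n unfolding k_def by measurable
  have shift_i: "integrable lborel (\<lambda>x::'a. h (x - x0))" if "integrable lborel h" for h :: "'a \<Rightarrow> real"
  proof -
    have [measurable]: "h \<in> borel_measurable borel" using borel_measurable_integrable[OF that] by simp
    have "(\<integral>\<^sup>+x. norm (h (x + (- x0))) \<partial>lborel) = (\<integral>\<^sup>+x. norm (h x) \<partial>lborel)"
      by (rule nn_integral_lborel_shift) measurable
    then show ?thesis using that by (simp add: integrable_iff_bounded)
  qed
  have ki: "integrable lborel (\<lambda>x. k n (x - x0))" for n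
    unfolding k_def using c by (intro shift_i[of "\<lambda>u. _ * gaussian _ u"] integrable_mult_right integrable_gaussian) simp
  have kK: "(LINT x|lborel. k n (x - x0)) = ?K" for n
  proof -
    have "(LINT x|lborel. k n (x - x0)) = (LINT x|lborel. k n x)"
      using integral_lborel_shift[OF km[of n], of "- x0"] by simp
    also have "\<dots> = ?K"
    proof -
      have pos: "0 < c * real (Suc n)" using c by simp
      have "sqrt (2 * pi) * real (Suc n) * (sqrt (2 * pi) / (c * real (Suc n))) = 2 * pi / c"
        using c by simp
      then show ?thesis
        unfolding k_def integral_mult_right_zero integral_gaussian[OF pos] power_mult_distrib[symmetric] by simp
    qed
    finally show ?thesis .
  qed
  have kle: "k n u \<le> (sqrt (2 * pi) * real (Suc n)) ^ DIM('a)" for n u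
    unfolding k_def using gaussian_le_1[of _ u] by (intro mult_left_le) auto
  have gki: "integrable lborel (\<lambda>x. g x * of_real (k n (x - x0)))" for n
  proof (rule Bochner_Integration.integrable_bound)
    show "integrable lborel (\<lambda>x. (sqrt (2 * pi) * real (Suc n)) ^ DIM('a) * norm (g x))"
      by (intro integrable_mult_right integrable_norm g)
    show "AE x in lborel. norm (g x * of_real (k n (x - x0))) \<le> norm ((sqrt (2 * pi) * real (Suc n)) ^ DIM('a) * norm (g x))" (is "AE x in _. ?P x")
    proof (rule AE_I2)
      fix x
      have "norm (g x * of_real (k n (x - x0))) = k n (x - x0) * norm (g x)"
        using k0 by (simp add: norm_mult)
      also have "\<dots> \<le> (sqrt (2 * pi) * real (Suc n)) ^ DIM('a) * norm (g x)"
        by (intro mult_right_mono kle) auto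
      finally show "?P x"
        by simp
    qed
  qed measurable
  define D where "D n = (LINT x|lborel. g x * of_real (k n (x - x0))) - of_real ?K * g x0" for n
  have D: "D n = (LINT x|lborel. (g x - g x0) * of_real (k n (x - x0)))" for n
  proof -
    have "of_real ?K * g x0 = (LINT x|lborel. g x0 * of_real (k n (x - x0)))"
      unfolding integral_mult_right_zero integral_complex_of_real kK by (simp add: mult.commute)
    moreover have "(LINT x|lborel. g x * of_real (k n (x - x0)) - g x0 * of_real (k n (x - x0))) =
        (LINT x|lborel. g x * of_real (k n (x - x0))) - (LINT x|lborel. g x0 * of_real (k n (x - x0)))"
      using ki[of n] by (intro Bochner_Integration.integral_diff gki integrable_mult_right) (simp add: complex_of_real_integrable_eq)
    ultimately show ?thesis
      by (simp only: D_def left_diff_distrib)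
  qed
  have "D \<longlonglongrightarrow> 0"
  proof (rule LIMSEQ_I)
    fix r :: real assume r: "r > 0"
    define e where "e = r / (2 * ?K)"
    have e: "e > 0" using r K by (simp add: e_def)
    obtain \<delta> where \<delta>: "\<delta> > 0" "\<And>x. dist x x0 < \<delta> \<Longrightarrow> dist (g x) (g x0) < e"
      using cont e unfolding continuous_at_eps_delta dist_norm by metis
    \<comment> \<open>Half of the Gaussian exponent gives the factor \<open>A n\<close> outside the
      ball of radius \<open>\<delta>\<close>. The other half, because \<open>Suc n\<close> is at
      least 1, leaves \<open>gaussian (c / sqrt 2)\<close>.\<close>
    define A where "A n = (sqrt (2 * pi) * real (Suc n)) ^ DIM('a) * exp (- ((c * \<delta>)\<^sup>2 / 4 * (real (Suc n))\<^sup>2))" for n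
    \<comment> \<open>The remaining Gaussian makes the constant \<open>g x0\<close> integrable;
      \<open>g\<close> itself needs only the factor \<open>A n\<close>.\<close>
    define R where "R x = norm (g x) + norm (g x0) * gaussian (c / sqrt 2) (x - x0)" for x
    have R0: "0 \<le> R x" for x by (simp add: R_def)
    have Ri: "integrable lborel R"
      unfolding R_def using c
      by (intro Bochner_Integration.integrable_add integrable_norm g integrable_mult_right shift_i[of "gaussian _"] integrable_gaussian) simp
    have A0: "0 \<le> A n" for n by (simp add: A_def)
    have bound: "norm ((g x - g x0) * of_real (k n (x - x0))) \<le> e * k n (x - x0) + A n * R x" for n x
    proof (cases "dist x x0 < \<delta>")
      case True
      then have "norm (g x - g x0) * k n (x - x0) \<le> e * k n (x - x0)"
        using \<delta>(2)[of x] k0 by (intro mult_right_mono) (auto simp: dist_norm)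
      then show ?thesis using A0[of n] R0[of x] k0 by (simp add: norm_mult add_increasing2)
    next
      case False
      then have far: "\<delta> \<le> norm (x - x0)" by (simp add: dist_norm)
      let ?N = "real (Suc n)" and ?u = "norm (x - x0)"
      have "\<delta>\<^sup>2 \<le> ?u\<^sup>2" using far \<delta>(1) by (intro power_mono) auto
      then have "c\<^sup>2 * ?N\<^sup>2 * \<delta>\<^sup>2 \<le> c\<^sup>2 * ?N\<^sup>2 * ?u\<^sup>2" by (intro mult_left_mono) auto
      moreover have "c\<^sup>2 * ?u\<^sup>2 * 1 \<le> c\<^sup>2 * ?u\<^sup>2 * ?N\<^sup>2" by (intro mult_left_mono) auto
      moreover have "(c * \<delta>)\<^sup>2 / 4 * N\<^sup>2 + (c / sqrt 2 * u)\<^sup>2 / 2 \<le> (c * N * u)\<^sup>2 / 2"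
        if "c\<^sup>2 * N\<^sup>2 * \<delta>\<^sup>2 \<le> c\<^sup>2 * N\<^sup>2 * u\<^sup>2" "c\<^sup>2 * u\<^sup>2 * 1 \<le> c\<^sup>2 * u\<^sup>2 * N\<^sup>2" for N u :: real
        using that by (simp add: power_mult_distrib power_divide algebra_simps)
      ultimately have ex: "(c * \<delta>)\<^sup>2 / 4 * ?N\<^sup>2 + (c / sqrt 2 * ?u)\<^sup>2 / 2 \<le> (c * ?N * ?u)\<^sup>2 / 2"
        by blast
      have kA: "k n (x - x0) \<le> A n * gaussian (c / sqrt 2) (x - x0)"
        unfolding k_def A_def gaussian_def mult.assoc exp_add[symmetric]
        using ex by (intro mult_left_mono) (auto simp: algebra_simps)
      then have kA1: "k n (x - x0) \<le> A n"
        by (rule order_trans) (rule mult_left_le[OF gaussian_le_1 A0])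
      have "norm ((g x - g x0) * of_real (k n (x - x0))) \<le> (norm (g x) + norm (g x0)) * k n (x - x0)"
        using k0 norm_triangle_ineq4[of "g x" "g x0"] by (auto simp: norm_mult intro!: mult_right_mono)
      also have "\<dots> \<le> norm (g x) * A n + norm (g x0) * (A n * gaussian (c / sqrt 2) (x - x0))"
        unfolding distrib_right by (intro add_mono mult_left_mono kA kA1) auto
      also have "\<dots> = A n * R x" by (simp add: R_def algebra_simps)
      also have "\<dots> \<le> e * k n (x - x0) + A n * R x" using e k0 by simp
      finally show ?thesis .
    qed
    have Dn: "norm (D n) \<le> r / 2 + A n * (LINT x|lborel. R x)" for n
    proof -
      have "norm (D n) \<le> (LINT x|lborel. norm ((g x - g x0) * of_real (k n (x - x0))))"
        unfolding D by (rule integral_norm_bound)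
      also have "\<dots> \<le> (LINT x|lborel. e * k n (x - x0) + A n * R x)"
      proof (rule integral_mono_AE)
        show i: "integrable lborel (\<lambda>x. e * k n (x - x0) + A n * R x)"
          by (intro Bochner_Integration.integrable_add integrable_mult_right ki Ri)
        show "integrable lborel (\<lambda>x. norm ((g x - g x0) * of_real (k n (x - x0))))"
          by (rule Bochner_Integration.integrable_bound[OF i]) (auto intro!: AE_I2 order_trans[OF bound])
        show "AE x in lborel. norm ((g x - g x0) * of_real (k n (x - x0))) \<le> e * k n (x - x0) + A n * R x"
          by (intro AE_I2 bound)
      qed
      also have "\<dots> = e * ?K + A n * (LINT x|lborel. R x)"
        by (subst Bochner_Integration.integral_add) (auto intro!: integrable_mult_right ki Ri simp: kK)
      also have "e * ?K = r / 2"
      proof -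
        have "r / (2 * k) * k = r / 2" if "k > 0" for k :: real using that by simp
        from this[OF K] show ?thesis by (simp only: e_def)
      qed
      finally show ?thesis .
    qed
    have "A \<longlonglongrightarrow> 0"
      unfolding A_def using c \<delta>(1) by (intro power_times_exp_neg_square_tendsto_0) auto
    from tendsto_mult_left_zero[OF this, of "LINT x|lborel. R x"]
    have "\<forall>\<^sub>F n in sequentially. A n * (LINT x|lborel. R x) < r / 2"
      using r by (intro order_tendstoD(2)[where y=0]) auto
    then obtain N where N: "\<And>n. n \<ge> N \<Longrightarrow> A n * (LINT x|lborel. R x) < r / 2"
      by (auto simp: eventually_sequentially)
    show "\<exists>no. \<forall>n\<ge>no. norm (D n - 0) < r"
    proof (intro exI allI impI)
      fix n assume "N \<le> n"
      from Dn[of n] N[OF this] show "norm (D n - 0) < r" unfolding diff_zero by linarith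
    qed
  qed
  then show ?thesis
    unfolding D_def by (simp add: LIM_zero_iff)
qed

text \<open>One Gaussian-weighted integral has two limits: dominated convergence gives the double
  transform, and the multiplication formula turns the integral into \<open>g\<close> against an
  approximate identity at \<open>x0\<close>.\<close>

lemma fourier_inversion:
  fixes g :: "'a::euclidean_space \<Rightarrow> complex"
  assumes g: "integrable lborel g" and cont: "isCont g x0" and c: "0 < c"
    and gh: "integrable lborel (fourier (- c) g)"
  shows "fourier c (fourier (- c) g) x0 = of_real ((2 * pi / c) ^ DIM('a)) * g x0"
proof (rule LIMSEQ_unique)
  let ?G = "\<lambda>n t. complex_of_real (gaussian (1 / real (Suc n)) (t::'a))"
  have [measurable]: "fourier (- c) g \<in> borel_measurable borel" by (rule fourier_measurable[OF g])
  have Gi: "integrable lborel (\<lambda>x. ?G n x * cis (c * (x \<bullet> x0)))" for n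
    by (intro integrable_mult_cis) (auto simp: complex_of_real_integrable_eq intro: integrable_gaussian)
  show "(\<lambda>n. LINT t|lborel. ?G n t * cis (c * (t \<bullet> x0)) * fourier (- c) g t) \<longlonglongrightarrow> fourier c (fourier (- c) g) x0"
    unfolding fourier_def[of c]
  proof (rule integral_dominated_convergence[where w="\<lambda>t. norm (fourier (- c) g t)"])
    show "integrable lborel (\<lambda>t. norm (fourier (- c) g t))" by (intro integrable_norm gh)
    show "AE t in lborel. (\<lambda>n. ?G n t * cis (c * (t \<bullet> x0)) * fourier (- c) g t) \<longlonglongrightarrow> fourier (- c) g t * cis (c * (x0 \<bullet> t))" (is "AE t in _. ?P t")
    proof (rule AE_I2)
      fix t
      have "(\<lambda>n. ?G n t * cis (c * (t \<bullet> x0)) * fourier (- c) g t) \<longlonglongrightarrow> of_real 1 * cis (c * (t \<bullet> x0)) * fourier (- c) g t"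
        by (intro tendsto_intros gaussian_tendsto_1)
      then show "?P t"
        by (simp add: inner_commute mult.commute)
    qed
    show "AE t in lborel. norm (?G n t * cis (c * (t \<bullet> x0)) * fourier (- c) g t) \<le> norm (fourier (- c) g t)" for n
      by (intro AE_I2) (simp add: norm_mult mult_left_le_one_le gaussian_le_1)
  qed measurable
  have "(LINT t|lborel. ?G n t * cis (c * (t \<bullet> x0)) * fourier (- c) g t) =
    (LINT x|lborel. g x * of_real ((sqrt (2 * pi) * real (Suc n)) ^ DIM('a) * gaussian (c * real (Suc n)) (x - x0)))" for n
    using integral_mult_fourier[OF g Gi[of n], of "- c"] fourier_gaussian_cis[of "1 / real (Suc n)" "- c" "- x0"] c by simp
  then show "(\<lambda>n. LINT t|lborel. ?G n t * cis (c * (t \<bullet> x0)) * fourier (- c) g t) \<longlonglongrightarrow> of_real ((2 * pi / c) ^ DIM('a)) * g x0"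
    using gaussian_approximate_identity[OF g cont c] by simp
qed

subsection \<open>Laplace transforms over the dual cone\<close>

definition planewave :: "complex^'n \<Rightarrow> real^'n \<Rightarrow> complex" where
  "planewave u t = exp (2 * of_real pi * \<i> * cdot u t)"

text \<open>The weight \<open>p\<close> accommodates the multiple kernels: differentiation under the
  integral multiplies it by a linear factor. The constant weight 1 gives the Cauchy-Szego kernel and
  the damping factors.\<close>

definition laplace :: "(real^'n) set \<Rightarrow> (real^'n \<Rightarrow> complex) \<Rightarrow> complex^'n \<Rightarrow> complex" where
  "laplace \<Gamma> p u = (LINT t|lborel. indicator (dual_cone \<Gamma>) t *\<^sub>R (p t * planewave u t))"

text \<open>A class that is closed under products and contains the linear functions, hence all
  weights arising from derivatives, and that the exponential decay of plane waves on the dual cone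
  still beats.\<close>

definition subexponential :: "(real^'n \<Rightarrow> complex) \<Rightarrow> bool" where
  "subexponential p \<longleftrightarrow> p \<in> borel_measurable borel \<and> (\<forall>a>0. \<exists>C. \<forall>t. norm (p t) \<le> C * exp (a * norm t))"

lemma cdot_add: "cdot (u + v) t = cdot u t + cdot v t"
  by (simp add: cdot_def distrib_right sum.distrib)

lemma cdot_scale: "cdot (c *s u) t = c * cdot u t"
  by (simp add: cdot_def sum_distrib_left mult.assoc)

lemma cdot_minus: "cdot (- u) t = - cdot u t"
  by (simp add: cdot_def sum_negf)

lemma cdot_vcnj: "cdot (vcnj u) t = cnj (cdot u t)"
  by (simp add: cdot_def)

lemma cdot_cpoint: "cdot (cpoint x y) t = Complex (x \<bullet> t) (y \<bullet> t)"
  by (simp add: cdot_def inner_vec_def complex_eq_iff)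

lemma continuous_on_cdot [continuous_intros]:
  "continuous_on S f \<Longrightarrow> continuous_on S (\<lambda>x. cdot u (f x))"
  unfolding cdot_def by (intro continuous_intros)

lemma norm_cdot_le: "norm (cdot u t) \<le> norm u * norm t"
proof -
  have "norm (cdot u t) \<le> (\<Sum>j\<in>UNIV. \<bar>norm (u $ j)\<bar> * \<bar>norm (t $ j)\<bar>)"
    unfolding cdot_def by (rule order_trans[OF norm_sum]) (simp add: norm_mult)
  also have "\<dots> \<le> norm u * norm t"
    unfolding norm_vec_def by (rule L2_set_mult_ineq)
  finally show ?thesis .
qed

lemma planewave_measurable [measurable]: "planewave u \<in> borel_measurable borel"
  unfolding planewave_def by (intro borel_measurable_continuous_onI continuous_intros)

lemma cdot_measurable [measurable]: "cdot u \<in> borel_measurable borel"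
  by (intro borel_measurable_continuous_onI continuous_intros)

lemma planewave_add: "planewave (u + v) t = planewave u t * planewave v t"
  by (simp add: planewave_def cdot_add distrib_left exp_add)

lemma planewave_cpoint: "planewave (cpoint x y) t = of_real (exp (- (2 * pi * (y \<bullet> t)))) * cis (2 * pi * (x \<bullet> t))"
proof -
  have "2 * of_real pi * \<i> * Complex (x \<bullet> t) (y \<bullet> t) = of_real (- (2 * pi * (y \<bullet> t))) + \<i> * of_real (2 * pi * (x \<bullet> t))"
    by (simp add: complex_eq_iff)
  then show ?thesis
    by (simp only: planewave_def cdot_cpoint exp_add exp_of_real cis_conv_exp)
qed

lemma norm_planewave: "norm (planewave u t) = exp (- (2 * pi * (imvec u \<bullet> t)))"
  using planewave_cpoint[of "revec u" "imvec u" t] by (simp add: norm_mult)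

section \<open>The dual cone and the decay of plane waves on it\<close>

lemma closed_dual_cone: "closed (dual_cone \<Gamma>)"
proof -
  have "dual_cone \<Gamma> = (\<Inter>x\<in>\<Gamma>. {t. 0 \<le> x \<bullet> t})" by (auto simp: dual_cone_def)
  then show ?thesis by (auto intro!: closed_INT closed_Collect_le continuous_intros)
qed

lemma dual_cone_measurable [measurable]: "dual_cone \<Gamma> \<in> sets borel"
  by (intro borel_closed closed_dual_cone)

lemma dual_cone_nonneg: "t \<in> dual_cone \<Gamma> \<Longrightarrow> y \<in> \<Gamma> \<Longrightarrow> 0 \<le> y \<bullet> t"
  by (simp add: dual_cone_def)

text \<open>If a closed ball of radius \<open>c\<close> about \<open>y\<close> lies in the cone,
  then so does \<open>y - (c / norm t) *\<^sub>R t\<close>; its inner product with \<open>t\<close>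
  is nonnegative, which is the claim.\<close>

lemma dual_cone_coercive:
  assumes "open_cone \<Gamma>" "y \<in> \<Gamma>"
  obtains c where "c > 0" "\<And>t. t \<in> dual_cone \<Gamma> \<Longrightarrow> c * norm t \<le> y \<bullet> t"
proof -
  obtain c where c: "c > 0" "cball y c \<subseteq> \<Gamma>"
    using assms open_cone_imp_open open_contains_cball by metis
  show ?thesis
  proof (rule that[OF c(1)])
    fix t assume t: "t \<in> dual_cone \<Gamma>"
    show "c * norm t \<le> y \<bullet> t"
    proof (cases "t = 0")
      case False
      have "dist y (y - (c / norm t) *\<^sub>R t) = c" using c False by (simp add: dist_norm)
      then have "y - (c / norm t) *\<^sub>R t \<in> \<Gamma>" using c(2) by auto
      from dual_cone_nonneg[OF t this] have "(c / norm t) * (t \<bullet> t) \<le> y \<bullet> t" by (simp add: inner_diff_left)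
      then show ?thesis using False by (simp add: power2_norm_eq_inner[symmetric] power2_eq_square)
    qed simp
  qed
qed

lemma planewave_decay:
  assumes "open_cone \<Gamma>" "u \<in> tube \<Gamma>"
  obtains c where "c > 0" "\<And>t. t \<in> dual_cone \<Gamma> \<Longrightarrow> norm (planewave u t) \<le> exp (- (c * norm t))"
proof -
  obtain c where c: "c > 0" "\<And>t. t \<in> dual_cone \<Gamma> \<Longrightarrow> c * norm t \<le> imvec u \<bullet> t"
    using dual_cone_coercive[OF assms(1)] assms(2) unfolding mem_tube_iff by blast
  show ?thesis
  proof (rule that[of "2 * pi * c"])
    fix t assume "t \<in> dual_cone \<Gamma>"
    from c(2)[OF this] have "2 * pi * (c * norm t) \<le> 2 * pi * (imvec u \<bullet> t)"
      by (intro mult_left_mono) auto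
    then show "norm (planewave u t) \<le> exp (- (2 * pi * c * norm t))"
      by (simp add: norm_planewave mult.assoc)
  qed (use c in simp)
qed

section \<open>Subexponential weights\<close>

lemma subexponential_measurable [measurable_dest]: "subexponential p \<Longrightarrow> p \<in> borel_measurable borel"
  by (simp add: subexponential_def)

lemma subexponential_const: "subexponential (\<lambda>t. c)"
  unfolding subexponential_def
proof (intro conjI allI impI)
  fix a :: real assume "0 < a"
  then have "norm c \<le> norm c * exp (a * norm t)" for t :: "real^'b"
    using mult_left_mono[of 1 "exp (a * norm t)" "norm c"] by simp
  then show "\<exists>C. \<forall>t::real^'b. norm c \<le> C * exp (a * norm t)" by blast
qed simp

lemma subexponential_linear:
  fixes p :: "real^'n \<Rightarrow> complex"
  assumes "p \<in> borel_measurable borel" "\<And>t. norm (p t) \<le> K * norm t" "0 \<le> K"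
  shows "subexponential p"
  unfolding subexponential_def
proof (intro conjI allI impI exI)
  fix a :: real and t :: "real^'n" assume a: "0 < a"
  have "a * norm t \<le> exp (a * norm t)" using exp_ge_add_one_self[of "a * norm t"] by linarith
  then have "norm t \<le> exp (a * norm t) / a" using a by (simp add: field_simps)
  then have "K * norm t \<le> K * (exp (a * norm t) / a)" using assms(3) by (intro mult_left_mono)
  then show "norm (p t) \<le> (K / a) * exp (a * norm t)" using assms(2)[of t] by simp
qed fact

lemma subexponential_mult:
  assumes "subexponential p" "subexponential q"
  shows "subexponential (\<lambda>t. p t * q t)"
  unfolding subexponential_def
proof (intro conjI allI impI)
  note [measurable] = assms
  show "(\<lambda>t. p t * q t) \<in> borel_measurable borel" by measurable
  fix a :: real assume "0 < a"
  then have "0 < a / 2" by simp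
  then obtain C D where C: "\<And>t. norm (p t) \<le> C * exp (a / 2 * norm t)" and D: "\<And>t. norm (q t) \<le> D * exp (a / 2 * norm t)"
    using assms unfolding subexponential_def by meson
  have "norm (p t * q t) \<le> (C * D) * exp (a * norm t)" for t
  proof -
    have "norm (p t * q t) \<le> (C * exp (a / 2 * norm t)) * (D * exp (a / 2 * norm t))"
      unfolding norm_mult using order_trans[OF norm_ge_zero C] by (intro mult_mono C D) auto
    also have "\<dots> = (C * D) * (exp (a / 2 * norm t) * exp (a / 2 * norm t))" by simp
    also have "exp (a / 2 * norm t) * exp (a / 2 * norm t) = exp (a * norm t)"
      by (simp flip: exp_add)
    finally show ?thesis .
  qed
  then show "\<exists>C. \<forall>t. norm (p t * q t) \<le> C * exp (a * norm t)" by blast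
qed

lemma subexponential_cdot: "subexponential (\<lambda>t. c * cdot u t)"
proof (rule subexponential_linear)
  show "norm (c * cdot u t) \<le> (norm c * norm u) * norm t" for t
    using mult_left_mono[OF norm_cdot_le[of u t] norm_ge_zero[of c]] by (simp add: norm_mult mult.assoc)
qed simp_all

text \<open>Half of the exponential absorbs the weight, the other half is integrable.\<close>

lemma subexponential_integrable:
  assumes p: "subexponential p" and a: "0 < a"
  shows "integrable lborel (\<lambda>t. norm (p t) * exp (- (a * norm t)))"
proof -
  note [measurable] = p
  have "0 < a / 2" using a by simp
  then obtain C where C: "\<And>t. norm (p t) \<le> C * exp (a / 2 * norm t)" using p unfolding subexponential_def by blast
  show ?thesis
  proof (rule Bochner_Integration.integrable_bound)
    show "integrable lborel (\<lambda>t::real^'a. C * exp (- (a / 2 * norm t)))"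
      using a by (intro integrable_mult_right integrable_exp_norm) simp
    show "AE t in lborel. norm (norm (p t) * exp (- (a * norm t))) \<le> norm (C * exp (- (a / 2 * norm t)))" (is "AE t in _. ?P t")
    proof (rule AE_I2)
      fix t
      have "norm (p t) * exp (- (a * norm t)) \<le> C * exp (a / 2 * norm t) * exp (- (a * norm t))"
        by (intro mult_right_mono C) auto
      also have "\<dots> = C * exp (- (a / 2 * norm t))" by (simp add: mult.assoc flip: exp_add)
      finally show "?P t" by simp
    qed
  qed measurable
qed

lemma laplace_integrable:
  assumes cone: "open_cone \<Gamma>" and p: "subexponential p" and u: "u \<in> tube \<Gamma>"
  shows "integrable lborel (\<lambda>t. indicator (dual_cone \<Gamma>) t *\<^sub>R (p t * planewave u t))"
proof -
  note [measurable] = p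
  obtain c where c: "c > 0" "\<And>t. t \<in> dual_cone \<Gamma> \<Longrightarrow> norm (planewave u t) \<le> exp (- (c * norm t))"
    using planewave_decay[OF cone u] by blast
  show ?thesis
  proof (rule Bochner_Integration.integrable_bound[OF subexponential_integrable[OF p c(1)]])
    show "AE t in lborel. norm (indicator (dual_cone \<Gamma>) t *\<^sub>R (p t * planewave u t)) \<le> norm (norm (p t) * exp (- (c * norm t)))"
      by (auto simp: indicator_def norm_mult intro!: mult_left_mono c(2))
  qed measurable
qed

lemma norm_exp_remainder_le: "norm (exp z - 1 - z) \<le> (norm z)\<^sup>2 * exp (norm (z::complex))"
proof -
  have "norm (exp z - (\<Sum>k\<le>1. z ^ k / fact k)) \<le> exp \<bar>Re z\<bar> * (norm z) ^ Suc 1 / fact 1"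
    by (rule Taylor_exp)
  also have "\<dots> \<le> (norm z)\<^sup>2 * exp (norm z)"
    using mult_left_mono[of "exp \<bar>Re z\<bar>" "exp (norm z)" "(norm z)\<^sup>2"] abs_Re_le_cmod[of z]
    by (simp add: mult.commute power2_eq_square)
  finally show ?thesis by (simp add: diff_diff_add)
qed

text \<open>Differentiation under the integral with an explicit quadratic remainder. Homogeneity
  under complex scalars is the second ingredient of holomorphy in the sense of
  \<open>vec_holomorphic_on\<close>.\<close>

lemma laplace_has_derivative:
  assumes cone: "open_cone \<Gamma>" and p: "subexponential p" and u: "u \<in> tube \<Gamma>"
  shows "(laplace \<Gamma> p has_derivative (\<lambda>h. laplace \<Gamma> (\<lambda>t. p t * (2 * of_real pi * \<i> * cdot h t)) u)) (at u)"
    and "laplace \<Gamma> (\<lambda>t. p t * (2 * of_real pi * \<i> * cdot (c *s h) t)) u = c * laplace \<Gamma> (\<lambda>t. p t * (2 * of_real pi * \<i> * cdot h t)) u"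
proof -
  let ?D = "dual_cone \<Gamma>"
  let ?L = "\<lambda>h. laplace \<Gamma> (\<lambda>t. p t * (2 * of_real pi * \<i> * cdot h t)) u"
  note [measurable] = p
  have ph: "subexponential (\<lambda>t. p t * (2 * of_real pi * \<i> * cdot h t))" for h
    by (intro subexponential_mult p subexponential_cdot)
  note int = laplace_integrable[OF cone ph u]
  show scale: "?L (c *s h) = c * ?L h" for c h
    unfolding laplace_def by (subst integral_mult_right_zero[symmetric]) (simp add: cdot_scale mult_ac)
  have add: "?L (h + k) = ?L h + ?L k" for h k
    unfolding laplace_def
    by (subst Bochner_Integration.integral_add[symmetric, OF int int]) (simp add: cdot_add algebra_simps)
  have lin: "bounded_linear ?L"
  proof (rule linear_conv_bounded_linear[THEN iffD1], rule linearI)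
    show "?L (r *\<^sub>R h) = r *\<^sub>R ?L h" for r h
    proof -
      have "r *\<^sub>R h = of_real r *s h"
        unfolding vec_eq_iff vector_scaleR_component by (simp add: scaleR_conv_of_real)
      then show ?thesis using scale[of "of_real r" h] by (simp add: scaleR_conv_of_real)
    qed
  qed (rule add)
  obtain c where c: "c > 0" "\<And>t. t \<in> ?D \<Longrightarrow> norm (planewave u t) \<le> exp (- (c * norm t))"
    using planewave_decay[OF cone u] by blast
  \<comment> \<open>The quadratic remainder of the exponential contributes a factor
    \<open>(norm t)\<^sup>2\<close> to the weight.\<close>
  define q where "q t = p t * (of_real (norm t) * of_real (norm t))" for t
  have q: "subexponential q"
    unfolding q_def by (intro subexponential_mult p subexponential_linear[where K=1]) (auto simp: )
  define B where "B = (2 * pi)\<^sup>2 * (LINT t|lborel. norm (q t) * exp (- (c / 2 * norm t)))"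
  obtain r where r: "r > 0" "ball u r \<subseteq> tube \<Gamma>"
    using open_tube[OF open_cone_imp_open[OF cone]] u open_contains_ball by blast
  \<comment> \<open>The radius \<open>r\<close> keeps \<open>u + h\<close> in the tube. The bound
    \<open>c / (4 * pi)\<close> keeps the change \<open>2 * pi * norm h * norm t\<close> of the
    exponent below \<open>c / 2 * norm t\<close>, so half of the decay survives.\<close>
  define \<delta> where "\<delta> = min r (c / (4 * pi))"
  have \<delta>: "\<delta> > 0" using r c by (simp add: \<delta>_def)
  have rem: "norm (laplace \<Gamma> p (u + h) - laplace \<Gamma> p u - ?L h) \<le> B * (norm h)\<^sup>2" if h: "norm h < \<delta>" for h
  proof -
    have "u + h \<in> ball u r" using h by (simp add: \<delta>_def dist_norm)
    then have uh: "u + h \<in> tube \<Gamma>" using r by blast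
    let ?z = "\<lambda>t. 2 * of_real pi * \<i> * cdot h t"
    have "laplace \<Gamma> p (u + h) - laplace \<Gamma> p u - ?L h =
       (LINT t|lborel. indicator ?D t *\<^sub>R (p t * planewave (u + h) t) - indicator ?D t *\<^sub>R (p t * planewave u t)
          - indicator ?D t *\<^sub>R (p t * (2 * of_real pi * \<i> * cdot h t) * planewave u t))"
      unfolding laplace_def
      by (subst Bochner_Integration.integral_diff[symmetric] | intro Bochner_Integration.integrable_diff laplace_integrable[OF cone p] uh u int)+ (rule refl)
    also have "\<dots> = (LINT t|lborel. indicator ?D t *\<^sub>R (p t * planewave u t * (exp (?z t) - 1 - ?z t)))"
      unfolding planewave_add planewave_def[of h] by (intro Bochner_Integration.integral_cong refl) (simp add: algebra_simps scaleR_conv_of_real)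
    finally have "norm (laplace \<Gamma> p (u + h) - laplace \<Gamma> p u - ?L h) \<le> (LINT t|lborel. norm (indicator ?D t *\<^sub>R (p t * planewave u t * (exp (?z t) - 1 - ?z t))))"
      by (simp only: integral_norm_bound)
    also have "\<dots> \<le> (LINT t|lborel. ((2 * pi)\<^sup>2 * (norm h)\<^sup>2) * (norm (q t) * exp (- (c / 2 * norm t))))"
    proof (rule integral_mono_AE')
      show "integrable lborel (\<lambda>t. ((2 * pi)\<^sup>2 * (norm h)\<^sup>2) * (norm (q t) * exp (- (c / 2 * norm t))))"
        using c by (intro integrable_mult_right subexponential_integrable q) simp
      show "AE t in lborel. norm (indicator ?D t *\<^sub>R (p t * planewave u t * (exp (?z t) - 1 - ?z t))) \<le> ((2 * pi)\<^sup>2 * (norm h)\<^sup>2) * (norm (q t) * exp (- (c / 2 * norm t)))" (is "AE t in _. ?P t")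
      proof (rule AE_I2)
        fix t
        show "?P t"
        proof (cases "t \<in> ?D")
          case True
          have zle: "norm (?z t) \<le> 2 * pi * norm h * norm t"
            using mult_left_mono[OF norm_cdot_le[of h t], of "2 * pi"] by (simp add: norm_mult mult.assoc)
          also have "\<dots> \<le> c / 2 * norm t"
          proof (rule mult_right_mono)
            have "norm h < c / (4 * pi)" using h by (simp add: \<delta>_def)
            then show "2 * pi * norm h \<le> c / 2" by (simp add: field_simps)
          qed simp
          finally have zle2: "norm (?z t) \<le> c / 2 * norm t" .
          have "norm (exp (?z t) - 1 - ?z t) \<le> (norm (?z t))\<^sup>2 * exp (norm (?z t))"
            by (rule norm_exp_remainder_le)
          also have "\<dots> \<le> (2 * pi * norm h * norm t)\<^sup>2 * exp (c / 2 * norm t)"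
            using zle zle2 by (intro mult_mono power_mono) auto
          finally have "norm (p t) * norm (planewave u t) * norm (exp (?z t) - 1 - ?z t) \<le>
             norm (p t) * exp (- (c * norm t)) * ((2 * pi * norm h * norm t)\<^sup>2 * exp (c / 2 * norm t))"
            using c(2)[OF True] by (intro mult_mono mult_left_mono) auto
          also have "\<dots> = ((2 * pi)\<^sup>2 * (norm h)\<^sup>2) * (norm (q t) * (exp (- (c * norm t)) * exp (c / 2 * norm t)))"
            by (simp add: q_def norm_mult power_mult_distrib power2_eq_square mult_ac)
          also have "exp (- (c * norm t)) * exp (c / 2 * norm t) = exp (- (c / 2 * norm t))"
            by (simp flip: exp_add)
          finally show ?thesis using True by (simp add: norm_mult)
        qed simp
      qed
      show "AE t in lborel. 0 \<le> ((2 * pi)\<^sup>2 * (norm h)\<^sup>2) * (norm (q t) * exp (- (c / 2 * norm t)))" by simp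
    qed
    also have "\<dots> = B * (norm h)\<^sup>2" unfolding B_def integral_mult_right_zero by simp
    finally show ?thesis .
  qed
  show "(laplace \<Gamma> p has_derivative ?L) (at u)"
    unfolding has_derivative_at
  proof (intro conjI lin)
    have "((\<lambda>h::complex^'a. B * norm h) \<longlongrightarrow> B * norm (0::complex^'a)) (at 0)"
      by (intro tendsto_intros)
    then have lim: "((\<lambda>h::complex^'a. B * norm h) \<longlongrightarrow> 0) (at 0)" by simp
    show "(\<lambda>h. norm (laplace \<Gamma> p (u + h) - laplace \<Gamma> p u - ?L h) / norm h) \<midarrow>0\<rightarrow> 0"
    proof (rule Lim_null_comparison[OF _ lim])
      show "\<forall>\<^sub>F h in at 0. norm (norm (laplace \<Gamma> p (u + h) - laplace \<Gamma> p u - ?L h) / norm h) \<le> B * norm h"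
        unfolding eventually_at
      proof (intro exI[of _ \<delta>] conjI \<delta> ballI impI)
        fix h :: "complex^'a" assume h: "h \<noteq> 0 \<and> dist h 0 < \<delta>"
        then have "norm (laplace \<Gamma> p (u + h) - laplace \<Gamma> p u - ?L h) \<le> (B * norm h) * norm h"
          using rem[of h] by (simp add: power2_eq_square mult.assoc)
        then show "norm (norm (laplace \<Gamma> p (u + h) - laplace \<Gamma> p u - ?L h) / norm h) \<le> B * norm h"
          using h by (simp add: pos_divide_le_eq)
      qed
    qed
  qed
qed

text \<open>The tube is open, so derivatives at its points do not see the arbitrary values that a
  total function takes outside.\<close>

lemma hardy_space_cong:
  assumes F: "F \<in> hardy_space \<Gamma>" and "open \<Gamma>" and eq: "\<And>z. z \<in> tube \<Gamma> \<Longrightarrow> F z = G z"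
  shows "G \<in> hardy_space \<Gamma>"
proof (rule hardy_spaceI)
  show "vec_holomorphic_on G (tube \<Gamma>)"
    unfolding vec_holomorphic_on_def
  proof
    fix z assume z: "z \<in> tube \<Gamma>"
    then obtain F' where F': "(F has_derivative F') (at z)" "\<forall>c v. F' (c *s v) = c * F' v"
      using hardy_space_holomorphic[OF F] unfolding vec_holomorphic_on_def by blast
    have "(G has_derivative F') (at z)"
      by (rule has_derivative_transform_within_open[OF F'(1) open_tube[OF \<open>open \<Gamma>\<close>] z]) (rule eq)
    then show "\<exists>F'. (G has_derivative F') (at z) \<and> (\<forall>c v. F' (c *s v) = c * F' v)"
      using F'(2) by blast
  qed
  show "nn_energy (slice G y) \<le> ennreal ((hardy_norm \<Gamma> F)\<^sup>2)" if "y \<in> \<Gamma>" for y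
    using hardy_slice_nn_le[OF F that] eq that by simp
qed simp

text \<open>The real part of the argument only contributes a phase. Thus slices become Fourier
  transforms of functions on the dual cone, and \<open>fourier_L2_bound\<close> applies to
  them.\<close>

lemma laplace_slice_fourier:
  fixes u0 :: "complex^'n"
  shows "laplace \<Gamma> p (s *\<^sub>R cpoint x y + u0) =
    fourier (2 * pi * s) (\<lambda>t. indicator (dual_cone \<Gamma>) t *\<^sub>R (p t * planewave (cpoint 0 (s *\<^sub>R y) + u0) t)) x"
proof -
  have "s *\<^sub>R cpoint x y + u0 = cpoint (s *\<^sub>R x) 0 + (cpoint 0 (s *\<^sub>R y) + u0)"
    by (simp add: vec_eq_iff complex_eq_iff)
  then show ?thesis
    unfolding laplace_def fourier_def
    by (intro Bochner_Integration.integral_cong refl) (simp add: planewave_add planewave_cpoint mult_ac)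
qed

text \<open>The shift \<open>u0\<close> makes the density square integrable, and the additional
  plane wave of height \<open>s *\<^sub>R y\<close> has modulus at most 1 on the dual cone, so the
  density at \<open>u0\<close> bounds all slices. The scale \<open>s\<close> is needed for the
  damping factors; the kernels have \<open>s = 1\<close>.\<close>

lemma laplace_in_hardy_space:
  fixes u0 :: "complex^'n"
  assumes cone: "open_cone \<Gamma>" and p: "subexponential p" and u0: "u0 \<in> tube \<Gamma>" and s: "0 < s"
  shows "(\<lambda>w. laplace \<Gamma> p (s *\<^sub>R w + u0)) \<in> hardy_space \<Gamma>"
proof -
  note [measurable] = p
  let ?D = "dual_cone \<Gamma>"
  have mem: "s *\<^sub>R w + u0 \<in> tube \<Gamma>" if "w \<in> tube \<Gamma>" for w
  proof -
    have "imvec (s *\<^sub>R w + u0) = s *\<^sub>R imvec w + imvec u0" by (simp add: imvec_def vec_eq_iff)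
    then show ?thesis using that u0 s unfolding mem_tube_iff by (simp add: open_cone_add[OF cone] open_cone_scale[OF cone])
  qed
  define C where "C = (2 * pi / \<bar>2 * pi * s\<bar>) ^ DIM(real^'n) * energy (\<lambda>t. indicator ?D t *\<^sub>R (p t * planewave u0 t))"
  have sq: "square_integrable (\<lambda>t. indicator ?D t *\<^sub>R (p t * planewave u t))" if u: "u \<in> tube \<Gamma>" for u
  proof -
    obtain c where c: "c > 0" "\<And>t. t \<in> ?D \<Longrightarrow> norm (planewave u t) \<le> exp (- (c * norm t))"
      using planewave_decay[OF cone u] by blast
    have pp: "subexponential (\<lambda>t. p t * p t)" by (intro subexponential_mult p)
    have "integrable lborel (\<lambda>t. (norm (indicator ?D t *\<^sub>R (p t * planewave u t)))\<^sup>2)"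
    proof (rule Bochner_Integration.integrable_bound[OF subexponential_integrable[OF pp, of "2 * c"]])
      show "AE t in lborel. norm ((norm (indicator ?D t *\<^sub>R (p t * planewave u t)))\<^sup>2) \<le> norm (norm (p t * p t) * exp (- (2 * c * norm t)))" (is "AE t in _. ?P t")
      proof (rule AE_I2)
        fix t
        show "?P t"
        proof (cases "t \<in> ?D")
          case True
          have "(norm (p t * planewave u t))\<^sup>2 \<le> (norm (p t) * exp (- (c * norm t)))\<^sup>2"
            using c(2)[OF True] by (intro power_mono) (auto simp: norm_mult intro: mult_left_mono)
          also have "\<dots> = norm (p t * p t) * exp (- (2 * c * norm t))"
            by (simp add: norm_mult power2_eq_square algebra_simps flip: exp_add)
          finally show ?thesis using True by simp
        qed simp
      qed
    qed (use c in auto)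
    then show ?thesis unfolding square_integrable_def by simp
  qed
  show ?thesis
  proof (rule hardy_spaceI[of _ _ C])
    show "vec_holomorphic_on (\<lambda>w. laplace \<Gamma> p (s *\<^sub>R w + u0)) (tube \<Gamma>)"
      unfolding vec_holomorphic_on_def
    proof
      fix w :: "complex^'n" assume w: "w \<in> tube \<Gamma>"
      let ?L = "\<lambda>h. laplace \<Gamma> (\<lambda>t. p t * (2 * of_real pi * \<i> * cdot h t)) (s *\<^sub>R w + u0)"
      have "((\<lambda>w. s *\<^sub>R w + u0) has_derivative (\<lambda>h. s *\<^sub>R h)) (at w)"
        by (auto intro!: derivative_eq_intros)
      from diff_chain_at[OF this laplace_has_derivative(1)[OF cone p mem[OF w]]]
      have "((\<lambda>w. laplace \<Gamma> p (s *\<^sub>R w + u0)) has_derivative (\<lambda>h. ?L (s *\<^sub>R h))) (at w)" by (simp add: o_def)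
      moreover have "?L (s *\<^sub>R (c *s h)) = c * ?L (s *\<^sub>R h)" for c h
      proof -
        have "s *\<^sub>R (c *s h) = c *s (s *\<^sub>R h)" by (simp add: vec_eq_iff)
        then show ?thesis using laplace_has_derivative(2)[OF cone p mem[OF w]] by simp
      qed
      ultimately show "\<exists>F'. ((\<lambda>w. laplace \<Gamma> p (s *\<^sub>R w + u0)) has_derivative F') (at w) \<and> (\<forall>c v. F' (c *s v) = c * F' v)"
        by blast
    qed
    show "0 \<le> C" unfolding C_def by (intro mult_nonneg_nonneg integral_nonneg_AE) auto
    fix y assume y: "y \<in> \<Gamma>"
    have eq: "cpoint 0 (s *\<^sub>R y) + u0 = s *\<^sub>R cpoint 0 y + u0" by (simp add: vec_eq_iff complex_eq_iff)
    have yt: "cpoint 0 (s *\<^sub>R y) + u0 \<in> tube \<Gamma>" unfolding eq by (rule mem) (simp add: y)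
    have "nn_energy (\<lambda>x. laplace \<Gamma> p (s *\<^sub>R cpoint x y + u0)) \<le>
       ennreal ((2 * pi / \<bar>2 * pi * s\<bar>) ^ DIM(real^'n) * energy (\<lambda>t. indicator ?D t *\<^sub>R (p t * planewave (cpoint 0 (s *\<^sub>R y) + u0) t)))"
      unfolding laplace_slice_fourier
      by (rule fourier_L2_bound[OF laplace_integrable[OF cone p yt] sq[OF yt]]) (use s in simp)
    also have "\<dots> \<le> ennreal C"
      unfolding C_def
    proof (intro ennreal_leI mult_left_mono integral_mono_AE)
      show "AE t in lborel. (norm (indicator ?D t *\<^sub>R (p t * planewave (cpoint 0 (s *\<^sub>R y) + u0) t)))\<^sup>2 \<le> (norm (indicator ?D t *\<^sub>R (p t * planewave u0 t)))\<^sup>2" (is "AE t in _. ?P t")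
      proof (rule AE_I2)
        fix t
        show "?P t"
        proof (cases "t \<in> ?D")
          case True
          have "norm (planewave (cpoint 0 (s *\<^sub>R y)) t) \<le> 1"
            using dual_cone_nonneg[OF True y] s by (simp add: norm_planewave)
          then have "norm (planewave (cpoint 0 (s *\<^sub>R y)) t) * norm (planewave u0 t) \<le> norm (planewave u0 t)"
            by (intro mult_left_le_one_le) auto
          then show ?thesis
            using True by (auto simp: planewave_add norm_mult intro!: power_mono mult_left_mono)
        qed simp
      qed
    qed (use sq[OF yt] sq[OF u0] in \<open>auto simp: square_integrable_def\<close>)
    finally show "nn_energy (\<lambda>x. laplace \<Gamma> p (s *\<^sub>R cpoint x y + u0)) \<le> ennreal C" .
  qed
qed

section \<open>The Cauchy-Szego kernel and its derivatives as Laplace transforms\<close>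

lemma szego_kernel_eq_laplace: "szego_kernel \<Gamma> w z = laplace \<Gamma> (\<lambda>_. 1) (w - vcnj z)"
proof -
  have "exp (2 * of_real pi * \<i> * cdot w t) * cnj (exp (2 * of_real pi * \<i> * cdot z t)) = planewave (w - vcnj z) t" for t
    unfolding exp_cnj diff_conv_add_uminus planewave_add
    by (simp add: planewave_def cdot_minus cdot_vcnj)
  then show ?thesis
    by (simp add: szego_kernel_def laplace_def set_lebesgue_integral_def)
qed

lemma tube_minus_vcnj:
  assumes "open_cone \<Gamma>" "w \<in> tube \<Gamma>" "z \<in> tube \<Gamma>"
  shows "w - vcnj z \<in> tube \<Gamma>"
proof -
  have "imvec (w - vcnj z) = imvec w + imvec z" by (simp add: imvec_def vec_eq_iff)
  then show ?thesis using assms open_cone_add by (simp add: mem_tube_iff)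
qed

text \<open>Since \<zeta> enters through its conjugate, the derivative of \<open>f\<close> is
  \<open>L (- vcnj h)\<close> with \<open>L\<close> complex linear. The real partial derivatives in
  the two directions of the j-th variable are then -L(e) and i L(e), which combine to -L(e).
  Agreement of \<open>f\<close> with the transform is asked for on the tube only, which is all that
  iteration provides.\<close>

lemma dir_wirtinger_bar_laplace:
  fixes d w :: "complex^'n"
  assumes cone: "open_cone \<Gamma>" and p: "subexponential p" and w: "w \<in> tube \<Gamma>" and z: "z \<in> tube \<Gamma>"
    and f: "\<And>\<zeta>. \<zeta> \<in> tube \<Gamma> \<Longrightarrow> f \<zeta> = laplace \<Gamma> p (w - vcnj \<zeta>)"
  shows "dir_wirtinger_bar d f z = laplace \<Gamma> (\<lambda>t. p t * (- (2 * of_real pi * \<i>) * cdot d t)) (w - vcnj z)"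
proof -
  let ?u = "w - vcnj z"
  define L where "L h = laplace \<Gamma> (\<lambda>t. p t * (2 * of_real pi * \<i> * cdot h t)) ?u" for h
  have u: "?u \<in> tube \<Gamma>" by (rule tube_minus_vcnj[OF cone w z])
  have dL: "(laplace \<Gamma> p has_derivative L) (at ?u)" and Lc: "L (c *s h) = c * L h" for c h
    using laplace_has_derivative[OF cone p u] unfolding L_def by auto
  have linL: "linear L" using dL has_derivative_linear by blast
  have df: "(f has_derivative (\<lambda>h. L (- vcnj h))) (at z)"
  proof (rule has_derivative_transform_within_open[OF _ open_tube[OF open_cone_imp_open[OF cone]] z])
    have "((\<lambda>\<zeta>. w - vcnj \<zeta>) has_derivative (\<lambda>h. - vcnj h)) (at z)"
      using has_derivative_diff[OF has_derivative_const bounded_linear_imp_has_derivative[OF bounded_linear_vcnj]] by simp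
    from diff_chain_at[OF this dL] show "((\<lambda>\<zeta>. laplace \<Gamma> p (w - vcnj \<zeta>)) has_derivative (\<lambda>h. L (- vcnj h))) (at z)"
      by (simp add: o_def)
  qed (simp add: f)
  have vd: "vector_derivative (\<lambda>s. f (z + axis j (a * of_real s))) (at 0) = L (- vcnj (axis j a))" for j a
  proof (rule vector_derivative_at)
    have ax: "axis j (a * of_real s) = s *\<^sub>R (axis j a :: complex^'n)" for s
      unfolding vec_eq_iff vector_scaleR_component by (simp add: axis_def scaleR_conv_of_real)
    have "((\<lambda>s. z + s *\<^sub>R axis j a) has_vector_derivative axis j a) (at 0)"
      by (auto intro!: derivative_eq_intros simp: has_vector_derivative_def)
    moreover have "(f has_derivative (\<lambda>h. L (- vcnj h))) (at (z + 0 *\<^sub>R axis j a))" using df by simp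
    ultimately have "((f \<circ> (\<lambda>s. z + s *\<^sub>R axis j a)) has_derivative ((\<lambda>h. L (- vcnj h)) \<circ> (\<lambda>s. s *\<^sub>R axis j a))) (at 0)"
      unfolding has_vector_derivative_def by (rule diff_chain_at)
    moreover have "L (- vcnj (s *\<^sub>R axis j a)) = s *\<^sub>R L (- vcnj (axis j a))" for s
    proof -
      have e: "- vcnj (s *\<^sub>R axis j a) = s *\<^sub>R (- vcnj (axis j a) :: complex^'n)" by (simp add: vec_eq_iff)
      show ?thesis unfolding e by (rule linear_cmul[OF linL])
    qed
    ultimately show "((\<lambda>s. f (z + axis j (a * of_real s))) has_vector_derivative L (- vcnj (axis j a))) (at 0)"
      unfolding has_vector_derivative_def ax by (simp add: o_def)
  qed
  have wb: "wirtinger_bar j f z = - L (axis j 1)" for j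
  proof -
    have e: "- vcnj (axis j 1) = (- 1) *s (axis j 1 :: complex^'n)" "- vcnj (axis j \<i>) = \<i> *s (axis j 1 :: complex^'n)"
      by (auto simp: vec_eq_iff axis_def)
    show ?thesis
      unfolding wirtinger_bar_def using vd[of j 1, unfolded e Lc] vd[of j \<i>, unfolded e Lc] by simp
  qed
  have "dir_wirtinger_bar d f z = - (\<Sum>j\<in>UNIV. L (d $ j *s axis j 1))"
    unfolding dir_wirtinger_bar_def wb Lc by (simp add: sum_negf)
  also have "(\<Sum>j\<in>UNIV. L (d $ j *s axis j 1)) = L (\<Sum>j\<in>UNIV. d $ j *s axis j 1)"
    by (rule linear_sum[OF linL, symmetric])
  also have "\<dots> = L d" by (simp add: basis_expansion)
  also have "- L d = L ((- 1) *s d)" by (simp only: Lc) simp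
  also have "\<dots> = laplace \<Gamma> (\<lambda>t. p t * (- (2 * of_real pi * \<i>) * cdot d t)) ?u"
    unfolding L_def by (simp add: cdot_scale cdot_minus)
  finally show ?thesis .
qed

lemma dir_wirtinger_bar_power_szego:
  fixes d w :: "complex^'n"
  assumes cone: "open_cone \<Gamma>" and w: "w \<in> tube \<Gamma>" and z: "z \<in> tube \<Gamma>"
  shows "(dir_wirtinger_bar d ^^ l) (szego_kernel \<Gamma> w) z = laplace \<Gamma> (\<lambda>t. (- (2 * of_real pi * \<i>) * cdot d t) ^ l) (w - vcnj z)"
  using z
proof (induction l arbitrary: z)
  case 0
  then show ?case by (simp add: szego_kernel_eq_laplace)
next
  case (Suc l)
  have "subexponential (\<lambda>t. (- (2 * of_real pi * \<i>) * cdot d t) ^ l)"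
  proof (induction l)
    case 0 show ?case by (simp add: subexponential_const)
  next
    case (Suc l) then show ?case unfolding power_Suc by (intro subexponential_mult subexponential_cdot)
  qed
  from dir_wirtinger_bar_laplace[OF cone this w Suc.prems Suc.IH, of d]
  show ?case by (simp only: funpow.simps o_apply power_Suc2)
qed

lemma subexponential_power: "subexponential p \<Longrightarrow> subexponential (\<lambda>t. p t ^ l)"
  by (induction l) (auto intro: subexponential_const subexponential_mult)

lemma laplace_vcnj_in_hardy_space:
  assumes cone: "open_cone \<Gamma>" and z: "z \<in> tube \<Gamma>" and p: "subexponential p"
  shows "(\<lambda>w. laplace \<Gamma> p (w - vcnj z)) \<in> hardy_space \<Gamma>"
proof -
  have "- vcnj z \<in> tube \<Gamma>"
  proof -
    have "imvec (- vcnj z) = imvec z" by (simp add: imvec_def vec_eq_iff)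
    then show ?thesis using z by (simp add: mem_tube_iff)
  qed
  from laplace_in_hardy_space[OF cone p this zero_less_one] show ?thesis by simp
qed

text \<open>On the tube the iterated derivative is a Laplace transform with a power of a linear form
  as weight; outside, its values are irrelevant by \<open>hardy_space_cong\<close>.\<close>

lemma multiple_kernel_in_hardy_space:
  assumes cone: "open_cone \<Gamma>" and z: "z k \<in> tube \<Gamma>"
  shows "multiple_kernel \<Gamma> d z k \<in> hardy_space \<Gamma>"
proof (rule hardy_space_cong[OF _ open_cone_imp_open[OF cone]])
  let ?l = "occurrences z k - 1"
  let ?G = "\<lambda>w. laplace \<Gamma> (\<lambda>t. (- (2 * of_real pi * \<i>) * cdot d t) ^ ?l) (w - vcnj (z k))"
  show "(\<lambda>w. (1 / fact ?l) * ?G w) \<in> hardy_space \<Gamma>"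
    by (intro hardy_space_cmult laplace_vcnj_in_hardy_space cone z subexponential_power subexponential_cdot)
  show "(1 / fact ?l) * ?G w = multiple_kernel \<Gamma> d z k w" if "w \<in> tube \<Gamma>" for w
    unfolding multiple_kernel_def using dir_wirtinger_bar_power_szego[OF cone that z, where d=d and l="?l"] by simp
qed

subsection \<open>The reproducing property\<close>

lemma cdot_scaleR: "cdot (r *\<^sub>R u) t = r *\<^sub>R cdot u t"
  unfolding cdot_def vector_scaleR_component by (simp add: sum_distrib_left scaleR_conv_of_real mult.assoc)

lemma vec_holomorphic_on_planewave_minus: "vec_holomorphic_on (\<lambda>z. planewave (- z) t) S"
  unfolding vec_holomorphic_on_def
proof
  fix z :: "complex^'a"
  let ?l = "\<lambda>h::complex^'a. 2 * of_real pi * \<i> * cdot (- h) t"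
  have "bounded_linear ?l"
  proof (rule linear_conv_bounded_linear[THEN iffD1], rule linearI)
    show "?l (a + b) = ?l a + ?l b" for a b
      unfolding cdot_minus cdot_add by (simp add: algebra_simps)
    show "?l (r *\<^sub>R a) = r *\<^sub>R ?l a" for r a
      unfolding cdot_minus cdot_scaleR by simp
  qed
  from diff_chain_at[OF bounded_linear_imp_has_derivative[OF this] DERIV_exp[unfolded has_field_derivative_def]]
  have "((\<lambda>z. planewave (- z) t) has_derivative (\<lambda>h. planewave (- z) t * ?l h)) (at z)"
    unfolding planewave_def o_def .
  moreover have "planewave (- z) t * ?l (c *s v) = c * (planewave (- z) t * ?l v)" for c v
    by (simp add: cdot_minus cdot_scale)
  ultimately show "\<exists>F'. ((\<lambda>z. planewave (- z) t) has_derivative F') (at z) \<and> (\<forall>c v. F' (c *s v) = c * F' v)"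
    by blast
qed

section \<open>Fourier transforms of slices that are uniformly integrable in L1 norm\<close>

context
  fixes \<Gamma> :: "(real^'n) set" and G :: "complex^'n \<Rightarrow> complex" and C :: real
  assumes cone: "open_cone \<Gamma>" and hol: "vec_holomorphic_on G (tube \<Gamma>)"
    and bound: "\<And>y. y \<in> \<Gamma> \<Longrightarrow> (\<integral>\<^sup>+x. norm (G (cpoint x y)) \<partial>lborel) \<le> ennreal C" and C: "0 \<le> C"
begin

private abbreviation "slice_transform y \<equiv> fourier (- (2 * pi)) (slice G y)"

lemma slice_integrable: "y \<in> \<Gamma> \<Longrightarrow> integrable lborel (slice G y)"
  using bound[of y] borel_measurable_slice[OF hol, of y] by (auto intro!: integrableI_bounded simp: le_less_trans)

lemma norm_slice_transform_le: "y \<in> \<Gamma> \<Longrightarrow> norm (slice_transform y t) \<le> C"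
proof -
  assume y: "y \<in> \<Gamma>"
  have "norm (slice_transform y t) \<le> (LINT x|lborel. norm (G (cpoint x y)))"
    by (rule norm_fourier_le[OF slice_integrable[OF y]])
  moreover have "ennreal (LINT x|lborel. norm (G (cpoint x y))) \<le> ennreal C"
    using bound[OF y] slice_integrable[OF y] by (subst nn_integral_eq_integral[symmetric]) auto
  ultimately show ?thesis using C by simp
qed

text \<open>Both sides are slice integrals of the holomorphic function
  \<open>G z * planewave (- z) t\<close>. For fixed \<open>t\<close> the plane wave is bounded on
  the slices between the two heights, so \<open>integral_slice_constant\<close> applies.\<close>

lemma slice_transform_shift:
  assumes y: "y \<in> \<Gamma>" "y' \<in> \<Gamma>"
  shows "slice_transform y t * of_real (exp (2 * pi * (y \<bullet> t))) = slice_transform y' t * of_real (exp (2 * pi * (y' \<bullet> t)))"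
proof -
  define h where "h z = G z * planewave (- z) t" for z
  have pw: "planewave (- cpoint x w) t = of_real (exp (2 * pi * (w \<bullet> t))) * cis (- (2 * pi) * (t \<bullet> x))" for x w
  proof -
    have "- cpoint x w = cpoint (- x) (- w)" by (simp add: vec_eq_iff complex_eq_iff)
    then show ?thesis by (simp add: planewave_cpoint inner_commute)
  qed
  have eq: "(LINT x|lborel. h (cpoint x w)) = slice_transform w t * of_real (exp (2 * pi * (w \<bullet> t)))" for w
    unfolding h_def pw fourier_def by (subst integral_mult_left_zero[symmetric]) (simp add: mult_ac)
  have "(LINT x|lborel. h (cpoint x y)) = (LINT x|lborel. h (cpoint x y'))"
  proof (rule integral_slice_constant[OF _ open_cone_imp_open[OF cone] open_cone_imp_convex[OF cone] y])
    show "vec_holomorphic_on h (tube \<Gamma>)"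
      unfolding h_def by (intro vec_holomorphic_on_mult hol vec_holomorphic_on_planewave_minus)
    fix w assume w: "w \<in> closed_segment y y'"
    then have w\<Gamma>: "w \<in> \<Gamma>" using closed_segment_subset[OF y open_cone_imp_convex[OF cone]] by blast
    note [measurable] = borel_measurable_slice[OF hol w\<Gamma>]
    obtain s where s: "0 \<le> s" "s \<le> 1" "w = (1 - s) *\<^sub>R y + s *\<^sub>R y'" using w by (auto simp: in_segment)
    have "w \<bullet> t = (1 - s) * (y \<bullet> t) + s * (y' \<bullet> t)" by (simp add: s inner_add_left)
    also have "\<dots> \<le> 1 * \<bar>y \<bullet> t\<bar> + 1 * \<bar>y' \<bullet> t\<bar>"
    proof -
      have "a * b \<le> 1 * \<bar>b\<bar>" if "0 \<le> a" "a \<le> 1" for a b :: real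
        using mult_left_mono[OF abs_ge_self that(1), of b] mult_right_mono[OF that(2) abs_ge_zero, of b] by linarith
      then show ?thesis using s by (intro add_mono) auto
    qed
    finally have le: "exp (2 * pi * (w \<bullet> t)) \<le> exp (2 * pi * (\<bar>y \<bullet> t\<bar> + \<bar>y' \<bullet> t\<bar>))" by simp
    have "(\<integral>\<^sup>+x. norm (h (cpoint x w)) \<partial>lborel) = (\<integral>\<^sup>+x. ennreal (exp (2 * pi * (w \<bullet> t))) * norm (G (cpoint x w)) \<partial>lborel)"
      unfolding h_def pw by (intro nn_integral_cong) (simp add: norm_mult ennreal_mult mult.commute)
    also have "\<dots> = ennreal (exp (2 * pi * (w \<bullet> t))) * (\<integral>\<^sup>+x. norm (G (cpoint x w)) \<partial>lborel)"
      by (rule nn_integral_cmult) measurable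
    also have "\<dots> \<le> ennreal (exp (2 * pi * (\<bar>y \<bullet> t\<bar> + \<bar>y' \<bullet> t\<bar>))) * ennreal C"
      by (intro mult_mono bound w\<Gamma> ennreal_leI le) auto
    also have "\<dots> = ennreal (exp (2 * pi * (\<bar>y \<bullet> t\<bar> + \<bar>y' \<bullet> t\<bar>)) * C)" by (simp add: ennreal_mult C)
    finally show "(\<integral>\<^sup>+x. norm (h (cpoint x w)) \<partial>lborel) \<le> ennreal (exp (2 * pi * (\<bar>y \<bullet> t\<bar> + \<bar>y' \<bullet> t\<bar>)) * C)" .
  qed
  then show ?thesis unfolding eq .
qed

text \<open>The shift relation compares with an arbitrary height \<open>y'\<close>, where the
  transform is at most \<open>C\<close>. The freedom in \<open>y'\<close> yields both the support
  and the integrability of the transform.\<close>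

lemma norm_slice_transform_decay:
  assumes y: "y \<in> \<Gamma>" "y' \<in> \<Gamma>"
  shows "norm (slice_transform y t) \<le> C * exp (2 * pi * (y' \<bullet> t)) * exp (- (2 * pi * (y \<bullet> t)))"
proof -
  have "norm (slice_transform y t) * exp (2 * pi * (y \<bullet> t)) = norm (slice_transform y' t) * exp (2 * pi * (y' \<bullet> t))"
    using arg_cong[OF slice_transform_shift[OF y, of t], of norm] by (simp add: norm_mult)
  also have "\<dots> \<le> C * exp (2 * pi * (y' \<bullet> t))"
    by (intro mult_right_mono norm_slice_transform_le y) simp
  finally have "norm (slice_transform y t) * exp (2 * pi * (y \<bullet> t)) * exp (- (2 * pi * (y \<bullet> t))) \<le>
      C * exp (2 * pi * (y' \<bullet> t)) * exp (- (2 * pi * (y \<bullet> t)))"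
    by (intro mult_right_mono) simp_all
  then show ?thesis by (simp add: mult.assoc flip: exp_add)
qed

text \<open>Some \<open>x\<close> in the cone has \<open>x \<bullet> t < 0\<close>; taking
  \<open>y'\<close> to be large multiples of \<open>x\<close> sends the bound to 0.\<close>

lemma slice_transform_outside_dual:
  assumes y: "y \<in> \<Gamma>" and t: "t \<notin> dual_cone \<Gamma>"
  shows "slice_transform y t = 0"
proof -
  obtain x where x: "x \<in> \<Gamma>" "x \<bullet> t < 0" using t by (auto simp: dual_cone_def not_le)
  let ?e = "exp (- (2 * pi * (y \<bullet> t)))"
  have bd: "norm (slice_transform y t) \<le> C * exp (2 * pi * (x \<bullet> t)) ^ Suc n * ?e" for n
  proof -
    have "real (Suc n) *\<^sub>R x \<in> \<Gamma>" by (intro open_cone_scale cone x) simp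
    from norm_slice_transform_decay[OF y this, of t]
    have "norm (slice_transform y t) \<le> C * exp (real (Suc n) * (2 * pi * (x \<bullet> t))) * ?e" by (simp add: mult_ac)
    then show ?thesis by (simp only: exp_of_nat_mult)
  qed
  have "(\<lambda>n. C * exp (2 * pi * (x \<bullet> t)) ^ Suc n * ?e) \<longlonglongrightarrow> C * 0 * ?e"
    using x by (intro tendsto_intros LIMSEQ_Suc[OF LIMSEQ_realpow_zero]) (auto simp: mult_less_0_iff)
  then have "norm (slice_transform y t) \<le> C * 0 * ?e"
    by (rule LIMSEQ_le_const) (intro exI allI impI bd)
  then show ?thesis by simp
qed

text \<open>Comparison with height \<open>y / 2\<close> leaves the factor exp(-pi y.t), which decays
  exponentially on the dual cone.\<close>

lemma slice_transform_integrable: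
  assumes y: "y \<in> \<Gamma>"
  shows "integrable lborel (slice_transform y)"
proof -
  obtain c where c: "c > 0" "\<And>t. t \<in> dual_cone \<Gamma> \<Longrightarrow> c * norm t \<le> y \<bullet> t"
    using dual_cone_coercive[OF cone y] by blast
  have [measurable]: "slice_transform y \<in> borel_measurable borel"
    by (rule fourier_measurable[OF slice_integrable[OF y]])
  show ?thesis
  proof (rule Bochner_Integration.integrable_bound)
    show "integrable lborel (\<lambda>t::real^'n. C * exp (- (pi * c * norm t)))"
      using c by (intro integrable_mult_right integrable_exp_norm) simp
    show "AE t in lborel. norm (slice_transform y t) \<le> norm (C * exp (- (pi * c * norm t)))" (is "AE t in _. ?P t")
    proof (rule AE_I2)
      fix t
      show "?P t"
      proof (cases "t \<in> dual_cone \<Gamma>")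
        case True
        have half: "(1/2) *\<^sub>R y \<in> \<Gamma>" by (intro open_cone_scale cone y) simp
        have "norm (slice_transform y t) \<le> C * (exp (2 * pi * (((1/2) *\<^sub>R y) \<bullet> t)) * exp (- (2 * pi * (y \<bullet> t))))"
          using norm_slice_transform_decay[OF y half] by (simp only: mult.assoc)
        also have "exp (2 * pi * (((1/2) *\<^sub>R y) \<bullet> t)) * exp (- (2 * pi * (y \<bullet> t))) = exp (- (pi * (y \<bullet> t)))"
          by (simp flip: exp_add)
        also have "C * exp (- (pi * (y \<bullet> t))) \<le> C * exp (- (pi * c * norm t))"
          using c(2)[OF True] C by (intro mult_left_mono) (auto simp: mult.assoc)
        finally show ?thesis using C by simp
      qed (simp add: slice_transform_outside_dual[OF y])
    qed
  qed measurable
qed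

lemma slice_reconstruction:
  assumes y: "y \<in> \<Gamma>"
  shows "G (cpoint x y) = fourier (2 * pi) (slice_transform y) x"
proof -
  have "continuous_on UNIV (slice G y)"
    by (rule continuous_on_slice[OF hol]) (auto intro!: continuous_intros y)
  then have "isCont (slice G y) x"
    by (simp add: continuous_on_eq_continuous_at)
  from fourier_inversion[OF slice_integrable[OF y] this, of "2 * pi"] slice_transform_integrable[OF y]
  show ?thesis by simp
qed

text \<open>The conjugated kernel on the slice is a Fourier transform, so the multiplication formula
  moves the transform onto \<open>G\<close>. The kernel contributes a decay of height
  \<open>\<eta> + y0\<close>, and by the shift relation the transform at height
  \<open>\<eta>\<close> with this decay is the one at height \<open>y0 + (\<eta> + \<eta>)\<close>.
  Hence the value appears above \<open>z\<close>, displaced by twice the slice height.\<close>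

lemma H1_reproducing:
  assumes \<eta>: "\<eta> \<in> \<Gamma>" and z: "z \<in> tube \<Gamma>"
  shows "(LINT x|lborel. G (cpoint x \<eta>) * cnj (laplace \<Gamma> (\<lambda>_. 1) (cpoint x \<eta> - vcnj z))) = G (z + cpoint 0 (\<eta> + \<eta>))"
proof -
  define x0 y0 where "x0 = revec z" and "y0 = imvec z"
  have z_eq: "z = cpoint x0 y0" by (simp add: x0_def y0_def)
  have y0: "y0 \<in> \<Gamma>" using z by (simp add: z_eq)
  define f where "f t = indicator (dual_cone \<Gamma>) t *\<^sub>R ((1::complex) * planewave (cpoint x0 (\<eta> + y0)) t)" for t
  have fi: "integrable lborel f"
    unfolding f_def by (rule laplace_integrable[OF cone subexponential_const]) (simp add: open_cone_add[OF cone \<eta> y0])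
  have "cnj (laplace \<Gamma> (\<lambda>_. 1) (cpoint x \<eta> - vcnj z)) = fourier (- (2 * pi)) f x" for x
  proof -
    have "cpoint x \<eta> - vcnj z = cpoint (x - x0) (\<eta> + y0)" by (simp add: z_eq vec_eq_iff complex_eq_iff)
    moreover have "cnj (planewave (cpoint (x - x0) w) t) = planewave (cpoint x0 w) t * cis (- (2 * pi) * (x \<bullet> t))" for w t
      by (simp add: planewave_cpoint cis_cnj mult.assoc cis_mult inner_diff_left algebra_simps)
    ultimately show ?thesis
      unfolding laplace_def fourier_def f_def
      by (subst Bochner_Integration.integral_cnj[symmetric]) (simp add: mult.assoc scaleR_conv_of_real)
  qed
  then have "(LINT x|lborel. G (cpoint x \<eta>) * cnj (laplace \<Gamma> (\<lambda>_. 1) (cpoint x \<eta> - vcnj z))) =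
      (LINT x|lborel. G (cpoint x \<eta>) * fourier (- (2 * pi)) f x)" by simp
  also have "\<dots> = (LINT t|lborel. f t * slice_transform \<eta> t)"
    by (rule integral_mult_fourier[OF fi slice_integrable[OF \<eta>]])
  also have "\<dots> = (LINT t|lborel. slice_transform (y0 + (\<eta> + \<eta>)) t * cis (2 * pi * (x0 \<bullet> t)))"
  proof (intro Bochner_Integration.integral_cong refl)
    fix t
    have w: "y0 + (\<eta> + \<eta>) \<in> \<Gamma>" by (intro open_cone_add cone y0 \<eta>)
    show "f t * slice_transform \<eta> t = slice_transform (y0 + (\<eta> + \<eta>)) t * cis (2 * pi * (x0 \<bullet> t))"
    proof (cases "t \<in> dual_cone \<Gamma>")
      case True
      have "slice_transform (y0 + (\<eta> + \<eta>)) t = slice_transform (y0 + (\<eta> + \<eta>)) t * of_real (exp (2 * pi * ((y0 + (\<eta> + \<eta>)) \<bullet> t))) * of_real (exp (- (2 * pi * ((y0 + (\<eta> + \<eta>)) \<bullet> t))))"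
        by (simp add: mult.assoc flip: of_real_mult exp_add)
      also have "\<dots> = slice_transform \<eta> t * of_real (exp (2 * pi * (\<eta> \<bullet> t))) * of_real (exp (- (2 * pi * ((y0 + (\<eta> + \<eta>)) \<bullet> t))))"
        unfolding slice_transform_shift[OF w \<eta>] ..
      also have "\<dots> = slice_transform \<eta> t * of_real (exp (- (2 * pi * ((\<eta> + y0) \<bullet> t))))"
      proof -
        have "2 * pi * (\<eta> \<bullet> t) + - (2 * pi * ((y0 + (\<eta> + \<eta>)) \<bullet> t)) = - (2 * pi * ((\<eta> + y0) \<bullet> t))"
          unfolding inner_add_left by (simp add: algebra_simps)
        then show ?thesis unfolding mult.assoc of_real_mult[symmetric] exp_add[symmetric] by (simp only:)
      qed
      finally show ?thesis using True by (simp add: f_def planewave_cpoint)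
    next
      case False
      have "indicat_real (dual_cone \<Gamma>) t = 0" using False by simp
      then show ?thesis
        using slice_transform_outside_dual[OF w False] by (simp only: f_def scaleR_zero_left mult_zero_left)
    qed
  qed
  also have "\<dots> = G (cpoint x0 (y0 + (\<eta> + \<eta>)))"
    using slice_reconstruction[of "y0 + (\<eta> + \<eta>)" x0] open_cone_add[OF cone y0 open_cone_add[OF cone \<eta> \<eta>]]
    by (simp add: fourier_def)
  also have "cpoint x0 (y0 + (\<eta> + \<eta>)) = z + cpoint 0 (\<eta> + \<eta>)"
    by (simp add: z_eq vec_eq_iff complex_eq_iff)
  finally show ?thesis .
qed

end

section \<open>Damping: from integrable to square integrable slices\<close>

lemma laplace_one_imaginary:
  "laplace \<Gamma> (\<lambda>_. 1) (cpoint 0 v) = of_real (LINT t|lborel. indicator (dual_cone \<Gamma>) t * exp (- (2 * pi * (v \<bullet> t))))"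
  unfolding laplace_def integral_complex_of_real[symmetric]
  by (intro Bochner_Integration.integral_cong refl) (simp add: planewave_cpoint scaleR_conv_of_real)

text \<open>Regularity of the cone enters here: an open nonempty subset of the dual cone has
  positive measure, so the normalizing constant of the damping factors is not 0.\<close>

lemma laplace_one_pos:
  fixes \<Gamma> :: "(real^'n) set"
  assumes reg: "regular_cone \<Gamma>" and v: "v \<in> \<Gamma>"
  shows "0 < (LINT t|lborel. indicator (dual_cone \<Gamma>) t * exp (- (2 * pi * (v \<bullet> t))))"
    and "integrable lborel (\<lambda>t. indicator (dual_cone \<Gamma>) t * exp (- (2 * pi * (v \<bullet> t))))"
proof -
  let ?f = "\<lambda>t. indicator (dual_cone \<Gamma>) t * exp (- (2 * pi * (v \<bullet> t))) :: real"
  have cone: "open_cone \<Gamma>" using reg by (simp add: regular_cone_def)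
  have "integrable lborel (\<lambda>t. indicator (dual_cone \<Gamma>) t *\<^sub>R ((1::complex) * planewave (cpoint 0 v) t))"
    by (rule laplace_integrable[OF cone subexponential_const]) (simp add: v)
  then have "integrable lborel (\<lambda>t. complex_of_real (?f t))"
    by (simp add: planewave_cpoint scaleR_conv_of_real)
  then show i: "integrable lborel ?f" by (simp only: complex_of_real_integrable_eq)
  have "(LINT t|lborel. ?f t) \<noteq> 0"
  proof
    assume "(LINT t|lborel. ?f t) = 0"
    then have "AE t in lborel. ?f t = 0"
      by (subst (asm) integral_nonneg_eq_0_iff_AE[OF i]) auto
    then have "AE t in lborel. t \<notin> interior (dual_cone \<Gamma>)"
      by eventually_elim (use interior_subset in \<open>auto simp: indicator_def\<close>)
    then have "interior (dual_cone \<Gamma>) \<in> null_sets lborel"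
      by (subst (asm) AE_iff_null_sets[symmetric]) auto
    then have "negligible (interior (dual_cone \<Gamma>))"
      by (simp add: negligible_iff_null_sets null_sets_completionI)
    then show False using reg open_not_negligible[of "interior (dual_cone \<Gamma>)"] by (simp add: regular_cone_def)
  qed
  moreover have "0 \<le> (LINT t|lborel. ?f t)" by (intro integral_nonneg_AE) auto
  ultimately show "0 < (LINT t|lborel. ?f t)" by (metis order_le_less)
qed

text \<open>The damping factors \<open>L(z/n + iv) / L(iv)\<close> belong to the Hardy space, are bounded by 1 and
  tend to 1; multiplying by them turns \<open>L\<^sup>2\<close> slices into \<open>L\<^sup>1\<close> slices.\<close>

lemma damping_factors:
  fixes \<Gamma> :: "(real^'n) set"
  assumes reg: "regular_cone \<Gamma>"
  obtains R :: "nat \<Rightarrow> complex^'n \<Rightarrow> complex" where "\<And>n. R n \<in> hardy_space \<Gamma>"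
    "\<And>n w. w \<in> tube \<Gamma> \<Longrightarrow> norm (R n w) \<le> 1" "\<And>w. (\<lambda>n. R n w) \<longlonglongrightarrow> 1"
proof -
  have cone: "open_cone \<Gamma>" using reg by (simp add: regular_cone_def)
  obtain v where v: "v \<in> \<Gamma>" using cone by (auto simp: open_cone_def)
  \<comment> \<open>This is L(iv). A further height in the cone only decreases the integrand on the
    dual cone, so \<open>K\<close> bounds all values L(w/n + iv).\<close>
  define K where "K = (LINT t|lborel. indicator (dual_cone \<Gamma>) t * exp (- (2 * pi * (v \<bullet> t))))"
  have K: "K > 0" unfolding K_def by (rule laplace_one_pos[OF reg v])
  define R where "R n w = of_real (1 / K) * laplace \<Gamma> (\<lambda>_. 1) ((1 / real (Suc n)) *\<^sub>R w + cpoint 0 v)" for n and w :: "complex^'n"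
  have vt: "cpoint 0 v \<in> tube \<Gamma>" by (simp add: v)
  show ?thesis
  proof (rule that)
    show "R n \<in> hardy_space \<Gamma>" for n
      unfolding R_def by (intro hardy_space_cmult laplace_in_hardy_space[OF cone subexponential_const vt]) simp
    show "norm (R n w) \<le> 1" if w: "w \<in> tube \<Gamma>" for n w
    proof -
      let ?u = "(1 / real (Suc n)) *\<^sub>R w + cpoint 0 v"
      have im: "imvec ?u = (1 / real (Suc n)) *\<^sub>R imvec w + v" by (simp add: imvec_def vec_eq_iff)
      have "norm (laplace \<Gamma> (\<lambda>_. 1) ?u) \<le> (LINT t|lborel. norm (indicator (dual_cone \<Gamma>) t *\<^sub>R (1 * planewave ?u t)))"
        unfolding laplace_def by (rule integral_norm_bound)
      also have "\<dots> \<le> K"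
        unfolding K_def
      proof (rule integral_mono_AE'[OF laplace_one_pos(2)[OF reg v]])
        show "AE t in lborel. norm (indicator (dual_cone \<Gamma>) t *\<^sub>R (1 * planewave ?u t)) \<le> indicator (dual_cone \<Gamma>) t * exp (- (2 * pi * (v \<bullet> t)))" (is "AE t in _. ?P t")
        proof (rule AE_I2)
          fix t
          have "v \<bullet> t \<le> imvec ?u \<bullet> t" if "t \<in> dual_cone \<Gamma>"
          proof -
            have "0 \<le> (1 / real (Suc n)) * (imvec w \<bullet> t)"
              using dual_cone_nonneg[OF that] w by (simp add: mem_tube_iff)
            then show ?thesis by (simp only: im inner_add_left inner_scaleR_left)
          qed
          then show "?P t"
            by (cases "t \<in> dual_cone \<Gamma>") (simp_all add: norm_planewave)
        qed
      qed simp
      finally have "norm (laplace \<Gamma> (\<lambda>_. 1) ?u) \<le> K" .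
      moreover have "norm (R n w) = (1 / K) * norm (laplace \<Gamma> (\<lambda>_. 1) ?u)"
        using K by (simp only: R_def norm_mult norm_of_real) simp
      ultimately show ?thesis using K by simp
    qed
    show "(\<lambda>n. R n w) \<longlonglongrightarrow> 1" for w
    proof -
      have c: "isCont (laplace \<Gamma> (\<lambda>_. 1)) (cpoint 0 v)"
        using laplace_has_derivative(1)[OF cone subexponential_const vt] has_derivative_continuous by blast
      have "(\<lambda>n. (1 / real (Suc n)) *\<^sub>R w + cpoint 0 v) \<longlonglongrightarrow> 0 *\<^sub>R w + cpoint 0 v"
        by (intro tendsto_intros LIMSEQ_inverse_real_of_nat[unfolded inverse_eq_divide])
      then have "(\<lambda>n. (1 / real (Suc n)) *\<^sub>R w + cpoint 0 v) \<longlonglongrightarrow> cpoint 0 v" by simp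
      from isCont_tendsto_compose[OF c this]
      have "(\<lambda>n. R n w) \<longlonglongrightarrow> of_real (1 / K) * laplace \<Gamma> (\<lambda>_. 1) (cpoint 0 v)"
        unfolding R_def by (intro tendsto_intros)
      then show ?thesis using K by (simp add: laplace_one_imaginary K_def[symmetric])
    qed
  qed
qed

text \<open>\<open>F\<close> times a damping factor has uniformly integrable slices, so
  \<open>H1_reproducing\<close> holds for it. The factors are bounded by 1 and tend to 1, and
  dominated convergence removes them on the fixed slice.\<close>

lemma slice_reproducing:
  assumes reg: "regular_cone \<Gamma>" and F: "F \<in> hardy_space \<Gamma>" and \<eta>: "\<eta> \<in> \<Gamma>" and z: "z \<in> tube \<Gamma>"
  shows "(LINT x|lborel. F (cpoint x \<eta>) * cnj (laplace \<Gamma> (\<lambda>_. 1) (cpoint x \<eta> - vcnj z))) = F (z + cpoint 0 (\<eta> + \<eta>))"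
proof -
  have cone: "open_cone \<Gamma>" using reg by (simp add: regular_cone_def)
  obtain R :: "nat \<Rightarrow> complex^'a \<Rightarrow> complex" where R: "\<And>n. R n \<in> hardy_space \<Gamma>"
    "\<And>n w. w \<in> tube \<Gamma> \<Longrightarrow> norm (R n w) \<le> 1" "\<And>w. (\<lambda>n. R n w) \<longlonglongrightarrow> 1"
    using damping_factors[OF reg] by blast
  let ?k = "\<lambda>x. cnj (laplace \<Gamma> (\<lambda>_. 1) (cpoint x \<eta> - vcnj z))"
  have kH: "(\<lambda>w. laplace \<Gamma> (\<lambda>_. 1) (w - vcnj z)) \<in> hardy_space \<Gamma>"
    by (rule laplace_vcnj_in_hardy_space[OF cone z subexponential_const])
  note sF = square_integrable_slice[OF F \<eta>] and sk = square_integrable_slice[OF kH \<eta>]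
  note [measurable] = sF sk square_integrable_slice[OF R(1) \<eta>]
  have eq: "(LINT x|lborel. (F (cpoint x \<eta>) * R n (cpoint x \<eta>)) * ?k x) = F (z + cpoint 0 (\<eta> + \<eta>)) * R n (z + cpoint 0 (\<eta> + \<eta>))" for n
  proof (rule H1_reproducing[OF cone _ _ _ \<eta> z, where C="(hardy_norm \<Gamma> F)\<^sup>2 + (hardy_norm \<Gamma> (R n))\<^sup>2"])
    show "vec_holomorphic_on (\<lambda>w. F w * R n w) (tube \<Gamma>)"
      by (intro vec_holomorphic_on_mult hardy_space_holomorphic F R)
    fix y assume y: "y \<in> \<Gamma>"
    show "(\<integral>\<^sup>+x. norm (F (cpoint x y) * R n (cpoint x y)) \<partial>lborel) \<le> ennreal ((hardy_norm \<Gamma> F)\<^sup>2 + (hardy_norm \<Gamma> (R n))\<^sup>2)"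
      using nn_integral_slice_mult_le[OF F y R(1) y] by (simp add: norm_mult)
  qed simp
  have l1: "(\<lambda>n. LINT x|lborel. (F (cpoint x \<eta>) * R n (cpoint x \<eta>)) * ?k x) \<longlonglongrightarrow> (LINT x|lborel. F (cpoint x \<eta>) * ?k x)"
  proof (rule integral_dominated_convergence[where w="\<lambda>x. norm (F (cpoint x \<eta>) * ?k x)"])
    show "integrable lborel (\<lambda>x. norm (F (cpoint x \<eta>) * ?k x))"
      by (intro integrable_norm integrable_mult_cnj sF sk)
    show "AE x in lborel. (\<lambda>n. (F (cpoint x \<eta>) * R n (cpoint x \<eta>)) * ?k x) \<longlonglongrightarrow> F (cpoint x \<eta>) * ?k x" (is "AE x in _. ?P x")
    proof (rule AE_I2)
      fix x
      have "(\<lambda>n. (F (cpoint x \<eta>) * R n (cpoint x \<eta>)) * ?k x) \<longlonglongrightarrow> (F (cpoint x \<eta>) * 1) * ?k x"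
        by (intro tendsto_intros R)
      then show "?P x" by simp
    qed
    show "AE x in lborel. norm ((F (cpoint x \<eta>) * R n (cpoint x \<eta>)) * ?k x) \<le> norm (F (cpoint x \<eta>) * ?k x)" for n
      using R(2)[of "cpoint _ \<eta>" n] \<eta> by (intro AE_I2) (auto simp: norm_mult intro!: mult_right_mono mult_left_le)
  qed measurable
  have l2: "(\<lambda>n. F (z + cpoint 0 (\<eta> + \<eta>)) * R n (z + cpoint 0 (\<eta> + \<eta>))) \<longlonglongrightarrow> F (z + cpoint 0 (\<eta> + \<eta>)) * 1"
    by (intro tendsto_intros R)
  show ?thesis using LIMSEQ_unique[OF l1[unfolded eq] l2] by simp
qed

text \<open>As \<open>\<eta>\<close> tends to 0, the slice pairings tend to the inner product and
  the displaced values of \<open>F\<close> tend to \<open>F z\<close> by continuity.\<close>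

lemma hardy_reproducing:
  assumes reg: "regular_cone \<Gamma>" and F: "F \<in> hardy_space \<Gamma>" and z: "z \<in> tube \<Gamma>"
  shows "hardy_inner \<Gamma> F (\<lambda>w. szego_kernel \<Gamma> w z) = F z"
proof -
  have cone: "open_cone \<Gamma>" using reg by (simp add: regular_cone_def)
  have kH: "(\<lambda>w. szego_kernel \<Gamma> w z) \<in> hardy_space \<Gamma>"
    unfolding szego_kernel_eq_laplace by (rule laplace_vcnj_in_hardy_space[OF cone z subexponential_const])
  have contz: "isCont F z"
    using hardy_space_holomorphic[OF F] z has_derivative_continuous unfolding vec_holomorphic_on_def by blast
  have "continuous_on UNIV (\<lambda>\<eta>. z + cpoint 0 (\<eta> + \<eta>))" by (intro continuous_intros)
  then have "((\<lambda>\<eta>. z + cpoint 0 (\<eta> + \<eta>)) \<longlongrightarrow> z + cpoint 0 (0 + 0)) (at 0)"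
    unfolding continuous_on_def by (rule bspec) (rule UNIV_I)
  moreover have "z + cpoint 0 (0 + 0) = z" by (simp add: vec_eq_iff complex_eq_iff)
  ultimately have "((\<lambda>\<eta>. z + cpoint 0 (\<eta> + \<eta>)) \<longlongrightarrow> z) (at 0 within \<Gamma>)"
    using tendsto_within_subset by (metis subset_UNIV)
  from isCont_tendsto_compose[OF contz this]
  have lim: "((\<lambda>\<eta>. F (z + cpoint 0 (\<eta> + \<eta>))) \<longlongrightarrow> F z) (at 0 within \<Gamma>)" .
  have "((\<lambda>\<eta>. LINT x|lborel. F (cpoint x \<eta>) * cnj (szego_kernel \<Gamma> (cpoint x \<eta>) z)) \<longlongrightarrow> F z) (at 0 within \<Gamma>)"
  proof (rule Lim_transform_eventually[OF lim])
    have "\<forall>\<^sub>F \<eta> in at 0 within \<Gamma>. \<eta> \<in> \<Gamma>" by (auto simp: eventually_at intro: exI[of _ 1])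
    then show "\<forall>\<^sub>F \<eta> in at 0 within \<Gamma>. F (z + cpoint 0 (\<eta> + \<eta>)) = (LINT x|lborel. F (cpoint x \<eta>) * cnj (szego_kernel \<Gamma> (cpoint x \<eta>) z))"
      by eventually_elim (simp add: szego_kernel_eq_laplace slice_reproducing[OF reg F _ z])
  qed
  from tendsto_unique[OF trivial_limit_at_0_within_cone[OF cone] hardy_inner_tendsto[OF cone F kH] this]
  show ?thesis .
qed

subsection \<open>Gram-Schmidt orthonormalization\<close>

context
  fixes \<Gamma> :: "(real^'n) set"
  assumes cone: "open_cone \<Gamma>"
begin

lemma hardy_inner_zero_left: "F \<in> hardy_space \<Gamma> \<Longrightarrow> hardy_inner \<Gamma> (\<lambda>w. 0) F = 0"
  using hardy_inner_add_cmult[OF cone zero_in_hardy_space zero_in_hardy_space, of F "-1"] by simp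

lemma hardy_inner_zero_right: "F \<in> hardy_space \<Gamma> \<Longrightarrow> hardy_inner \<Gamma> F (\<lambda>w. 0) = 0"
  using hardy_inner_commute[of \<Gamma> F "\<lambda>w. 0"] hardy_inner_zero_left by simp

lemma hardy_space_diff: "F \<in> hardy_space \<Gamma> \<Longrightarrow> G \<in> hardy_space \<Gamma> \<Longrightarrow> (\<lambda>w. F w - G w) \<in> hardy_space \<Gamma>"
  using hardy_space_add_cmult[of F \<Gamma> G "-1"] by simp

lemma hardy_inner_diff_left:
  "F \<in> hardy_space \<Gamma> \<Longrightarrow> G \<in> hardy_space \<Gamma> \<Longrightarrow> H \<in> hardy_space \<Gamma> \<Longrightarrow>
    hardy_inner \<Gamma> (\<lambda>w. F w - G w) H = hardy_inner \<Gamma> F H - hardy_inner \<Gamma> G H"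
  using hardy_inner_add_cmult[OF cone, of F G H "-1"] by simp

lemma hardy_inner_cmult_left:
  "G \<in> hardy_space \<Gamma> \<Longrightarrow> H \<in> hardy_space \<Gamma> \<Longrightarrow> hardy_inner \<Gamma> (\<lambda>w. c * G w) H = c * hardy_inner \<Gamma> G H"
  using hardy_inner_add_cmult[OF cone zero_in_hardy_space, of G H c] hardy_inner_zero_left by simp

lemma hardy_inner_diff_right:
  "F \<in> hardy_space \<Gamma> \<Longrightarrow> G \<in> hardy_space \<Gamma> \<Longrightarrow> H \<in> hardy_space \<Gamma> \<Longrightarrow>
    hardy_inner \<Gamma> H (\<lambda>w. F w - G w) = hardy_inner \<Gamma> H F - hardy_inner \<Gamma> H G"
  using hardy_inner_diff_left[of F G H] by (simp add: hardy_inner_commute[of \<Gamma> H])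

lemma hardy_inner_cmult_right:
  "G \<in> hardy_space \<Gamma> \<Longrightarrow> H \<in> hardy_space \<Gamma> \<Longrightarrow> hardy_inner \<Gamma> H (\<lambda>w. c * G w) = cnj c * hardy_inner \<Gamma> H G"
  using hardy_inner_cmult_left[of G H c] by (simp add: hardy_inner_commute[of \<Gamma> H])

lemma hardy_space_sum:
  assumes "\<And>i. i < (m::nat) \<Longrightarrow> f i \<in> hardy_space \<Gamma>"
  shows "(\<lambda>w. \<Sum>i<m. c i * f i w) \<in> hardy_space \<Gamma>"
  using assms
proof (induction m)
  case 0 then show ?case by (simp add: zero_in_hardy_space)
next
  case (Suc m) then show ?case by (simp add: hardy_space_add_cmult)
qed

lemma hardy_inner_sum_left:
  assumes "\<And>i. i < (m::nat) \<Longrightarrow> f i \<in> hardy_space \<Gamma>" "H \<in> hardy_space \<Gamma>"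
  shows "hardy_inner \<Gamma> (\<lambda>w. \<Sum>i<m. c i * f i w) H = (\<Sum>i<m. c i * hardy_inner \<Gamma> (f i) H)"
  using assms(1)
proof (induction m)
  case 0 then show ?case by (simp add: hardy_inner_zero_left assms)
next
  case (Suc m)
  have "(\<lambda>w. \<Sum>i<m. c i * f i w) \<in> hardy_space \<Gamma>" by (rule hardy_space_sum) (use Suc in simp)
  from hardy_inner_add_cmult[OF cone this Suc.prems[OF lessI] assms(2), of "c m"] Suc show ?case by simp
qed

lemma hardy_inner_sum_right:
  assumes "\<And>i. i < (m::nat) \<Longrightarrow> f i \<in> hardy_space \<Gamma>" "H \<in> hardy_space \<Gamma>"
  shows "hardy_inner \<Gamma> H (\<lambda>w. \<Sum>i<m. c i * f i w) = (\<Sum>i<m. cnj (c i) * hardy_inner \<Gamma> H (f i))"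
  using hardy_inner_sum_left[OF assms, where c=c] by (simp add: hardy_inner_commute[of \<Gamma> H])

lemma hardy_norm_square_eq_inner:
  "F \<in> hardy_space \<Gamma> \<Longrightarrow> (hardy_norm \<Gamma> F)\<^sup>2 = Re (hardy_inner \<Gamma> F F)"
  by (simp add: hardy_inner_self[OF cone])

lemma hardy_inner_Cauchy_Schwarz:
  assumes F: "F \<in> hardy_space \<Gamma>" and G: "G \<in> hardy_space \<Gamma>"
  shows "norm (hardy_inner \<Gamma> F G) \<le> hardy_norm \<Gamma> F * hardy_norm \<Gamma> G"
proof (rule tendsto_le[OF trivial_limit_at_0_within_cone[OF cone] tendsto_const tendsto_norm[OF hardy_inner_tendsto[OF cone F G]]])
  have "\<forall>\<^sub>F \<eta> in at 0 within \<Gamma>. \<eta> \<in> \<Gamma>" by (auto simp: eventually_at intro: exI[of _ 1])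
  then show "\<forall>\<^sub>F \<eta> in at 0 within \<Gamma>. norm (LINT x|lborel. F (cpoint x \<eta>) * cnj (G (cpoint x \<eta>))) \<le> hardy_norm \<Gamma> F * hardy_norm \<Gamma> G"
  proof eventually_elim
    case (elim \<eta>)
    have "(norm (LINT x|lborel. F (cpoint x \<eta>) * cnj (G (cpoint x \<eta>))))\<^sup>2 \<le>
      (energy (slice F \<eta>)) * energy (slice G \<eta>)"
      by (intro Cauchy_Schwarz_integral square_integrable_slice[OF F] square_integrable_slice[OF G] elim)
    also have "\<dots> \<le> (hardy_norm \<Gamma> F)\<^sup>2 * (hardy_norm \<Gamma> G)\<^sup>2"
      by (intro mult_mono hardy_slice_le F G elim integral_nonneg_AE) auto
    also have "\<dots> = (hardy_norm \<Gamma> F * hardy_norm \<Gamma> G)\<^sup>2" by (simp add: power_mult_distrib)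
    finally show ?case by (rule power2_le_imp_le) simp
  qed
qed

lemma gram_schmidt_in_hardy_space:
  assumes "\<And>j. j \<le> k \<Longrightarrow> f j \<in> hardy_space \<Gamma>"
  shows "gram_schmidt \<Gamma> f k \<in> hardy_space \<Gamma>"
  using assms
proof (induction k rule: less_induct)
  case (less k)
  let ?g = "\<lambda>w. f k w - (\<Sum>j<k. hardy_inner \<Gamma> (f k) (gram_schmidt \<Gamma> f j) * gram_schmidt \<Gamma> f j w)"
  have "?g \<in> hardy_space \<Gamma>"
    using less by (intro hardy_space_diff hardy_space_sum) auto
  from hardy_space_cmult[OF this, of "1 / of_real (hardy_norm \<Gamma> ?g)"]
  show ?case by (subst gram_schmidt.simps) simp
qed

text \<open>A vanishing Gram-Schmidt remainder is divided by 0, so the corresponding element is the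
  zero function; hence norms are 0 or 1 in general.\<close>

lemma gram_schmidt_orthonormal:
  assumes f: "\<And>j. f j \<in> hardy_space \<Gamma>"
  shows "(\<forall>j<k. hardy_inner \<Gamma> (gram_schmidt \<Gamma> f k) (gram_schmidt \<Gamma> f j) = 0) \<and>
    (hardy_norm \<Gamma> (gram_schmidt \<Gamma> f k) = 1 \<or> gram_schmidt \<Gamma> f k = (\<lambda>w. 0))"
proof (induction k rule: less_induct)
  case (less k)
  let ?e = "gram_schmidt \<Gamma> f"
  have eH: "?e j \<in> hardy_space \<Gamma>" for j by (rule gram_schmidt_in_hardy_space) (rule f)
  have orth: "hardy_inner \<Gamma> (?e i) (?e j) = 0" if "i < k" "j < k" "i \<noteq> j" for i j
    using less[of i] less[of j] that hardy_inner_commute[of \<Gamma> "?e i" "?e j"]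
    by (cases "i < j") auto
  \<comment> \<open>Either the squared norm of the element is 1, or the element is the zero function
    and both sides vanish.\<close>
  have proj: "hardy_inner \<Gamma> F (?e j) * hardy_inner \<Gamma> (?e j) (?e j) = hardy_inner \<Gamma> F (?e j)" if "j < k" "F \<in> hardy_space \<Gamma>" for F j
    using less[OF that(1)] that(2) hardy_inner_self[OF cone eH[of j]] by (auto simp: hardy_inner_zero_right)
  define g where "g = (\<lambda>w. f k w - (\<Sum>j<k. hardy_inner \<Gamma> (f k) (?e j) * ?e j w))"
  have gH: "g \<in> hardy_space \<Gamma>" unfolding g_def by (intro hardy_space_diff hardy_space_sum f eH)
  have e_eq: "?e k = (\<lambda>w. (1 / of_real (hardy_norm \<Gamma> g)) * g w)"
    by (subst gram_schmidt.simps) (simp add: g_def)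
  have gorth: "hardy_inner \<Gamma> g (?e j) = 0" if j: "j < k" for j
  proof -
    have "hardy_inner \<Gamma> g (?e j) = hardy_inner \<Gamma> (f k) (?e j) - (\<Sum>i<k. hardy_inner \<Gamma> (f k) (?e i) * hardy_inner \<Gamma> (?e i) (?e j))"
      unfolding g_def by (simp add: hardy_inner_diff_left hardy_space_sum hardy_inner_sum_left f eH)
    also have "(\<Sum>i<k. hardy_inner \<Gamma> (f k) (?e i) * hardy_inner \<Gamma> (?e i) (?e j)) = (\<Sum>i<k. if i = j then hardy_inner \<Gamma> (f k) (?e j) else 0)"
      using orth[OF _ j] proj[OF j f] by (intro sum.cong) auto
    also have "\<dots> = hardy_inner \<Gamma> (f k) (?e j)" using j by simp
    finally show ?thesis by simp
  qed
  have "hardy_inner \<Gamma> (?e k) (?e j) = 0" if "j < k" for j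
    unfolding e_eq hardy_inner_cmult_left[OF gH eH] gorth[OF that] by simp
  moreover have "hardy_norm \<Gamma> (?e k) = 1 \<or> ?e k = (\<lambda>w. 0)"
  proof (cases "hardy_norm \<Gamma> g = 0")
    case True then show ?thesis unfolding e_eq by simp
  next
    case False
    have "hardy_inner \<Gamma> (\<lambda>w. c * g w) (\<lambda>w. c * g w) = c * (cnj c * of_real ((hardy_norm \<Gamma> g)\<^sup>2))" for c
      unfolding hardy_inner_cmult_left[OF gH hardy_space_cmult[OF gH]] hardy_inner_cmult_right[OF gH gH] hardy_inner_self[OF cone gH] ..
    then have "hardy_inner \<Gamma> (?e k) (?e k) = 1"
      unfolding e_eq using False by (simp only:) (simp add: power2_eq_square)
    then have "(hardy_norm \<Gamma> (?e k))\<^sup>2 = 1"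
      using hardy_norm_square_eq_inner[OF eH[of k]] by simp
    then show ?thesis by (simp add: power2_eq_1_iff) (smt (verit) hardy_norm_nonneg)
  qed
  ultimately show ?case by blast
qed

end

subsection \<open>Convergence under maximal selection\<close>

locale maximal_selection_setting =
  fixes \<Gamma> :: "(real^'n) set" and d :: "complex^'n" and F :: "complex^'n \<Rightarrow> complex" and z :: "nat \<Rightarrow> complex^'n"
  assumes reg: "regular_cone \<Gamma>" and F: "F \<in> hardy_space \<Gamma>" and sel: "maximal_selection \<Gamma> d F z"
begin

lemma cone: "open_cone \<Gamma>"
  using reg by (simp add: regular_cone_def)

lemma z_mem: "z m \<in> tube \<Gamma>"
  using sel by (simp add: maximal_selection_def)

abbreviation B :: "nat \<Rightarrow> complex^'n \<Rightarrow> complex" where "B \<equiv> onsys \<Gamma> d z"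

lemma kernel_in_hardy_space: "multiple_kernel \<Gamma> d z k \<in> hardy_space \<Gamma>"
  by (rule multiple_kernel_in_hardy_space[OF cone z_mem])

lemma B_in_hardy_space: "B k \<in> hardy_space \<Gamma>"
  unfolding onsys_def by (rule gram_schmidt_in_hardy_space[OF cone kernel_in_hardy_space])

lemma B_orthogonal: "i \<noteq> j \<Longrightarrow> hardy_inner \<Gamma> (B i) (B j) = 0"
proof (induction i j rule: linorder_wlog)
  case (le i j)
  then have "hardy_inner \<Gamma> (B j) (B i) = 0"
    using gram_schmidt_orthonormal[OF cone, of "multiple_kernel \<Gamma> d z" j, OF kernel_in_hardy_space] unfolding onsys_def by auto
  then show ?case using hardy_inner_commute[of \<Gamma> "B i" "B j"] by simp
next
  case (sym i j)
  then show ?case using hardy_inner_commute[of \<Gamma> "B i" "B j"] by simp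
qed

lemma B_norm: "hardy_norm \<Gamma> (B k) = 1 \<or> B k = (\<lambda>w. 0)"
  using gram_schmidt_orthonormal[OF cone, of "multiple_kernel \<Gamma> d z" k, OF kernel_in_hardy_space] unfolding onsys_def by blast

text \<open>Replaces normalization in the computations below, as it covers a vanishing
  \<open>B j\<close> too.\<close>

lemma B_projection: "G \<in> hardy_space \<Gamma> \<Longrightarrow> hardy_inner \<Gamma> G (B j) * hardy_inner \<Gamma> (B j) (B j) = hardy_inner \<Gamma> G (B j)"
  using B_norm[of j] hardy_inner_self[OF cone B_in_hardy_space[of j]] by (auto simp: hardy_inner_zero_right[OF cone])

text \<open>A general \<open>G\<close> is allowed because the kernels are projected as well: their
  residuals are the unnormalized Gram-Schmidt remainders.\<close>

definition residual :: "(complex^'n \<Rightarrow> complex) \<Rightarrow> nat \<Rightarrow> complex^'n \<Rightarrow> complex" where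
  "residual G m = (\<lambda>w. G w - (\<Sum>k<m. hardy_inner \<Gamma> G (B k) * B k w))"

lemma residual_in_hardy_space: "G \<in> hardy_space \<Gamma> \<Longrightarrow> residual G m \<in> hardy_space \<Gamma>"
  unfolding residual_def by (intro hardy_space_diff hardy_space_sum cone B_in_hardy_space)

lemma residual_inner_B:
  assumes G: "G \<in> hardy_space \<Gamma>"
  shows "hardy_inner \<Gamma> (residual G m) (B j) = (if j < m then 0 else hardy_inner \<Gamma> G (B j))"
proof -
  have "hardy_inner \<Gamma> (residual G m) (B j) = hardy_inner \<Gamma> G (B j) - (\<Sum>k<m. hardy_inner \<Gamma> G (B k) * hardy_inner \<Gamma> (B k) (B j))"
    unfolding residual_def
    by (simp add: hardy_inner_diff_left[OF cone] hardy_space_sum[OF cone] hardy_inner_sum_left[OF cone] G B_in_hardy_space)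
  also have "(\<Sum>k<m. hardy_inner \<Gamma> G (B k) * hardy_inner \<Gamma> (B k) (B j)) = (\<Sum>k<m. if k = j then hardy_inner \<Gamma> G (B j) else 0)"
    using B_orthogonal[of _ j] B_projection[OF G, of j] by (intro sum.cong) auto
  finally show ?thesis by simp
qed

text \<open>Taking residuals is the orthogonal projection onto the complement of the first
  \<open>m\<close> elements; these are its idempotence and self-adjointness.\<close>

lemma inner_residual:
  assumes G: "G \<in> hardy_space \<Gamma>" and H: "H \<in> hardy_space \<Gamma>"
  shows "hardy_inner \<Gamma> (residual G m) (residual H m) = hardy_inner \<Gamma> (residual G m) H"
    and "hardy_inner \<Gamma> G (residual H m) = hardy_inner \<Gamma> (residual G m) H"
proof -
  note mem = residual_in_hardy_space[OF G] B_in_hardy_space G H hardy_space_sum[OF cone]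
  have "hardy_inner \<Gamma> (residual G m) (residual H m) =
    hardy_inner \<Gamma> (residual G m) H - (\<Sum>k<m. cnj (hardy_inner \<Gamma> H (B k)) * hardy_inner \<Gamma> (residual G m) (B k))"
    unfolding residual_def[of H]
    by (simp add: hardy_inner_diff_right[OF cone] hardy_inner_sum_right[OF cone] mem)
  then show "hardy_inner \<Gamma> (residual G m) (residual H m) = hardy_inner \<Gamma> (residual G m) H"
    by (simp add: residual_inner_B[OF G])
  have "hardy_inner \<Gamma> G (residual H m) = hardy_inner \<Gamma> G H - (\<Sum>k<m. cnj (hardy_inner \<Gamma> H (B k)) * hardy_inner \<Gamma> G (B k))"
    unfolding residual_def[of H]
    by (simp add: hardy_inner_diff_right[OF cone] hardy_inner_sum_right[OF cone] mem)
  moreover have "hardy_inner \<Gamma> (residual G m) H = hardy_inner \<Gamma> G H - (\<Sum>k<m. hardy_inner \<Gamma> G (B k) * hardy_inner \<Gamma> (B k) H)"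
    unfolding residual_def
    by (simp add: hardy_inner_diff_left[OF cone] hardy_inner_sum_left[OF cone] mem)
  ultimately show "hardy_inner \<Gamma> G (residual H m) = hardy_inner \<Gamma> (residual G m) H"
    by (simp add: hardy_inner_commute[of \<Gamma> _ H] mult.commute)
qed

abbreviation coef :: "nat \<Rightarrow> complex" where "coef k \<equiv> hardy_inner \<Gamma> F (B k)"

lemma residual_norm_diff:
  assumes "m \<le> k"
  shows "(hardy_norm \<Gamma> (\<lambda>w. residual F m w - residual F k w))\<^sup>2 = (\<Sum>j=m..<k. (norm (coef j))\<^sup>2)"
proof -
  \<comment> \<open>Coefficients below \<open>m\<close> are padded with 0, which brings the sum into
    the form over \<open>{..<k}\<close> of the sum lemmas.\<close>
  have eq: "(\<lambda>w. residual F m w - residual F k w) = (\<lambda>w. \<Sum>j<k. (if m \<le> j then coef j else 0) * B j w)"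
  proof
    fix w
    have "(\<Sum>j<k. coef j * B j w) = (\<Sum>j<m. coef j * B j w) + (\<Sum>j=m..<k. coef j * B j w)"
      using sum.atLeastLessThan_concat[of 0 m k "\<lambda>j. coef j * B j w"] assms by (simp add: atLeast0LessThan)
    moreover have "(\<Sum>j<k. (if m \<le> j then coef j else 0) * B j w) = (\<Sum>j=m..<k. coef j * B j w)"
      by (rule sum.mono_neutral_cong_right) auto
    ultimately show "residual F m w - residual F k w = (\<Sum>j<k. (if m \<le> j then coef j else 0) * B j w)"
      by (simp add: residual_def)
  qed
  define c where "c j = (if m \<le> j then coef j else 0)" for j
  define S where "S = (\<lambda>w. \<Sum>j<k. c j * B j w)"
  have S: "S \<in> hardy_space \<Gamma>" unfolding S_def by (intro hardy_space_sum cone B_in_hardy_space)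
  have SB: "hardy_inner \<Gamma> S (B i) = c i" if "i < k" for i
  proof -
    have "hardy_inner \<Gamma> S (B i) = (\<Sum>j<k. c j * hardy_inner \<Gamma> (B j) (B i))"
      unfolding S_def by (rule hardy_inner_sum_left[OF cone]) (rule B_in_hardy_space)+
    also have "\<dots> = (\<Sum>j<k. if j = i then c i else 0)"
      using B_orthogonal[of _ i] B_projection[OF F, of i] by (intro sum.cong) (auto simp: c_def)
    finally show ?thesis using that by simp
  qed
  have "hardy_inner \<Gamma> S S = (\<Sum>j<k. cnj (c j) * hardy_inner \<Gamma> S (B j))"
    by (subst (2) S_def, rule hardy_inner_sum_right[OF cone]) (rule B_in_hardy_space S)+
  also have "\<dots> = (\<Sum>j<k. of_real ((norm (c j))\<^sup>2))"
    by (intro sum.cong refl) (simp add: SB complex_norm_square mult.commute del: of_real_power)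
  also have "\<dots> = of_real (\<Sum>j<k. (norm (c j))\<^sup>2)" by simp
  also have "(\<Sum>j<k. (norm (c j))\<^sup>2) = (\<Sum>j=m..<k. (norm (coef j))\<^sup>2)"
    by (rule sum.mono_neutral_cong_right) (auto simp: c_def)
  finally have "hardy_inner \<Gamma> S S = of_real (\<Sum>j=m..<k. (norm (coef j))\<^sup>2)" .
  then show ?thesis
    unfolding eq c_def[symmetric] S_def[symmetric] hardy_norm_square_eq_inner[OF cone S] by simp
qed

text \<open>Bessel's inequality, from Pythagoras: the partial sum \<open>F - residual F m\<close> is
  orthogonal to the residual.\<close>

lemma coef_bound: "(\<Sum>j<m. (norm (coef j))\<^sup>2) \<le> (hardy_norm \<Gamma> F)\<^sup>2"
proof -
  have "residual F 0 = F" by (simp add: residual_def)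
  then have "(\<Sum>j<m. (norm (coef j))\<^sup>2) = (hardy_norm \<Gamma> (\<lambda>w. F w - residual F m w))\<^sup>2"
    using residual_norm_diff[of 0 m] by (simp add: atLeast0LessThan)
  moreover have "(hardy_norm \<Gamma> (\<lambda>w. F w - residual F m w))\<^sup>2 = (hardy_norm \<Gamma> F)\<^sup>2 - (hardy_norm \<Gamma> (residual F m))\<^sup>2"
  proof -
    note mem = F residual_in_hardy_space[OF F] hardy_space_diff[OF cone F residual_in_hardy_space[OF F]]
    have "hardy_inner \<Gamma> (\<lambda>w. F w - residual F m w) (\<lambda>w. F w - residual F m w) =
       hardy_inner \<Gamma> F F - hardy_inner \<Gamma> F (residual F m) - (hardy_inner \<Gamma> (residual F m) F - hardy_inner \<Gamma> (residual F m) (residual F m))"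
      using mem by (simp add: hardy_inner_diff_left[OF cone] hardy_inner_diff_right[OF cone])
    also have "\<dots> = hardy_inner \<Gamma> F F - hardy_inner \<Gamma> (residual F m) (residual F m)"
      using inner_residual[OF F F, of m] by simp
    finally show ?thesis
      by (simp add: hardy_norm_square_eq_inner[OF cone] mem)
  qed
  ultimately show ?thesis by simp
qed

lemma coef_summable: "summable (\<lambda>j. (norm (coef j))\<^sup>2)"
  by (rule summableI_nonneg_bounded[OF _ coef_bound]) simp

text \<open>Orthonormalizing a second time changes nothing, so selecting \<open>z m\<close> in
  \<open>onsys_next\<close> reproduces the element \<open>B m\<close>. This identifies the maximum
  in the selection principle with the modulus of \<open>coef m\<close>.\<close>

lemma onsys_next_self: "onsys_next \<Gamma> d z m (z m) = B m"
  and gram_schmidt_B: "k < m \<Longrightarrow> gram_schmidt \<Gamma> (\<lambda>k. if k < m then B k else h k) k = B k"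
proof -
  have fix_B: "gram_schmidt \<Gamma> (\<lambda>k. if k < m then B k else h k) k = B k" if "k < m" for k h
    using that
  proof (induction k rule: less_induct)
    case (less k)
    let ?f = "\<lambda>k. if k < m then B k else h k"
    have "(\<Sum>j<k. hardy_inner \<Gamma> (?f k) (gram_schmidt \<Gamma> ?f j) * gram_schmidt \<Gamma> ?f j w) = 0" for w
      using less B_orthogonal by (intro sum.neutral) auto
    then have "gram_schmidt \<Gamma> ?f k = (\<lambda>w. B k w / of_real (hardy_norm \<Gamma> (B k)))"
      using less.prems by (subst gram_schmidt.simps) (simp add: Let_def)
    \<comment> \<open>If \<open>B k\<close> is the zero function, the quotient is 0/0, which is
      again 0.\<close>
    also have "\<dots> = B k" using B_norm[of k] by auto
    finally show ?case .
  qed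
  show "k < m \<Longrightarrow> gram_schmidt \<Gamma> (\<lambda>k. if k < m then B k else h k) k = B k" by (rule fix_B)
  have "gram_schmidt \<Gamma> (\<lambda>k. if k < m then B k else multiple_kernel \<Gamma> d z m) m = gram_schmidt \<Gamma> (multiple_kernel \<Gamma> d z) m"
    using fix_B[of _ "\<lambda>_. multiple_kernel \<Gamma> d z m"]
    by (subst (1 2) gram_schmidt.simps) (simp add: Let_def onsys_def)
  then show "onsys_next \<Gamma> d z m (z m) = B m"
    unfolding onsys_next_def fun_upd_triv by (rule trans) (simp only: onsys_def)
qed

text \<open>A new point occurs exactly once, so the order of the derivative is 1 - 1 = 0.\<close>

lemma multiple_kernel_fresh:
  assumes "\<zeta> \<notin> range z"
  shows "multiple_kernel \<Gamma> d (z(m := \<zeta>)) m = (\<lambda>w. szego_kernel \<Gamma> w \<zeta>)"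
proof -
  have "{j. j \<le> m \<and> (z(m := \<zeta>)) j = (z(m := \<zeta>)) m} = {m}"
    using assms by auto
  then show ?thesis by (simp add: multiple_kernel_def occurrences_def)
qed

text \<open>Testing the maximality of \<open>z m\<close> against a point \<open>\<zeta>\<close> that does not occur in the sequence
  bounds the value of the residual at \<open>\<zeta>\<close>, because that value is the inner product with the kernel at \<open>\<zeta>\<close>.\<close>

lemma residual_pointwise_le:
  assumes \<zeta>: "\<zeta> \<in> tube \<Gamma>" "\<zeta> \<notin> range z"
  shows "norm (residual F m \<zeta>) \<le> norm (coef m) * hardy_norm \<Gamma> (\<lambda>w. szego_kernel \<Gamma> w \<zeta>)"
proof -
  let ?\<phi> = "\<lambda>w. szego_kernel \<Gamma> w \<zeta>"
  have \<phi>: "?\<phi> \<in> hardy_space \<Gamma>"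
    unfolding szego_kernel_eq_laplace by (rule laplace_vcnj_in_hardy_space[OF cone \<zeta>(1) subexponential_const])
  let ?g = "residual ?\<phi> m"
  have g: "?g \<in> hardy_space \<Gamma>" by (rule residual_in_hardy_space[OF \<phi>])
  have next_eq: "onsys_next \<Gamma> d z m \<zeta> = (\<lambda>w. (1 / of_real (hardy_norm \<Gamma> ?g)) * ?g w)"
    unfolding onsys_next_def multiple_kernel_fresh[OF \<zeta>(2)]
    using gram_schmidt_B[of _ m "\<lambda>_. ?\<phi>"]
    by (subst gram_schmidt.simps) (simp add: Let_def residual_def)
  have "residual F m \<zeta> = hardy_inner \<Gamma> (residual F m) ?\<phi>"
    by (rule hardy_reproducing[OF reg residual_in_hardy_space[OF F] \<zeta>(1), symmetric])
  also have "\<dots> = hardy_inner \<Gamma> F ?g" by (rule inner_residual(2)[OF F \<phi>, symmetric])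
  finally have val: "residual F m \<zeta> = hardy_inner \<Gamma> F ?g" .
  \<comment> \<open>A projection does not increase the norm; its idempotence turns Cauchy-Schwarz
    into this bound.\<close>
  have gle: "hardy_norm \<Gamma> ?g \<le> hardy_norm \<Gamma> ?\<phi>"
  proof (cases "hardy_norm \<Gamma> ?g = 0")
    case False
    have "hardy_inner \<Gamma> ?g ?\<phi> = of_real ((hardy_norm \<Gamma> ?g)\<^sup>2)"
      by (rule trans[OF inner_residual(1)[OF \<phi> \<phi>, symmetric] hardy_inner_self[OF cone g]])
    then have "(hardy_norm \<Gamma> ?g)\<^sup>2 = norm (hardy_inner \<Gamma> ?g ?\<phi>)"
      by (simp only: norm_of_real) simp
    also have "\<dots> \<le> hardy_norm \<Gamma> ?g * hardy_norm \<Gamma> ?\<phi>" by (rule hardy_inner_Cauchy_Schwarz[OF cone g \<phi>])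
    finally show ?thesis using False hardy_norm_nonneg[of \<Gamma> ?g] by (simp add: power2_eq_square)
  qed simp
  show ?thesis
  proof (cases "hardy_norm \<Gamma> ?g = 0")
    \<comment> \<open>Here \<open>onsys_next\<close> is the zero function and maximality says
      nothing, but Cauchy-Schwarz already forces the residual to vanish at
      \<open>\<zeta>\<close>.\<close>
    case True
    then have "norm (residual F m \<zeta>) \<le> 0"
      using hardy_inner_Cauchy_Schwarz[OF cone F g] val by simp
    then show ?thesis using order_trans[OF _ mult_nonneg_nonneg] by force
  next
    case False
    have "hardy_inner \<Gamma> F (onsys_next \<Gamma> d z m \<zeta>) = (1 / of_real (hardy_norm \<Gamma> ?g)) * hardy_inner \<Gamma> F ?g"
      unfolding next_eq hardy_inner_cmult_right[OF cone g F] by simp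
    then have "hardy_inner \<Gamma> F ?g = of_real (hardy_norm \<Gamma> ?g) * hardy_inner \<Gamma> F (onsys_next \<Gamma> d z m \<zeta>)"
      using False by simp
    then have "norm (residual F m \<zeta>) = hardy_norm \<Gamma> ?g * norm (hardy_inner \<Gamma> F (onsys_next \<Gamma> d z m \<zeta>))"
      unfolding val by (simp add: norm_mult)
    also have "\<dots> \<le> hardy_norm \<Gamma> ?\<phi> * norm (coef m)"
    proof (rule mult_mono[OF gle])
      have "norm (hardy_inner \<Gamma> F (onsys_next \<Gamma> d z m \<zeta>)) \<le> norm (hardy_inner \<Gamma> F (onsys_next \<Gamma> d z m (z m)))"
        using sel \<zeta>(1) unfolding maximal_selection_def by blast
      then show "norm (hardy_inner \<Gamma> F (onsys_next \<Gamma> d z m \<zeta>)) \<le> norm (coef m)"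
        unfolding onsys_next_self .
    qed simp_all
    finally show ?thesis by (simp add: mult.commute)
  qed
qed

lemma residual_tendsto_0:
  assumes "\<zeta> \<in> tube \<Gamma>" "\<zeta> \<notin> range z"
  shows "(\<lambda>m. residual F m \<zeta>) \<longlonglongrightarrow> 0"
proof (rule Lim_null_comparison)
  show "\<forall>\<^sub>F m in sequentially. norm (residual F m \<zeta>) \<le> norm (coef m) * hardy_norm \<Gamma> (\<lambda>w. szego_kernel \<Gamma> w \<zeta>)"
    by (intro always_eventually allI residual_pointwise_le assms)
  have "(\<lambda>m. sqrt ((norm (coef m))\<^sup>2)) \<longlonglongrightarrow> sqrt 0"
    by (intro tendsto_intros summable_LIMSEQ_zero coef_summable)
  then show "(\<lambda>m. norm (coef m) * hardy_norm \<Gamma> (\<lambda>w. szego_kernel \<Gamma> w \<zeta>)) \<longlonglongrightarrow> 0"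
    by (intro tendsto_mult_left_zero) simp
qed

text \<open>The residuals tend to 0 off a countable set, so Fatou's lemma on each slice bounds the norm
  of a residual by its distances to the later ones.\<close>

lemma residual_norm_le_tail: "(hardy_norm \<Gamma> (residual F m))\<^sup>2 \<le> (\<Sum>j. (norm (coef (j + m)))\<^sup>2)"
proof (rule hardy_norm_sq_leI(2))
  let ?T = "\<Sum>j. (norm (coef (j + m)))\<^sup>2"
  have sm: "summable (\<lambda>j. (norm (coef (j + m)))\<^sup>2)" using coef_summable by (rule summable_ignore_initial_segment)
  show "0 \<le> ?T" by (rule suminf_nonneg[OF sm]) simp
  fix y assume y: "y \<in> \<Gamma>"
  note [measurable] = square_integrable_slice[OF residual_in_hardy_space[OF F] y]
  \<comment> \<open>On a fixed slice a point of the sequence is determined by its real part, so the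
    exceptional set is countable and hence null.\<close>
  have "countable ((\<lambda>x. cpoint x y) -` range z)"
  proof (rule countable_subset)
    show "(\<lambda>x. cpoint x y) -` range z \<subseteq> range (\<lambda>m. revec (z m))"
      by (auto simp: image_iff) (metis revec_cpoint)
  qed simp
  then have "AE x in lborel. x \<notin> (\<lambda>x. cpoint x y) -` range z"
    by (intro AE_not_in countable_imp_null_set_lborel)
  then have ae: "AE x in lborel. (\<lambda>k. residual F k (cpoint x y)) \<longlonglongrightarrow> 0"
    by eventually_elim (auto intro!: residual_tendsto_0 simp: y)
  show "nn_energy (\<lambda>x. residual F m (cpoint x y)) \<le> ennreal ?T"
  proof (rule L2_Fatou)
    show "AE x in lborel. (\<lambda>k. residual F m (cpoint x y) - residual F k (cpoint x y)) \<longlonglongrightarrow> residual F m (cpoint x y)"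
      using ae by eventually_elim (auto dest: tendsto_diff[OF tendsto_const])
    show "(\<lambda>x. residual F m (cpoint x y) - residual F k (cpoint x y)) \<in> borel_measurable borel" for k
      by measurable
    fix k assume k: "m \<le> k"
    have "nn_energy (\<lambda>x. residual F m (cpoint x y) - residual F k (cpoint x y)) \<le>
        ennreal ((hardy_norm \<Gamma> (\<lambda>w. residual F m w - residual F k w))\<^sup>2)"
      by (rule hardy_slice_nn_le[OF hardy_space_diff[OF cone residual_in_hardy_space[OF F] residual_in_hardy_space[OF F]] y])
    also have "(hardy_norm \<Gamma> (\<lambda>w. residual F m w - residual F k w))\<^sup>2 = (\<Sum>j<k - m. (norm (coef (j + m)))\<^sup>2)"
      unfolding residual_norm_diff[OF k]
      using sum.shift_bounds_nat_ivl[of "\<lambda>j. (norm (coef j))\<^sup>2" 0 m "k - m"] k by (simp add: atLeast0LessThan)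
    also have "\<dots> \<le> ?T" by (rule sum_le_suminf[OF sm]) auto
    finally show "nn_energy (\<lambda>x. residual F m (cpoint x y) - residual F k (cpoint x y)) \<le> ennreal ?T"
      by (simp add: ennreal_leI)
  qed
qed

lemma residual_norm_tendsto_0: "(\<lambda>m. hardy_norm \<Gamma> (residual F m)) \<longlonglongrightarrow> 0"
proof (rule Lim_null_comparison)
  show "\<forall>\<^sub>F m in sequentially. norm (hardy_norm \<Gamma> (residual F m)) \<le> sqrt (\<Sum>j. (norm (coef (j + m)))\<^sup>2)"
    by (intro always_eventually allI) (simp add: real_le_rsqrt residual_norm_le_tail)
  have "(\<lambda>m. sqrt (\<Sum>j. (norm (coef (j + m)))\<^sup>2)) \<longlonglongrightarrow> sqrt 0"
    by (intro tendsto_intros suminf_exist_split2 coef_summable)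
  then show "(\<lambda>m. sqrt (\<Sum>j. (norm (coef (j + m)))\<^sup>2)) \<longlonglongrightarrow> 0" by simp
qed

end

theorem mainTheorem2:
  fixes \<Gamma> :: "(real^'n) set"
    and d :: "complex^'n"
    and F :: "complex^'n \<Rightarrow> complex"
    and z :: "nat \<Rightarrow> complex^'n"
  assumes "regular_cone \<Gamma>"
    and "\<And>y' x. y' \<in> \<Gamma> \<Longrightarrow>
           ((\<lambda>y. szego_kernel \<Gamma> (cpoint x y) (cpoint x y)) \<longlongrightarrow> 0)
             (inf at_infinity (principal (closure ((\<lambda>v. y' + v) ` \<Gamma>))))"
    and "(\<Sum>j\<in>UNIV. (norm (d $ j))\<^sup>2) = 1"
    and "F \<in> hardy_space \<Gamma>"
    and "maximal_selection \<Gamma> d F z"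
  shows "(\<lambda>m. hardy_norm \<Gamma>
            (\<lambda>w. F w - (\<Sum>k<m. hardy_inner \<Gamma> F (onsys \<Gamma> d z k) * onsys \<Gamma> d z k w)))
         \<longlonglongrightarrow> 0"
proof -
  interpret maximal_selection_setting \<Gamma> d F z
    by unfold_locales (use assms in auto)
  show ?thesis
    using residual_norm_tendsto_0 by (simp add: residual_def)
qed

end
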